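(* Let $\tau\in\mathbb{H}$, $q=e^{2\pi i\tau}$, and define $$K'(w;\tau)=\sum_{n\ge0}\frac{(-1)^nq^{n^2}(q;q^2)_n}{(wq^2;q^2)_n(q^2/w;q^2)_n},\qquad K''(w;\tau)=\sum_{n\ge1}\frac{(-1)^nq^{n^2}(q;q^2)_{n-1}}{(wq;q^2)_n(q/w;q^2)_n}.$$ Let $\alpha$ be any complex number with $\alpha\neq m\tau+n$ for all $m,n\in\mathbb{Z}$, and put $w=e^{2\pi i\alpha}$, $w^{1/2}:=e^{\pi i\alpha}$. Then $$\frac{q^{-1/8}}{w^{-1/2}-w^{1/2}}K'(w;\tau)+q^{-1/8}\bigl(w^{1/2}-w^{-1/2}\bigr)K''(w;\tau)=\frac{\eta^4(\tau)}{\eta^2(2\tau)\,\vartheta(\alpha;\tau)},$$ a meromorphic Jacobi form. If $\alpha=r\tau+s$ with $r,s\in\mathbb{Q}$, then this function multiplied by $q^{-r^2/2}$ is a weakly holomorphic modular form of weight $1/2$ on a subgroup of $SL_2(\mathbb{Z})$ depending on $r$.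
   Context: Notation: for $\lambda\in\mathbb{Q}$, $q^\lambda:=e^{2\pi i\lambda\tau}$. $(a;q)_0=1$, $(a;q)_n=\prod_{j=0}^{n-1}(1-aq^j)$, and $(a;q^2)_n=\prod_{j=0}^{n-1}(1-aq^{2j})$. $\eta(\tau)=q^{1/24}\prod_{n\ge1}(1-q^n)$. $\vartheta(z;\tau)=\sum_{n\in\mathbb{Z}}(-1)^n e^{\pi i(2n+1)z}q^{n(n+1)/2+1/8}$.
   Formalization: The right-hand side carries a minus sign, since with the stated ϑ the printed identity is off by a global sign; the finite-index subgroup depends on both r and s, since none depending on r alone serves every s (e.g. r=0, s=1/N). *)

theory Defs
  imports "HOL-Complex_Analysis.Complex_Analysis" "HOL-Algebra.Coset"
begin

section \<open>q-series, eta and theta\<close>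

definition upper_half_plane :: "complex set" where
  "upper_half_plane = {\<tau>. 0 < Im \<tau>}"

text \<open>\<open>qpow \<tau> \<lambda>\<close> is \<open>q\<close> to the power \<open>\<lambda>\<close>; it depends on \<open>\<tau>\<close> and not only on \<open>q = qpow \<tau> 1\<close>.\<close>

definition qpow :: "complex \<Rightarrow> real \<Rightarrow> complex" where
  "qpow \<tau> l = exp (2 * of_real pi * \<i> * of_real l * \<tau>)"

definition qpoch :: "complex \<Rightarrow> complex \<Rightarrow> nat \<Rightarrow> complex" where
  "qpoch a q n = (\<Prod>j<n. 1 - a * q ^ j)"

definition eta :: "complex \<Rightarrow> complex" where
  "eta \<tau> = qpow \<tau> (1/24) * (\<Prod>n. 1 - qpow \<tau> 1 ^ (n + 1))"

definition theta :: "complex \<Rightarrow> complex \<Rightarrow> complex" where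
  "theta z \<tau> = (\<Sum>\<^sub>\<infinity>n::int. (-1) powi n * exp (of_real pi * \<i> * of_int (2*n+1) * z)
                  * qpow \<tau> (of_int (n*(n+1)) / 2 + 1/8))"

definition K1 :: "complex \<Rightarrow> complex \<Rightarrow> complex" where
  "K1 w \<tau> = (let q = qpow \<tau> 1 in
     \<Sum>\<^sub>\<infinity>n::nat. (-1)^n * q^(n^2) * qpoch q (q^2) n
        / (qpoch (w * q^2) (q^2) n * qpoch (q^2 / w) (q^2) n))"

definition K2 :: "complex \<Rightarrow> complex \<Rightarrow> complex" where
  "K2 w \<tau> = (let q = qpow \<tau> 1 in
     \<Sum>\<^sub>\<infinity>n\<in>{1::nat..}. (-1)^n * q^(n^2) * qpoch q (q^2) (n - 1)
        / (qpoch (w * q) (q^2) n * qpoch (q / w) (q^2) n))"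

text \<open>
  Here \<open>h\<close> is the square root \<open>exp (\<pi> \<i> \<alpha>)\<close> of \<open>w = exp (2 \<pi> \<i> \<alpha>)\<close>. As \<open>q\<close> tends to 0,
  \<open>K_comb \<alpha> \<tau>\<close> behaves like \<open>q\<close> to the power \<open>-1/8\<close> times \<open>1 / (1/h - h)\<close>, whereas
  \<open>theta \<alpha> \<tau>\<close> behaves like \<open>q\<close> to the power \<open>1/8\<close> times \<open>h - 1/h\<close>. Thus, with this
  normalisation of \<open>theta\<close>, \<open>K_comb\<close> is minus the quotient
  \<open>eta \<tau> ^ 4 / (eta (2 * \<tau>) ^ 2 * theta \<alpha> \<tau>)\<close>.
\<close>

definition K_comb :: "complex \<Rightarrow> complex \<Rightarrow> complex" where
  "K_comb \<alpha> \<tau> = (let w = exp (2 * of_real pi * \<i> * \<alpha>); h = exp (of_real pi * \<i> * \<alpha>) in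
     qpow \<tau> (-1/8) / (1/h - h) * K1 w \<tau> + qpow \<tau> (-1/8) * (h - 1/h) * K2 w \<tau>)"


section \<open>The modular group\<close>

definition SL2Z :: "(int^2^2) monoid" where
  "SL2Z = \<lparr>carrier = {A. det A = 1}, mult = (**), one = mat 1\<rparr>"

definition finite_index_subgroup :: "(int^2^2) set \<Rightarrow> bool" where
  "finite_index_subgroup \<Gamma> \<longleftrightarrow> subgroup \<Gamma> SL2Z \<and> finite (rcosets\<^bsub>SL2Z\<^esub> \<Gamma>)"

definition Gamma0_4 :: "(int^2^2) set" where
  "Gamma0_4 = {A \<in> carrier SL2Z. 4 dvd A $ 2 $ 1}"

definition moebius :: "int^2^2 \<Rightarrow> complex \<Rightarrow> complex" where
  "moebius A \<tau> = (of_int (A$1$1) * \<tau> + of_int (A$1$2)) / (of_int (A$2$1) * \<tau> + of_int (A$2$2))"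

definition cocyc :: "int^2^2 \<Rightarrow> complex \<Rightarrow> complex" where
  "cocyc A \<tau> = of_int (A$2$1) * \<tau> + of_int (A$2$2)"

text \<open>
  Shimura's automorphy factor of weight \<open>1/2\<close> on \<open>Gamma0_4\<close>, by means of the classical theta
  series; half-integral weights are taken with respect to it.
\<close>

definition theta0 :: "complex \<Rightarrow> complex" where
  "theta0 \<tau> = (\<Sum>\<^sub>\<infinity>n::int. qpow \<tau> (of_int (n^2)))"

definition shimura_j :: "int^2^2 \<Rightarrow> complex \<Rightarrow> complex" where
  "shimura_j A \<tau> = theta0 (moebius A \<tau>) / theta0 \<tau>"


section \<open>Weakly holomorphic modular forms of half-integral weight\<close>

text \<open>
  The weight is \<open>k/2\<close>. The last clause is meromorphy at all cusps. The principal branch of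
  \<open>powr\<close> is harmless there: another branch changes the expansion by a constant factor only.
\<close>

definition weakly_holomorphic_modform ::
    "(int^2^2) set \<Rightarrow> int \<Rightarrow> (complex \<Rightarrow> complex) \<Rightarrow> bool" where
  "weakly_holomorphic_modform \<Gamma> k f \<longleftrightarrow>
     finite_index_subgroup \<Gamma> \<and> \<Gamma> \<subseteq> Gamma0_4 \<and>
     f holomorphic_on upper_half_plane \<and>
     (\<forall>A\<in>\<Gamma>. \<forall>\<tau>\<in>upper_half_plane. f (moebius A \<tau>) = shimura_j A \<tau> powi k * f \<tau>) \<and>
     (\<forall>A\<in>carrier SL2Z. \<exists>N>0. \<exists>n0::int. \<exists>c::nat \<Rightarrow> complex. \<forall>\<tau>\<in>upper_half_plane.
        (\<lambda>n. c n * qpow \<tau> (of_int (n0 + int n) / real N))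
          sums (cocyc A \<tau> powr (- of_int k / 2) * f (moebius A \<tau>)))"


section \<open>Meromorphic Jacobi forms\<close>

definition holomorphic2 :: "(complex \<times> complex \<Rightarrow> complex) \<Rightarrow> (complex \<times> complex) set \<Rightarrow> bool" where
  "holomorphic2 f U \<longleftrightarrow>
     (\<forall>p\<in>U. \<exists>a b. (f has_derivative (\<lambda>(u, v). a * u + b * v)) (at p))"

text \<open>
  Meromorphic functions of two variables on an open set: locally quotients of holomorphic
  functions, with a denominator that vanishes identically on no nonempty open set.
\<close>

definition meromorphic2 :: "(complex \<times> complex \<Rightarrow> complex) \<Rightarrow> (complex \<times> complex) set \<Rightarrow> bool" where
  "meromorphic2 f U \<longleftrightarrow>
     (\<forall>p\<in>U. \<exists>V g h. open V \<and> p \<in> V \<and> V \<subseteq> U \<and> holomorphic2 g V \<and> holomorphic2 h V \<and>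
        (\<forall>W. open W \<and> W \<noteq> {} \<and> W \<subseteq> V \<longrightarrow> (\<exists>x\<in>W. h x \<noteq> 0)) \<and>
        (\<forall>x\<in>V. h x \<noteq> 0 \<longrightarrow> f x = g x / h x))"

text \<open>
  The weight is \<open>k/2\<close> and the index is \<open>m/2\<close>. The sign in the elliptic transformation law is the
  usual character for half-integral index; it is trivial for integral index. The last clause is
  meromorphy at the cusps: every \<open>SL2Z\<close>-translate, as a function of \<open>z\<close> and a fractional power of
  \<open>q\<close>, extends meromorphically to \<open>q = 0\<close>. The laws are also imposed at poles, where a
  quotient takes the value 0 by the convention \<open>x / 0 = 0\<close>.
\<close>

definition meromorphic_jacobi_form ::
    "(int^2^2) set \<Rightarrow> int \<Rightarrow> int \<Rightarrow> (complex \<Rightarrow> complex \<Rightarrow> complex) \<Rightarrow> bool" where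
  "meromorphic_jacobi_form \<Gamma> k m \<phi> \<longleftrightarrow>
     finite_index_subgroup \<Gamma> \<and> \<Gamma> \<subseteq> Gamma0_4 \<and>
     meromorphic2 (\<lambda>(z, \<tau>). \<phi> z \<tau>) (UNIV \<times> upper_half_plane) \<and>
     (\<forall>A\<in>\<Gamma>. \<forall>z. \<forall>\<tau>\<in>upper_half_plane.
        \<phi> (z / cocyc A \<tau>) (moebius A \<tau>) =
          shimura_j A \<tau> powi k * exp (of_real pi * \<i> * of_int (m * A$2$1) * z^2 / cocyc A \<tau>) * \<phi> z \<tau>) \<and>
     (\<forall>l n::int. \<forall>z. \<forall>\<tau>\<in>upper_half_plane.
        \<phi> (z + of_int l * \<tau> + of_int n) \<tau> =
          (-1) powi (m * (l + n)) * exp (- of_real pi * \<i> * of_int m * (of_int (l^2) * \<tau> + 2 * of_int l * z))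
            * \<phi> z \<tau>) \<and>
     (\<forall>A\<in>carrier SL2Z. \<exists>N>0. \<exists>\<Phi>. meromorphic2 \<Phi> (UNIV \<times> ball 0 1) \<and>
        (\<forall>z. \<forall>\<tau>\<in>upper_half_plane.
           cocyc A \<tau> powr (- of_int k / 2) * exp (- of_real pi * \<i> * of_int (m * A$2$1) * z^2 / cocyc A \<tau>)
             * \<phi> (z / cocyc A \<tau>) (moebius A \<tau>) = \<Phi> (z, qpow \<tau> (1 / real N))))"

end

theory Submission
  imports Defs
begin

text \<open>
  Telescoping gives \<open>K'(wq) / (1 - wq) + (w - 1) K''(w) = 1\<close>. Together with the symmetry under
  \<open>w \<mapsto> 1/w\<close> this yields \<open>S(wq) = -w S(w)\<close> for \<open>S = K' / (1 - w) + (1 - 1/w) K''\<close>, so the product of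
  \<open>S\<close> with \<open>(w; q) (q/w; q)\<close> is invariant under \<open>w \<mapsto> wq\<close> and holomorphic on an annulus; by the
  maximum principle it is constant. Its value at \<open>w = 1\<close> is a limiting case of the q-Gauss
  sum, and the triple product turns the result into \<open>eta\<close> and \<open>theta\<close>.

  For the modularity, \<open>eta \<tau> ^ 4 / eta (2 * \<tau>) ^ 2\<close> is the product of two theta constants. Theta
  inversion again follows from double periodicity and the maximum principle, and Jacobi's
  derivative formula fixes its constant. Under the generators of the modular group the theta
  constants run through finite families up to roots of unity, so the transformation laws,
  which involve multipliers, hold on stabilisers of finite index.
\<close>

text \<open>The \<open>$\<close> of formal power series clashes with vector indexing and makes parsing exponential.\<close>

no_notation fps_nth (infixl \<open>$\<close> 75)

text \<open>The function \<open>S\<close> has a pole at w = 1. In \<open>KZ\<close> the factor 1 - w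
  of (w; q) is cancelled against it, so that w = 1 becomes an interior point of the annulus and also
  the point of evaluation, where the \<open>KB\<close> term drops out.

  For the modularity the obstacle is the branch of the square root. No multiplier is computed: for
  each matrix one continuous function \<open>J\<close> serves \<open>theta\<close> and
  \<open>theta0\<close> as J and the product th3 th4 as J^2, so it cancels in th3 th4 / (theta0
  theta). Moreover Shimura's factor is itself a quotient of two values of \<open>theta0\<close>, so
  the law of weight 1/2 is plain invariance of the quotient by \<open>theta0\<close>. Such quotients
  have finite orbits, and the orbit-stabiliser argument yields the group. Only the expansions at the
  cusps involve a branch; there J is a constant times the principal square root, because the upper
  half-plane is connected.\<close>

abbreviation pii :: complex where "pii \<equiv> of_real pi * \<i>"

section \<open>q-Pochhammer symbols\<close>

text \<open>The exponent grows by at least n at step n, so consecutive ratios are at most B r^n and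
  tend to 0. Any geometric factor B^n is thereby absorbed; this is the source of nearly all
  majorants below.\<close>

lemma summable_power_superlinear:
  fixes B r :: real and e :: "nat \<Rightarrow> nat"
  assumes r: "0 \<le> r" "r < 1" and B: "0 \<le> B" and e: "\<And>n. e n + n \<le> e (Suc n)"
  shows "summable (\<lambda>n. B ^ n * r ^ e n)"
proof -
  have "(\<lambda>n. B * r ^ n) \<longlonglongrightarrow> B * 0"
    using r by (intro tendsto_intros LIMSEQ_power_zero) auto
  then have "\<forall>\<^sub>F n in sequentially. B * r ^ n < 1/2"
    by (rule order_tendstoD) simp
  then obtain N where N: "\<And>n. n \<ge> N \<Longrightarrow> B * r ^ n < 1/2"
    by (auto simp: eventually_sequentially)
  show ?thesis
  proof (rule summable_ratio_test[where c = "1/2" and N = N])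
    fix n assume "n \<ge> N"
    have "r ^ e (Suc n) \<le> r ^ (e n + n)"
      using r e by (intro power_decreasing) auto
    then have "B ^ Suc n * r ^ e (Suc n) \<le> B ^ Suc n * r ^ (e n + n)"
      using B by (intro mult_left_mono) auto
    also have "\<dots> = (B * r ^ n) * (B ^ n * r ^ e n)"
      by (simp add: power_add)
    also have "\<dots> \<le> 1/2 * (B ^ n * r ^ e n)"
      using N[OF \<open>n \<ge> N\<close>] r B by (intro mult_right_mono) auto
    finally show "norm (B ^ Suc n * r ^ e (Suc n)) \<le> 1/2 * norm (B ^ n * r ^ e n)"
      using r B by simp
  qed simp
qed

lemma tendsto_nonzero_bounded_below:
  fixes X :: "nat \<Rightarrow> 'a::real_normed_field"
  assumes "X \<longlonglongrightarrow> L" "L \<noteq> 0" "\<And>n. X n \<noteq> 0"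
  obtains d where "0 < d" "\<And>n. d \<le> norm (X n)"
proof -
  have "(\<lambda>n. inverse (X n)) \<longlonglongrightarrow> inverse L"
    using assms by (intro tendsto_inverse)
  then have "Bseq (\<lambda>n. inverse (X n))"
    by (rule convergent_imp_Bseq[OF convergentI])
  then obtain M where M: "M > 0" "\<And>n. norm (inverse (X n)) \<le> M"
    by (auto simp: Bseq_def)
  show ?thesis
  proof (rule that[of "1/M"])
    fix n
    have "inverse (norm (X n)) \<le> M"
      using M(2)[of n] by (simp add: norm_inverse)
    then show "1/M \<le> norm (X n)"
      using M(1) assms(3)[of n] by (simp add: field_simps)
  qed (use M in simp)
qed

definition qinf :: "complex \<Rightarrow> complex \<Rightarrow> complex" where
  "qinf a q = (\<Prod>n. 1 - a * q ^ n)"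

lemma qpoch_0 [simp]: "qpoch a q 0 = 1"
  by (simp add: qpoch_def)

lemma qpoch_Suc: "qpoch a q (Suc n) = qpoch a q n * (1 - a * q ^ n)"
  by (simp add: qpoch_def)

lemma qpoch_rec: "qpoch a q (Suc n) = (1 - a) * qpoch (a * q) q n"
  unfolding qpoch_def prod.lessThan_Suc_shift by (simp add: mult_ac)

lemma qpoch_add: "qpoch a q (m + n) = qpoch a q m * qpoch (a * q ^ m) q n"
  by (induction n) (simp_all add: qpoch_Suc power_add mult_ac)

lemma norm_qpoch_le:
  assumes "norm q \<le> 1"
  shows "norm (qpoch a q n) \<le> (1 + norm a) ^ n"
proof -
  have "norm (1 - a * q ^ j) \<le> 1 + norm a" for j
  proof -
    have "norm (1 - a * q ^ j) \<le> 1 + norm a * norm q ^ j"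
      by (metis norm_mult norm_one norm_power norm_triangle_ineq4)
    also have "norm a * norm q ^ j \<le> norm a * 1"
      using assms by (intro mult_left_mono power_le_one) auto
    finally show ?thesis by simp
  qed
  then show ?thesis
    unfolding qpoch_def prod_norm[symmetric] using prod_mono[of "{..<n}" "\<lambda>j. norm (1 - a * q ^ j)" "\<lambda>_. 1 + norm a"]
    by simp
qed

lemma norm_qpoch_ge:
  assumes "0 \<le> d" "\<And>k. d \<le> norm (1 - a * q ^ k)"
  shows "d ^ n \<le> norm (qpoch a q n)"
  unfolding qpoch_def prod_norm[symmetric] using prod_mono[of "{..<n}" "\<lambda>_. d" "\<lambda>j. norm (1 - a * q ^ j)"] assms
  by simp

lemma qpoch_eq_0_iff: "qpoch a q n = 0 \<longleftrightarrow> (\<exists>k<n. a * q ^ k = 1)"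
  by (auto simp: qpoch_def)

section \<open>The infinite product (a; q) and its dependence on a\<close>

context
  fixes q :: complex
  assumes q: "norm q < 1"
begin

lemma convergent_prod_q: "convergent_prod (\<lambda>n. 1 - a * q ^ n)"
proof -
  have "summable (\<lambda>n. norm a * norm q ^ n)"
    using q by (intro summable_mult summable_geometric) simp
  then have "summable (\<lambda>n. norm ((1 - a * q ^ n) - 1))"
    by (simp add: norm_mult norm_power)
  then show ?thesis
    by (intro abs_convergent_prod_imp_convergent_prod summable_imp_abs_convergent_prod)
qed

lemma qpoch_tendsto: "(\<lambda>n. qpoch a q n) \<longlonglongrightarrow> qinf a q"
  using convergent_prod_LIMSEQ[OF convergent_prod_q[of a]]
  unfolding qpoch_def qinf_def by (simp add: LIMSEQ_lessThan_iff_atMost)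

lemma qinf_nonzero: "(\<And>k. a * q ^ k \<noteq> 1) \<Longrightarrow> qinf a q \<noteq> 0"
  unfolding qinf_def by (rule prodinf_nonzero[OF convergent_prod_q]) (metis right_minus_eq)

lemma qinf_rec: "qinf a q = (1 - a) * qinf (a * q) q"
proof -
  have "(\<lambda>n. qpoch a q (Suc n)) \<longlonglongrightarrow> (1 - a) * qinf (a * q) q"
    unfolding qpoch_rec by (intro tendsto_intros qpoch_tendsto)
  moreover have "(\<lambda>n. qpoch a q (Suc n)) \<longlonglongrightarrow> qinf a q"
    using qpoch_tendsto by (rule LIMSEQ_Suc)
  ultimately show ?thesis by (rule LIMSEQ_unique[symmetric])
qed

text \<open>The factors tend to 1 and none vanishes, so one d > 0 bounds them all from below. A
  finite Pochhammer symbol in a denominator then costs only d^n, which a quadratic exponent of q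
  outweighs.\<close>

lemma qinf_bounded_factors:
  assumes "\<And>k. a * q ^ k \<noteq> 1"
  obtains d where "0 < d" "\<And>k. d \<le> norm (1 - a * q ^ k)"
proof (rule tendsto_nonzero_bounded_below[of "\<lambda>k. 1 - a * q ^ k" 1])
  have "(\<lambda>k. 1 - a * q ^ k) \<longlonglongrightarrow> 1 - a * 0"
    using q by (intro tendsto_intros LIMSEQ_power_zero)
  then show "(\<lambda>k. 1 - a * q ^ k) \<longlonglongrightarrow> 1" by simp
  show "1 - a * q ^ k \<noteq> 0" for k using assms[of k] by (metis right_minus_eq)
qed (use that in auto)

lemma qpow_neq_1: "q ^ Suc k \<noteq> 1"
proof
  assume "q ^ Suc k = 1"
  then have "norm q ^ Suc k = 1" by (metis norm_one norm_power)
  moreover have "norm q ^ Suc k < 1" using q power_Suc_less_one[of "norm q" k]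
    by (cases "norm q = 0") auto
  ultimately show False by simp
qed

lemma qpoch_q_nonzero [simp]: "qpoch q q n \<noteq> 0"
  using qpow_neq_1 by (auto simp: qpoch_eq_0_iff)

lemma qinf_q_nonzero: "qinf q q \<noteq> 0"
  using qpow_neq_1 by (intro qinf_nonzero) auto

lemma holomorphic_qinf: "(\<lambda>a. qinf a q) holomorphic_on UNIV"
proof -
  have "(\<lambda>a. qinf a q) holomorphic_on ball 0 R" for R
  proof -
    have "uniformly_convergent_on (cball 0 R) (\<lambda>N a. \<Prod>n<N. 1 - a * q ^ n)"
    proof (rule uniformly_convergent_on_prod'[where f = "\<lambda>n a. 1 - a * q ^ n"])
      show "uniformly_convergent_on (cball 0 R) (\<lambda>N a. \<Sum>n<N. norm (1 - a * q ^ n - 1))"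
      proof (rule Weierstrass_m_test'[where M = "\<lambda>n. R * norm q ^ n"])
        show "norm (norm (1 - a * q ^ n - 1)) \<le> R * norm q ^ n" if "a \<in> cball 0 R" for n a
          using that by (auto simp: norm_mult norm_power intro!: mult_right_mono)
        show "summable (\<lambda>n. R * norm q ^ n)"
          using q by (intro summable_mult summable_geometric) simp
      qed
    qed (auto intro!: continuous_intros)
    then obtain l where l: "uniform_limit (cball 0 R) (\<lambda>N a. \<Prod>n<N. 1 - a * q ^ n) l sequentially"
      by (auto simp: uniformly_convergent_on_def)
    have "l a = qinf a q" if "a \<in> ball 0 R" for a
      using tendsto_uniform_limitI[OF l, of a] that qpoch_tendsto[of a]
      unfolding qpoch_def by (intro LIMSEQ_unique) auto
    moreover have "l holomorphic_on ball 0 R"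
      by (rule holomorphic_uniform_limit[OF _ l])
         (auto intro!: continuous_intros holomorphic_intros always_eventually)
    ultimately show ?thesis by (rule holomorphic_transform[rotated])
  qed
  then have "(\<lambda>a. qinf a q) field_differentiable at a" for a
    using holomorphic_on_imp_differentiable_at[of _ "ball 0 (norm a + 1)" a] by auto
  then show ?thesis by (simp add: holomorphic_on_def field_differentiable_at_within)
qed

end

text \<open>Separate odd from even exponents in the product of the 1 - q^n; for finite products with
  2 n factors this is exact.\<close>

lemma qinf_square:
  assumes "norm q < 1"
  shows "qinf q q = qinf q (q\<^sup>2) * qinf (q\<^sup>2) (q\<^sup>2)"
proof -
  have q2: "norm (q\<^sup>2) < 1"
    using assms by (simp add: norm_power power_less_one_iff)
  have 1: "qpoch q q (2 * n) = qpoch q (q\<^sup>2) n * qpoch (q\<^sup>2) (q\<^sup>2) n" for n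
  proof (induction n)
    case (Suc n)
    have "qpoch q q (2 * Suc n) = qpoch q q (2 * n) * ((1 - q * q ^ (2 * n)) * (1 - q * q ^ Suc (2 * n)))"
      by (simp add: qpoch_Suc)
    also have "q ^ Suc (2 * n) = q * (q\<^sup>2) ^ n" by (simp add: power_mult)
    also have "q ^ (2 * n) = (q\<^sup>2) ^ n" by (simp add: power_mult)
    finally show ?case unfolding Suc qpoch_Suc by (simp add: power2_eq_square mult_ac)
  qed simp
  have "(\<lambda>n. qpoch q q (2 * n)) \<longlonglongrightarrow> qinf q q"
    using LIMSEQ_subseq_LIMSEQ[OF qpoch_tendsto[OF assms], of "\<lambda>n. 2 * n"]
    by (simp add: strict_mono_def o_def)
  moreover have "(\<lambda>n. qpoch q q (2 * n)) \<longlonglongrightarrow> qinf q (q\<^sup>2) * qinf (q\<^sup>2) (q\<^sup>2)"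
    unfolding 1 by (intro tendsto_intros qpoch_tendsto[OF q2])
  ultimately show ?thesis by (rule LIMSEQ_unique)
qed

lemma qinf_mult_minus:
  assumes "norm q < 1"
  shows "qinf a q * qinf (-a) q = qinf (a\<^sup>2) (q\<^sup>2)"
proof -
  have q2: "norm (q\<^sup>2) < 1" using assms by (simp add: norm_power power_less_one_iff)
  have 2: "qpoch a q n * qpoch (-a) q n = qpoch (a\<^sup>2) (q\<^sup>2) n" for n
    unfolding qpoch_def prod.distrib[symmetric]
    by (intro prod.cong) (auto simp: algebra_simps power2_eq_square power_mult_distrib)
  have "(\<lambda>n. qpoch a q n * qpoch (-a) q n) \<longlonglongrightarrow> qinf a q * qinf (-a) q"
    by (intro tendsto_intros qpoch_tendsto[OF assms])
  then show ?thesis unfolding 2 by (rule LIMSEQ_unique[OF _ qpoch_tendsto[OF q2]])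
qed

section \<open>The Jacobi triple product\<close>

text \<open>Gaussian binomial coefficients, by a q-Pascal rule rather than as quotients, so that no
  denominators occur. The truncated difference \<open>n - k\<close> does no harm: for k > n its
  cofactor \<open>qbinom q n k\<close> is 0.\<close>

fun qbinom :: "complex \<Rightarrow> nat \<Rightarrow> nat \<Rightarrow> complex" where
  "qbinom q n 0 = 1"
| "qbinom q 0 (Suc k) = 0"
| "qbinom q (Suc n) (Suc k) = qbinom q n (Suc k) + q ^ (n - k) * qbinom q n k"

lemma qbinom_eq_0: "n < k \<Longrightarrow> qbinom q n k = 0"
  by (induction q n k rule: qbinom.induct) auto

lemma qbinom_qpoch:
  "k \<le> n \<Longrightarrow> qbinom q n k * (qpoch q q k * qpoch q q (n - k)) = qpoch q q n"
proof (induction q n k rule: qbinom.induct)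
  case (3 q n k)
  show ?case
  proof (cases "k = n")
    case True
    with 3(2)[of] show ?thesis by (auto simp: qbinom_eq_0 qpoch_Suc)
  next
    case False
    with 3 have k: "k < n" by simp
    have e: "n - k = Suc (n - Suc k)" using k by simp
    have IH1: "qbinom q n (Suc k) * (qpoch q q (Suc k) * qpoch q q (n - Suc k)) = qpoch q q n"
      using 3 k by simp
    have IH2: "qbinom q n k * (qpoch q q k * qpoch q q (n - k)) = qpoch q q n"
      using 3 k by simp
    have "qbinom q (Suc n) (Suc k) * (qpoch q q (Suc k) * qpoch q q (Suc n - Suc k)) =
        (qbinom q n (Suc k) * (qpoch q q (Suc k) * qpoch q q (n - Suc k))) * (1 - q ^ (n - k))
        + q ^ (n - k) * (1 - q ^ Suc k) * (qbinom q n k * (qpoch q q k * qpoch q q (n - k)))"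
      by (simp add: qpoch_Suc e algebra_simps)
    also have "\<dots> = qpoch q q n * (1 - q ^ (n - k) * q ^ Suc k)"
      unfolding IH1 IH2 by (simp add: algebra_simps)
    also have "q ^ (n - k) * q ^ Suc k = q * q ^ n"
      using k by (simp flip: power_add power_Suc)
    finally show ?thesis by (simp add: qpoch_Suc)
  qed
qed auto

text \<open>The finite q-binomial theorem. Multiplication by the last factor 1 - x q^n is,
  coefficient by coefficient, the q-Pascal rule, since q^n = q^k q^(n-k).\<close>

lemma qpoch_expansion:
  "qpoch x q n = (\<Sum>k\<le>n. (-1) ^ k * q ^ (k * (k - 1) div 2) * qbinom q n k * x ^ k)"
proof (induction n)
  case (Suc n)
  let ?c = "\<lambda>n k. (-1) ^ k * q ^ (k * (k - 1) div 2) * qbinom q n k * x ^ k"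
  have step: "?c (Suc n) (Suc k) = ?c n (Suc k) - x * q ^ n * ?c n k" if "k \<le> n" for k
  proof -
    have "Suc k * (Suc k - 1) = k * (k - 1) + 2 * k" by (cases k) auto
    then have "Suc k * (Suc k - 1) div 2 = k * (k - 1) div 2 + k" by simp
    moreover have "q ^ n = q ^ k * q ^ (n - k)" using that by (simp flip: power_add)
    ultimately show ?thesis by (simp add: power_add algebra_simps)
  qed
  have "(\<Sum>k\<le>Suc n. ?c (Suc n) k) = ?c (Suc n) 0 + (\<Sum>k\<le>n. ?c (Suc n) (Suc k))"
    by (rule sum.atMost_Suc_shift)
  also have "\<dots> = ?c n 0 + (\<Sum>k\<le>n. ?c n (Suc k)) - x * q ^ n * (\<Sum>k\<le>n. ?c n k)"
  proof -
    have "(\<Sum>k\<le>n. ?c (Suc n) (Suc k)) = (\<Sum>k\<le>n. ?c n (Suc k) - x * q ^ n * ?c n k)"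
      by (intro sum.cong refl step) simp
    then show ?thesis by (simp only: sum_subtractf sum_distrib_left) simp
  qed
  also have "?c n 0 + (\<Sum>k\<le>n. ?c n (Suc k)) = (\<Sum>k\<le>Suc n. ?c n k)"
    by (rule sum.atMost_Suc_shift[symmetric])
  also have "\<dots> = (\<Sum>k\<le>n. ?c n k)" by (simp add: qbinom_eq_0)
  finally show ?case using Suc by (simp add: qpoch_Suc algebra_simps)
qed simp

text \<open>Indices are paired by reflection about the middle; this folds the finite counterpart of
  a bilateral sum into a sum over n \<ge> 0.\<close>

lemma sum_symmetric_split:
  fixes f :: "nat \<Rightarrow> 'a::comm_monoid_add"
  shows "(\<Sum>m\<le>2 * N + 1. f m) = (\<Sum>n\<le>N. f (N + 1 + n) + f (N - n))"
proof -
  have "(\<Sum>m<Suc N + Suc N. f m) = (\<Sum>m<Suc N. f m) + (\<Sum>n<Suc N. f (Suc N + n))"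
    using sum.atLeastLessThan_concat[of 0 "Suc N" "Suc N + Suc N" f]
      sum.shift_bounds_nat_ivl[of f 0 "Suc N" "Suc N"]
    by (simp add: lessThan_atLeast0 add.commute del: sum.op_ivl_Suc)
  also have "(\<Sum>m<Suc N. f m) = (\<Sum>n<Suc N. f (Suc N - Suc n))"
    by (rule sum.nat_diff_reindex[symmetric])
  finally show ?thesis
    by (simp add: sum.distrib lessThan_Suc_atMost add.commute mult_2)
qed

text \<open>Expand the 2N + 1 factors of \<open>qpoch (w / q ^ N) q (2*N+1)\<close> by the
  q-binomial theorem. They are centred at 1 - w, so the lower half reverses into (q/w; q), and terms
  reflected about the middle share one Gaussian binomial. With w = h^2 each pair becomes an odd
  power of h minus its inverse.\<close>

lemma finite_triple_product:
  fixes h q :: complex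
  assumes h: "h \<noteq> 0" and q: "q \<noteq> 0" "norm q < 1"
  shows "(h - 1/h) * (qpoch (h\<^sup>2 * q) q N * qpoch (q / h\<^sup>2) q N) =
    (\<Sum>n\<le>N. (-1) ^ n * (h ^ (2*n+1) - 1 / h ^ (2*n+1)) * q ^ (n * (n + 1) div 2) * qbinom q (2*N+1) (N - n))"
proof -
  define w where "w = h\<^sup>2"
  have w: "w \<noteq> 0" using h by (simp add: w_def)
  \<comment> \<open>\<open>D\<close> clears the powers q^1, ..., q^N left in the denominators when
    the lower N factors are reversed.\<close>
  define D where "D = q ^ (N * (N + 1) div 2)"
  have D: "D \<noteq> 0" using q by (simp add: D_def)
  have tri: "2 * (m * (m - 1) div 2) = m * (m - 1)" "2 * (m * (m + 1) div 2) = m * (m + 1)" for m :: nat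
    by (cases m; simp)+
  have low: "qpoch (w / q ^ N) q N * D = (-w) ^ N * qpoch (q / w) q N"
  proof -
    have "qpoch (w / q ^ N) q N = (\<Prod>j<N. 1 - w / q ^ N * q ^ (N - Suc j))"
      unfolding qpoch_def by (rule prod.nat_diff_reindex[symmetric])
    also have "\<dots> = (\<Prod>j<N. 1 - w / q ^ Suc j)"
    proof (intro prod.cong refl)
      fix j assume "j \<in> {..<N}"
      then have "N = (N - Suc j) + Suc j" by simp
      then have "q ^ N = q ^ (N - Suc j) * q ^ Suc j" by (metis power_add)
      then show "1 - w / q ^ N * q ^ (N - Suc j) = 1 - w / q ^ Suc j"
        using q by simp
    qed
    also have "\<dots> * q ^ (N * (N + 1) div 2) = (-w) ^ N * qpoch (q / w) q N"
    proof (induction N)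
      case (Suc N)
      have "Suc N * (Suc N + 1) div 2 = N * (N + 1) div 2 + Suc N" by simp
      then have "(\<Prod>j<Suc N. 1 - w / q ^ Suc j) * q ^ (Suc N * (Suc N + 1) div 2) =
          ((\<Prod>j<N. 1 - w / q ^ Suc j) * q ^ (N * (N + 1) div 2)) * ((1 - w / q ^ Suc N) * q ^ Suc N)"
        by (simp only: power_add prod.lessThan_Suc mult_ac)
      also have "(1 - w / q ^ Suc N) * q ^ Suc N = (-w) * (1 - q / w * q ^ N)"
        using q w by (simp add: field_simps)
      finally show ?case unfolding Suc qpoch_Suc by (simp add: mult_ac)
    qed simp
    finally show ?thesis by (simp add: D_def)
  qed
  define f where "f m = (-1) ^ m * q ^ (m * (m - 1) div 2) * qbinom q (2*N+1) m * (w / q ^ N) ^ m" for m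
  have f1: "f (N - n) * D = (-w) ^ N * ((-1) ^ n * q ^ (n * (n + 1) div 2) * qbinom q (2*N+1) (N - n)) / w ^ n"
    if n: "n \<le> N" for n
  proof -
    obtain m where N: "N = m + n" using n by (metis le_add_diff_inverse2)
    have "m * (m - 1) + N * (N + 1) = n * (n + 1) + 2 * (N * m)"
      unfolding N by (cases m) (simp_all add: algebra_simps)
    then have "m * (m - 1) div 2 + N * (N + 1) div 2 = n * (n + 1) div 2 + N * m"
      using tri[of m] tri[of N] tri[of n] by linarith
    then have e: "q ^ (m * (m - 1) div 2) * D = q ^ (n * (n + 1) div 2) * (q ^ N) ^ m"
      unfolding D_def by (simp flip: power_add power_mult)
    have s: "(-1::complex) ^ m = (-1) ^ N * (-1) ^ n"
      unfolding N by (simp add: power_add mult.assoc flip: power_mult_distrib)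
    have "f m * D = (-1) ^ m * (q ^ (m * (m - 1) div 2) * D) * qbinom q (2*N+1) m * w ^ m / (q ^ N) ^ m"
      unfolding f_def by (simp add: power_divide)
    also have "\<dots> = (-1) ^ N * (-1) ^ n * q ^ (n * (n + 1) div 2) * qbinom q (2*N+1) m * w ^ m"
      unfolding e s using q by simp
    also have "w ^ m = w ^ N / w ^ n" unfolding N using w by (simp add: power_add)
    finally show ?thesis by (simp add: N power_minus[of w] mult_ac)
  qed
  have f2: "f (N + 1 + n) * D = - ((-w) ^ N * ((-1) ^ n * q ^ (n * (n + 1) div 2) * qbinom q (2*N+1) (N - n)) * w ^ Suc n)"
    if n: "n \<le> N" for n
  proof -
    let ?m = "N + 1 + n"
    have "?m * (?m - 1) + N * (N + 1) = n * (n + 1) + 2 * (N * ?m)"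
      by (simp add: algebra_simps)
    then have "?m * (?m - 1) div 2 + N * (N + 1) div 2 = n * (n + 1) div 2 + N * ?m"
      using tri[of ?m] tri[of N] tri[of n] by linarith
    then have e: "q ^ (?m * (?m - 1) div 2) * D = q ^ (n * (n + 1) div 2) * (q ^ N) ^ ?m"
      unfolding D_def by (simp flip: power_add power_mult)
    \<comment> \<open>The symmetry of Gaussian binomials: \<open>?m\<close> and \<open>N - n\<close>
      add up to 2N + 1, so both satisfy the same product formula.\<close>
    have "qbinom q (2*N+1) ?m * (qpoch q q ?m * qpoch q q (N - n)) = qpoch q q (2*N+1)"
      using qbinom_qpoch[of ?m "2*N+1" q] n by simp
    moreover have "qbinom q (2*N+1) (N - n) * (qpoch q q (N - n) * qpoch q q ?m) = qpoch q q (2*N+1)"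
      using qbinom_qpoch[of "N - n" "2*N+1" q] n by (simp add: algebra_simps Suc_diff_le)
    ultimately have b: "qbinom q (2*N+1) ?m = qbinom q (2*N+1) (N - n)"
      using qpoch_q_nonzero[OF q(2)] by (metis mult.commute mult_right_cancel mult_eq_0_iff)
    have "f ?m * D = (-1) ^ ?m * (q ^ (?m * (?m - 1) div 2) * D) * qbinom q (2*N+1) ?m * w ^ ?m / (q ^ N) ^ ?m"
      unfolding f_def by (simp add: power_divide)
    also have "\<dots> = (-1) ^ ?m * q ^ (n * (n + 1) div 2) * qbinom q (2*N+1) (N - n) * w ^ ?m"
      unfolding e b using q by simp
    finally show ?thesis by (simp add: power_add power_minus[of w] mult_ac)
  qed
  define c where "c n = (-1) ^ n * q ^ (n * (n + 1) div 2) * qbinom q (2*N+1) (N - n)" for n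
  have "qpoch (w / q ^ N) q (2*N+1) = (\<Sum>n\<le>N. f (N + 1 + n) + f (N - n))"
    unfolding qpoch_expansion f_def[symmetric] by (rule sum_symmetric_split)
  moreover have "qpoch (w / q ^ N) q (2*N+1) = qpoch (w / q ^ N) q N * ((1 - w) * qpoch (w * q) q N)"
  proof -
    have "qpoch (w / q ^ N) q (N + Suc N) = qpoch (w / q ^ N) q N * qpoch w q (Suc N)"
      using qpoch_add[of "w / q ^ N" q N "Suc N"] q by simp
    moreover have "2 * N + 1 = N + Suc N" by simp
    ultimately show ?thesis by (simp only: qpoch_rec)
  qed
  ultimately have "qpoch (w / q ^ N) q N * D * ((1 - w) * qpoch (w * q) q N) = (\<Sum>n\<le>N. f (N + 1 + n) * D + f (N - n) * D)"
    by (simp only: distrib_right[symmetric] sum_distrib_right[symmetric]) (simp only: mult_ac)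
  also have "\<dots> = (\<Sum>n\<le>N. (-w) ^ N * (c n / w ^ n - c n * w ^ Suc n))"
    by (intro sum.cong refl) (simp only: f1 f2 atMost_iff c_def; simp add: algebra_simps)
  finally have "(-w) ^ N * ((1 - w) * (qpoch (w * q) q N * qpoch (q / w) q N)) = (-w) ^ N * (\<Sum>n\<le>N. c n / w ^ n - c n * w ^ Suc n)"
    unfolding low sum_distrib_left by (simp add: mult_ac)
  then have eq: "(1 - w) * (qpoch (w * q) q N * qpoch (q / w) q N) = (\<Sum>n\<le>N. c n / w ^ n - c n * w ^ Suc n)"
    using w by simp
  have h1: "h - 1/h = - (1/h) * (1 - w)" using h by (simp add: w_def field_simps power2_eq_square)
  have "(h - 1/h) * (qpoch (w * q) q N * qpoch (q / w) q N) = - (1/h) * (\<Sum>n\<le>N. c n / w ^ n - c n * w ^ Suc n)"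
    unfolding h1 mult.assoc eq ..
  also have "\<dots> = (\<Sum>n\<le>N. (-1) ^ n * (h ^ (2*n+1) - 1 / h ^ (2*n+1)) * q ^ (n * (n + 1) div 2) * qbinom q (2*N+1) (N - n))"
    unfolding sum_distrib_left
  proof (intro sum.cong refl)
    fix n
    have "h ^ (2*n+1) = w ^ n * h" by (simp add: w_def power_mult)
    moreover have "w ^ Suc n = w ^ n * h * h" by (simp add: w_def power2_eq_square)
    ultimately have "- (1/h) * (c n / w ^ n - c n * w ^ Suc n) = c n * (h ^ (2*n+1) - 1 / h ^ (2*n+1))"
      using h w by (simp add: field_simps)
    then show "- (1/h) * (c n / w ^ n - c n * w ^ Suc n) = (-1) ^ n * (h ^ (2*n+1) - 1 / h ^ (2*n+1)) * q ^ (n * (n + 1) div 2) * qbinom q (2*N+1) (N - n)"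
      by (simp only: c_def mult_ac)
  qed
  finally show ?thesis by (simp add: w_def)
qed

lemma triple_product_summable:
  assumes h: "h \<noteq> 0" and q: "norm q < 1"
  shows "summable (\<lambda>n. norm ((-1) ^ n * (h ^ (2*n+1) - 1 / h ^ (2*n+1)) * q ^ (n * (n + 1) div 2) :: complex))"
proof -
  define H where "H = norm h + 1 / norm h"
  have H: "norm h \<le> H" "1 / norm h \<le> H" "0 \<le> H" by (auto simp: H_def)
  have "summable (\<lambda>n. (2 * H) * ((H\<^sup>2) ^ n * norm q ^ (n * (n + 1) div 2)))"
    using q H by (intro summable_mult summable_power_superlinear) auto
  then show ?thesis
  proof (rule summable_comparison_test'[where N = 0])
    fix n
    have "norm (h ^ (2*n+1) - 1 / h ^ (2*n+1)) \<le> norm h ^ (2*n+1) + (1 / norm h) ^ (2*n+1)"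
      using norm_triangle_ineq4[of "h ^ (2*n+1)" "1 / h ^ (2*n+1)"]
      by (simp only: norm_power norm_divide norm_one power_one_over)
    also have "\<dots> \<le> H ^ (2*n+1) + H ^ (2*n+1)"
      using H by (intro add_mono power_mono) auto
    also have "\<dots> = 2 * H * (H\<^sup>2) ^ n" by (simp add: power_mult)
    finally show "norm (norm ((-1) ^ n * (h ^ (2*n+1) - 1 / h ^ (2*n+1)) * q ^ (n * (n + 1) div 2))) \<le>
        (2 * H) * ((H\<^sup>2) ^ n * norm q ^ (n * (n + 1) div 2))"
      by (simp add: norm_mult norm_power mult.assoc[symmetric] mult_right_mono)
  qed
qed

text \<open>Let N tend to infinity in the finite form. The symbols (q; q)_n are bounded and bounded
  away from 0, so the Gaussian binomials are bounded uniformly and tend to 1 / (q; q); Tannery's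
  theorem exchanges limit and sum.\<close>

theorem triple_product:
  assumes h: "h \<noteq> 0" and q: "q \<noteq> 0" "norm q < 1"
  shows "(\<lambda>n. (-1) ^ n * (h ^ (2*n+1) - 1 / h ^ (2*n+1)) * q ^ (n * (n + 1) div 2)) sums
      ((h - 1/h) * (qinf q q * qinf (h\<^sup>2 * q) q * qinf (q / h\<^sup>2) q))"
proof -
  define c where "c n = (-1) ^ n * (h ^ (2*n+1) - 1 / h ^ (2*n+1)) * q ^ (n * (n + 1) div 2)" for n
  \<comment> \<open>Extension by 0 beyond N turns the finite sums into series over a fixed index
    set, as dominated convergence requires.\<close>
  define a where "a n N = (if n \<le> N then c n * qbinom q (2*N+1) (N - n) else 0)" for n N
  have sc: "summable (\<lambda>n. norm (c n))"
    unfolding c_def by (rule triple_product_summable[OF h q(2)])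
  have lim: "(\<lambda>N. qpoch q q (2*N+1)) \<longlonglongrightarrow> qinf q q" "(\<lambda>N. qpoch q q (N + n + 1)) \<longlonglongrightarrow> qinf q q"
      "(\<lambda>N. qpoch q q (N - n)) \<longlonglongrightarrow> qinf q q" for n
  proof -
    show "(\<lambda>N. qpoch q q (2*N+1)) \<longlonglongrightarrow> qinf q q"
      using LIMSEQ_subseq_LIMSEQ[OF qpoch_tendsto[OF q(2)], of "\<lambda>N. 2*N+1"]
      by (simp add: strict_mono_def o_def)
    show "(\<lambda>N. qpoch q q (N + n + 1)) \<longlonglongrightarrow> qinf q q"
      using LIMSEQ_subseq_LIMSEQ[OF qpoch_tendsto[OF q(2)], of "\<lambda>N. N+n+1"]
      by (simp add: strict_mono_def o_def)
    show "(\<lambda>N. qpoch q q (N - n)) \<longlonglongrightarrow> qinf q q"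
      by (rule filterlim_compose[OF qpoch_tendsto[OF q(2)] filterlim_minus_const_nat_at_top])
  qed
  have qn: "qinf q q \<noteq> 0" by (rule qinf_q_nonzero[OF q(2)])
  have qb: "qbinom q (2*N+1) (N - n) = qpoch q q (2*N+1) / (qpoch q q (N - n) * qpoch q q (N + n + 1))"
    if "n \<le> N" for n N
    using qbinom_qpoch[of "N - n" "2*N+1" q] that q
    by (simp add: field_simps Suc_diff_le)
  obtain d where d: "0 < d" "\<And>n. d \<le> norm (qpoch q q n)"
    using tendsto_nonzero_bounded_below[OF qpoch_tendsto[OF q(2)] qn] q by auto
  obtain M where M: "\<And>n. norm (qpoch q q n) \<le> M"
    using convergent_imp_Bseq[OF convergentI[OF qpoch_tendsto[OF q(2), of q]]] by (auto simp: Bseq_def)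
  have "((\<lambda>N. suminf (\<lambda>n. a n N)) \<longlonglongrightarrow> suminf (\<lambda>n. c n * (qinf q q / (qinf q q * qinf q q))))"
  proof (rule tannerys_theorem[THEN conjunct2, THEN conjunct2])
    show "(\<lambda>N. a n N) \<longlonglongrightarrow> c n * (qinf q q / (qinf q q * qinf q q))" for n
    proof (rule Lim_transform_eventually)
      show "(\<lambda>N. c n * (qpoch q q (2*N+1) / (qpoch q q (N - n) * qpoch q q (N + n + 1)))) \<longlonglongrightarrow>
          c n * (qinf q q / (qinf q q * qinf q q))"
        using qn by (intro tendsto_intros lim) auto
      show "\<forall>\<^sub>F N in sequentially. c n * (qpoch q q (2*N+1) / (qpoch q q (N - n) * qpoch q q (N + n + 1))) = a n N"
        using eventually_ge_at_top[of n] by eventually_elim (simp only: a_def qb if_True)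
    qed
    show "\<forall>\<^sub>F (n, N) in sequentially \<times>\<^sub>F sequentially. norm (a n N) \<le> norm (c n) * (M / (d * d))"
    proof (rule always_eventually, clarify)
      fix n N
      have M0: "0 \<le> M" using M[of 0] norm_ge_zero order_trans by blast
      show "norm (a n N) \<le> norm (c n) * (M / (d * d))"
      proof (cases "n \<le> N")
        case True
        have "norm (qbinom q (2*N+1) (N - n)) \<le> M / (d * d)"
          unfolding qb[OF True] norm_divide norm_mult using d M M0
          by (intro frac_le mult_mono) (auto intro: less_imp_le)
        then have "norm (c n) * norm (qbinom q (2*N+1) (N - n)) \<le> norm (c n) * (M / (d * d))"
          by (intro mult_left_mono) auto
        then show ?thesis using True by (simp only: a_def norm_mult if_True)
      qed (use M0 d in \<open>simp add: a_def\<close>)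
    qed
    show "summable (\<lambda>n. norm (c n) * (M / (d * d)))"
      by (intro summable_mult2 sc)
  qed simp
  moreover have "suminf (\<lambda>n. a n N) = (h - 1/h) * (qpoch (h\<^sup>2 * q) q N * qpoch (q / h\<^sup>2) q N)" for N
  proof -
    have "suminf (\<lambda>n. a n N) = (\<Sum>n\<le>N. a n N)"
      by (rule suminf_finite) (auto simp: a_def)
    also have "\<dots> = (\<Sum>n\<le>N. c n * qbinom q (2*N+1) (N - n))"
      by (intro sum.cong) (auto simp: a_def)
    finally show ?thesis unfolding finite_triple_product[OF h q] c_def .
  qed
  moreover have "(\<lambda>N. (h - 1/h) * (qpoch (h\<^sup>2 * q) q N * qpoch (q / h\<^sup>2) q N)) \<longlonglongrightarrow>
      (h - 1/h) * (qinf (h\<^sup>2 * q) q * qinf (q / h\<^sup>2) q)"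
    by (intro tendsto_intros qpoch_tendsto q)
  ultimately have "suminf (\<lambda>n. c n * (qinf q q / (qinf q q * qinf q q))) = (h - 1/h) * (qinf (h\<^sup>2 * q) q * qinf (q / h\<^sup>2) q)"
    by (simp add: LIMSEQ_unique)
  then have "suminf c * (qinf q q / (qinf q q * qinf q q)) = (h - 1/h) * (qinf (h\<^sup>2 * q) q * qinf (q / h\<^sup>2) q)"
    using suminf_mult2[OF summable_norm_cancel[OF sc], of "qinf q q / (qinf q q * qinf q q)"] by simp
  then have "suminf c / qinf q q = (h - 1/h) * (qinf (h\<^sup>2 * q) q * qinf (q / h\<^sup>2) q)"
    using qn by simp
  then have "suminf c = ((h - 1/h) * (qinf (h\<^sup>2 * q) q * qinf (q / h\<^sup>2) q)) * qinf q q"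
    using qn by (metis nonzero_divide_eq_eq)
  then have "suminf c = (h - 1/h) * (qinf q q * qinf (h\<^sup>2 * q) q * qinf (q / h\<^sup>2) q)"
    by (simp only: mult_ac)
  moreover have "c sums suminf c" by (rule summable_sums[OF summable_norm_cancel[OF sc]])
  ultimately show ?thesis unfolding c_def[abs_def] by simp
qed

section \<open>A limiting case of the q-Gauss sum\<close>

text \<open>Summand of 1phi1(a; c; p, c/a), the limit b \<rightarrow> \<infinity> of the q-Gauss
  series 2phi1(a, b; c; p, c/(a b)).\<close>

definition qgauss_term :: "complex \<Rightarrow> complex \<Rightarrow> complex \<Rightarrow> nat \<Rightarrow> complex" where
  "qgauss_term a p c n =
     qpoch a p n / (qpoch p p n * qpoch c p n) * (-1) ^ n * p ^ (n * (n - 1) div 2) * (c / a) ^ n"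

text \<open>Certificate for the contiguous relation (1 - c) F(c) = (1 - c/a) F(c p) of the sums F:
  the sequence \<open>(1 - p ^ n) * qgauss_term a p c n\<close> is 0 at n = 0 and tends to 0, so the
  right-hand side sums to 0.\<close>

lemma qgauss_term_telescope:
  assumes p: "norm p < 1" and a: "a \<noteq> 0" and c: "\<And>k. c * p ^ k \<noteq> 1"
  shows "(1 - c) * qgauss_term a p c n - (1 - c / a) * qgauss_term a p (c * p) n =
    (1 - c) * ((1 - p ^ n) * qgauss_term a p c n - (1 - p ^ Suc n) * qgauss_term a p c (Suc n))"
proof -
  define t where "t = qgauss_term a p c n"
  have cn: "1 - c * p ^ k \<noteq> 0" for k using c[of k] by (metis right_minus_eq)
  have pc: "qpoch c p n \<noteq> 0" "qpoch (c * p) p n \<noteq> 0"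
    using c c[of "Suc _"] by (auto simp: qpoch_eq_0_iff mult.assoc)
  have pn: "1 - p ^ Suc n \<noteq> 0" using qpow_neq_1[OF p, of n] by (metis right_minus_eq)
  have "qpoch c p n * (1 - c * p ^ n) = (1 - c) * qpoch (c * p) p n"
    using qpoch_rec[of c p n] by (simp add: qpoch_Suc)
  then have r: "1 / qpoch (c * p) p n = (1 - c) / ((1 - c * p ^ n) * qpoch c p n)"
    using pc cn by (simp add: field_simps)
  have 1: "(1 - c / a) * qgauss_term a p (c * p) n = (1 - c / a) * (t * p ^ n * ((1 - c) / (1 - c * p ^ n)))"
  proof -
    have "qgauss_term a p (c * p) n = qpoch a p n / qpoch p p n * (1 / qpoch (c * p) p n) * (-1) ^ n * p ^ (n * (n - 1) div 2) * (c / a * p) ^ n"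
      by (simp add: qgauss_term_def)
    then show ?thesis unfolding r t_def qgauss_term_def power_mult_distrib[of "c / a" p] by (simp add: mult_ac)
  qed
  have "Suc n * (Suc n - 1) div 2 = n * (n - 1) div 2 + n" by (cases n) auto
  then have 2: "(1 - p ^ Suc n) * qgauss_term a p c (Suc n) = - t * (1 - a * p ^ n) * p ^ n * (c / a) / (1 - c * p ^ n)"
    using pn unfolding qgauss_term_def t_def by (simp add: qpoch_Suc power_add mult_ac)
  show ?thesis unfolding 1 2 t_def[symmetric] using a cn[of n] by (simp add: field_simps)
qed

text \<open>The majorant is uniform in m because the factors 1 - c p^m p^k occur among the 1 - c
  p^k, for which one lower bound holds.\<close>

lemma qgauss_term_bound:
  assumes p: "norm p < 1" and a: "a \<noteq> 0" and c: "\<And>k. c * p ^ k \<noteq> 1"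
  obtains M where "summable M" "\<And>m n. norm (qgauss_term a p (c * p ^ m) n) \<le> M n"
proof -
  obtain d where d: "0 < d" "\<And>k. d \<le> norm (1 - c * p ^ k)"
    using qinf_bounded_factors[OF p c] by auto
  have "\<And>k. p * p ^ k \<noteq> 1" using qpow_neq_1[OF p] by simp
  from qinf_bounded_factors[OF p this]
  obtain e where e: "0 < e" "\<And>k. e \<le> norm (1 - p * p ^ k)" by auto
  define B where "B = (1 + norm a) / (e * d) * (norm c / norm a)"
  show ?thesis
  proof (rule that)
    show "summable (\<lambda>n. B ^ n * norm p ^ (n * (n - 1) div 2))"
    proof (rule summable_power_superlinear)
      show "n * (n - 1) div 2 + n \<le> Suc n * (Suc n - 1) div 2" for n by (cases n) auto
    qed (use p d e in \<open>auto simp: B_def\<close>)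
    fix m n
    have 1: "norm (qpoch a p n) \<le> (1 + norm a) ^ n" using p by (intro norm_qpoch_le) simp
    have 2: "e ^ n \<le> norm (qpoch p p n)" using e by (intro norm_qpoch_ge) auto
    have 3: "d ^ n \<le> norm (qpoch (c * p ^ m) p n)"
      using d by (intro norm_qpoch_ge) (auto simp: mult.assoc simp flip: power_add)
    have "norm (c * p ^ m / a) ^ n \<le> (norm c / norm a) ^ n"
      using p a by (intro power_mono) (auto simp: norm_mult norm_divide norm_power power_le_one
          intro!: divide_right_mono mult_right_le_one_le)
    moreover have "norm (qpoch a p n / (qpoch p p n * qpoch (c * p ^ m) p n)) \<le> (1 + norm a) ^ n / (e ^ n * d ^ n)"
      unfolding norm_divide norm_mult using 1 2 3 d e by (intro frac_le mult_mono) auto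
    ultimately have "norm (qpoch a p n / (qpoch p p n * qpoch (c * p ^ m) p n)) * norm p ^ (n * (n - 1) div 2) * norm (c * p ^ m / a) ^ n \<le>
      (1 + norm a) ^ n / (e ^ n * d ^ n) * norm p ^ (n * (n - 1) div 2) * (norm c / norm a) ^ n"
      using d e by (intro mult_mono) auto
    then show "norm (qgauss_term a p (c * p ^ m) n) \<le> B ^ n * norm p ^ (n * (n - 1) div 2)"
      unfolding qgauss_term_def B_def by (simp add: norm_mult norm_power norm_divide power_divide power_mult_distrib mult_ac)
  qed
qed

text \<open>Iteration of the contiguous relation moves c to c p^m. As m grows, (c p^m / a)^n kills
  every term but the first, so the series tends to 1 and the accumulated factors give the quotient
  of infinite products.\<close>

theorem qgauss_limit:
  assumes p: "norm p < 1" and a: "a \<noteq> 0" and c: "\<And>k. c * p ^ k \<noteq> 1"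
  shows "qgauss_term a p c sums (qinf (c / a) p / qinf c p)"
proof -
  define f where "f c = suminf (qgauss_term a p c)" for c
  obtain M where M: "summable M" "\<And>m n. norm (qgauss_term a p (c * p ^ m) n) \<le> M n"
    using qgauss_term_bound[OF p a c] by blast
  have S: "summable (qgauss_term a p (c * p ^ m))" for m
    using M by (intro summable_comparison_test'[OF M(1)]) auto
  have rec: "(1 - c * p ^ m) * f (c * p ^ m) = (1 - c * p ^ m / a) * f (c * p ^ Suc m)" for m
  proof -
    define C where "C = c * p ^ m"
    have C: "C * p ^ k \<noteq> 1" for k using c[of "m + k"] by (simp add: C_def power_add mult.assoc)
    have S1: "summable (qgauss_term a p C)" using S[of m] by (simp add: C_def)
    have S2: "summable (qgauss_term a p (C * p))" using S[of "Suc m"] by (simp add: C_def mult_ac)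
    let ?G = "\<lambda>n. (1 - p ^ n) * qgauss_term a p C n"
    have "(\<lambda>n. (1 - p ^ n) * qgauss_term a p C n) \<longlonglongrightarrow> (1 - 0) * 0"
      using p by (intro tendsto_intros LIMSEQ_power_zero summable_LIMSEQ_zero S1)
    then have "?G \<longlonglongrightarrow> 0" by simp
    then have "(\<lambda>n. ?G n - ?G (Suc n)) sums (?G 0 - 0)" by (rule telescope_sums')
    then have "(\<lambda>n. (1 - C) * (?G n - ?G (Suc n))) sums ((1 - C) * (?G 0 - 0))" by (rule sums_mult)
    then have "(\<lambda>n. (1 - C) * qgauss_term a p C n - (1 - C / a) * qgauss_term a p (C * p) n) sums 0"
      unfolding qgauss_term_telescope[OF p a C, symmetric] by simp
    moreover have "(\<lambda>n. (1 - C) * qgauss_term a p C n - (1 - C / a) * qgauss_term a p (C * p) n) sums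
        ((1 - C) * f C - (1 - C / a) * f (C * p))"
      unfolding f_def by (intro sums_diff sums_mult summable_sums S1 S2)
    ultimately have "(1 - C) * f C - (1 - C / a) * f (C * p) = 0" by (rule sums_unique2[symmetric])
    then show ?thesis by (simp add: C_def mult_ac)
  qed
  have it: "qpoch c p m * f c = qpoch (c / a) p m * f (c * p ^ m)" for m
  proof (induction m)
    case (Suc m)
    have "qpoch c p (Suc m) * f c = (1 - c * p ^ m) * (qpoch c p m * f c)" by (simp add: qpoch_Suc)
    also have "\<dots> = qpoch (c / a) p m * ((1 - c * p ^ m) * f (c * p ^ m))" unfolding Suc by simp
    also have "\<dots> = qpoch (c / a) p (Suc m) * f (c * p ^ Suc m)" unfolding rec by (simp add: qpoch_Suc)
    finally show ?case .
  qed simp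
  have "(\<lambda>m. f (c * p ^ m)) \<longlonglongrightarrow> suminf (\<lambda>n. if n = 0 then 1 else 0 :: complex)"
    unfolding f_def
  proof (rule tannerys_theorem[THEN conjunct2, THEN conjunct2])
    show "(\<lambda>m. qgauss_term a p (c * p ^ m) n) \<longlonglongrightarrow> (if n = 0 then 1 else 0)" for n
    proof (cases "n = 0")
      case False
      have "(\<lambda>m. qpoch (c * p ^ m) p n) \<longlonglongrightarrow> qpoch (c * 0) p n"
        unfolding qpoch_def using p by (intro tendsto_intros LIMSEQ_power_zero)
      then have l: "(\<lambda>m. qpoch (c * p ^ m) p n) \<longlonglongrightarrow> 1" by (simp add: qpoch_def)
      have "(\<lambda>m. qgauss_term a p (c * p ^ m) n) \<longlonglongrightarrow> 
        qpoch a p n / (qpoch p p n * 1) * (-1) ^ n * p ^ (n * (n - 1) div 2) * (c * 0 / a) ^ n"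
        unfolding qgauss_term_def using p a qpoch_q_nonzero[OF p, of n]
        by (intro tendsto_intros LIMSEQ_power_zero l) auto
      then show ?thesis using False by (simp add: power_0_left)
    qed (simp add: qgauss_term_def)
    show "\<forall>\<^sub>F (n, m) in sequentially \<times>\<^sub>F sequentially. norm (qgauss_term a p (c * p ^ m) n) \<le> M n"
      by (rule always_eventually) (use M in auto)
  qed (use M in auto)
  moreover have "suminf (\<lambda>n. if n = 0 then 1 else 0 :: complex) = 1"
    using suminf_finite[of "{0}" "\<lambda>n. if n = 0 then 1 else 0 :: complex"] by simp
  ultimately have "(\<lambda>m. qpoch (c / a) p m * f (c * p ^ m)) \<longlonglongrightarrow> qinf (c / a) p * 1"
    by (intro tendsto_intros qpoch_tendsto p) simp
  moreover have "(\<lambda>m. qpoch c p m * f c) \<longlonglongrightarrow> qinf c p * f c"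
    by (intro tendsto_intros qpoch_tendsto p)
  ultimately have "qinf c p * f c = qinf (c / a) p"
    unfolding it by (metis LIMSEQ_unique mult_1_right)
  then have "f c = qinf (c / a) p / qinf c p"
    using qinf_nonzero[OF p c] by (simp add: field_simps)
  then show ?thesis using summable_sums[OF S[of 0]] by (simp add: f_def)
qed

section \<open>Holomorphic series and functions on annuli\<close>

lemma holomorphic_suminf:
  fixes f :: "nat \<Rightarrow> complex \<Rightarrow> complex"
  assumes "open S" "\<And>n. f n holomorphic_on S"
    and "\<And>z. z \<in> S \<Longrightarrow> \<exists>r>0. \<exists>M. summable M \<and> (\<forall>n. \<forall>w\<in>cball z r \<inter> S. norm (f n w) \<le> M n)"
  shows "(\<lambda>w. \<Sum>n. f n w) holomorphic_on S"
proof -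
  have "(\<lambda>w. \<Sum>n. f n w) field_differentiable at z" if z: "z \<in> S" for z
  proof -
    obtain r M where r: "r > 0" and M: "summable M" "\<And>n w. w \<in> cball z r \<inter> S \<Longrightarrow> norm (f n w) \<le> M n"
      using assms(3)[OF z] by blast
    obtain r' where r': "r' > 0" "cball z r' \<subseteq> S" using \<open>open S\<close> z open_contains_cball by blast
    define e where "e = min r r'"
    have e: "e > 0" "cball z e \<subseteq> S" "cball z e \<subseteq> cball z r" using r r' by (auto simp: e_def)
    have ul: "uniform_limit (cball z e) (\<lambda>n w. \<Sum>i<n. f i w) (\<lambda>w. \<Sum>i. f i w) sequentially"
      by (rule Weierstrass_m_test[OF _ M(1)]) (use M(2) e in blast)
    have hol: "f i holomorphic_on cball z e" "f i holomorphic_on ball z e" for i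
      using assms(2) e(2) ball_subset_cball[of z e] by (meson holomorphic_on_subset order_trans)+
    have "(\<lambda>w. \<Sum>i. f i w) holomorphic_on ball z e"
      by (rule holomorphic_uniform_limit[OF _ ul])
         (auto intro!: always_eventually continuous_intros holomorphic_intros hol holomorphic_on_imp_continuous_on)
    then show ?thesis using e(1) by (auto intro: holomorphic_on_imp_differentiable_at)
  qed
  then show ?thesis by (simp add: holomorphic_on_def field_differentiable_at_within)
qed

text \<open>Values of \<open>f\<close> on the open annulus are all attained on the compact annulus of radii
  \<open>sqrt (norm q)\<close> and \<open>1 / sqrt (norm q)\<close>, so the maximum modulus principle applies.\<close>

lemma q_periodic_on_annulus_constant:
  assumes q: "q \<noteq> 0" "norm q < 1"
    and f: "f holomorphic_on {w. norm q < norm w \<and> norm w < 1 / norm q}"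
    and per: "\<And>w. 1 < norm w \<Longrightarrow> norm w < 1 / norm q \<Longrightarrow> f (w * q) = f w"
  shows "f constant_on {w. norm q < norm w \<and> norm w < 1 / norm q}"
proof -
  define S where "S = {w :: complex. norm q < norm w \<and> norm w < 1 / norm q}"
  define r where "r = sqrt (norm q)"
  have r: "0 < r" "r < 1" "r * r = norm q"
    using q by (auto simp: r_def)
  have rq: "norm q < r" "1 < 1 / r" "1 / r < 1 / norm q"
    using r by (auto simp: field_simps simp flip: r(3))
  define K where "K = cball 0 (1/r) - ball (0::complex) r"
  have S: "open S"
    unfolding S_def by (intro open_Collect_conj open_Collect_less continuous_intros)
  have conn: "connected S"
    unfolding S_def using connected_annulus(1)[of "norm q" "0::complex" "1 / norm q"] by simp
  have K: "compact K" unfolding K_def by (rule compact_diff) auto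
  have KS: "K \<subseteq> S" using rq by (auto simp: K_def S_def)
  have "1 \<in> K" using r rq by (auto simp: K_def)
  then have "K \<noteq> {}" by blast
  have "continuous_on K (\<lambda>w. norm (f w))"
    using f KS holomorphic_on_imp_continuous_on holomorphic_on_subset
    by (intro continuous_on_norm) (auto simp: S_def)
  then obtain x where x: "x \<in> K" "\<And>y. y \<in> K \<Longrightarrow> norm (f y) \<le> norm (f x)"
    using continuous_attains_sup[OF K \<open>K \<noteq> {}\<close>, of "\<lambda>w. norm (f w)"] by auto
  have max: "norm (f w) \<le> norm (f x)" if w: "w \<in> S" for w
  proof -
    consider "w \<in> K" | "norm w > 1/r" | "norm w < r" by (force simp: K_def)
    then show ?thesis
    proof cases
      case 1 then show ?thesis by (rule x)
    next
      case 2
      have "f (w * q) = f w" using 2 rq w by (intro per) (auto simp: S_def)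
      moreover have "w * q \<in> K"
      proof -
        have "r = 1 / r * norm q" using r by (simp add: field_simps)
        also have "\<dots> \<le> norm w * norm q" using 2 by (intro mult_right_mono) auto
        finally have "r \<le> norm (w * q)" by (simp add: norm_mult)
        moreover have "norm w * norm q \<le> 1" using w q by (simp add: S_def field_simps)
        ultimately show ?thesis using rq by (auto simp: K_def norm_mult)
      qed
      ultimately show ?thesis using x(2) by metis
    next
      case 3
      have gt: "1 < norm (w / q)" using w q by (simp add: S_def norm_divide field_simps)
      have lt: "norm (w / q) < 1 / r"
      proof -
        have "norm (w / q) = norm w / (r * r)" by (simp add: norm_divide r)
        also have "\<dots> < r / (r * r)" using 3 r by (intro divide_strict_right_mono) auto
        also have "r / (r * r) = 1 / r" using r(1) by simp
        finally show ?thesis .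
      qed
      have "f (w / q * q) = f (w / q)" using gt lt rq by (intro per) auto
      then have "f w = f (w / q)" using q by simp
      moreover have "w / q \<in> K" using gt lt r by (auto simp: K_def)
      ultimately show ?thesis using x(2) by metis
    qed
  qed
  have "f constant_on S"
    by (rule maximum_modulus_principle[of f S S x]) (use f S conn x KS max in \<open>auto simp: S_def\<close>)
  then show ?thesis by (simp add: S_def)
qed

section \<open>The two q-hypergeometric series\<close>

text \<open>The index of \<open>KB\<close> is shifted by one against the paper's \<open>K''\<close>.\<close>

definition KA_term :: "complex \<Rightarrow> complex \<Rightarrow> nat \<Rightarrow> complex" where
  "KA_term q w n = (-1) ^ n * q ^ n\<^sup>2 * qpoch q (q\<^sup>2) n / (qpoch (w * q\<^sup>2) (q\<^sup>2) n * qpoch (q\<^sup>2 / w) (q\<^sup>2) n)"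

definition KB_term :: "complex \<Rightarrow> complex \<Rightarrow> nat \<Rightarrow> complex" where
  "KB_term q w n = (-1) ^ Suc n * q ^ (Suc n)\<^sup>2 * qpoch q (q\<^sup>2) n /
     (qpoch (w * q) (q\<^sup>2) (Suc n) * qpoch (q / w) (q\<^sup>2) (Suc n))"

definition KA :: "complex \<Rightarrow> complex \<Rightarrow> complex" where "KA q w = suminf (KA_term q w)"
definition KB :: "complex \<Rightarrow> complex \<Rightarrow> complex" where "KB q w = suminf (KB_term q w)"

section \<open>The functional equation of the two series and its solution\<close>

context
  fixes q :: complex
  assumes q: "q \<noteq> 0" "norm q < 1"
begin

lemma norm_q2: "norm (q\<^sup>2) < 1"
  using q by (simp add: norm_power power_less_one_iff)

lemma norm_K_quotient_le:
  assumes "0 < d" "\<And>k. d \<le> norm (1 - a * (q\<^sup>2) ^ k)" "\<And>k. d \<le> norm (1 - b * (q\<^sup>2) ^ k)"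
  shows "norm (qpoch q (q\<^sup>2) n / (qpoch a (q\<^sup>2) m * qpoch b (q\<^sup>2) m)) \<le> 2 ^ n / (d ^ m * d ^ m)"
proof -
  have "norm (qpoch q (q\<^sup>2) n) \<le> (1 + norm q) ^ n" using norm_q2 by (intro norm_qpoch_le) simp
  also have "\<dots> \<le> 2 ^ n" using q by (intro power_mono) auto
  finally have "norm (qpoch q (q\<^sup>2) n) \<le> 2 ^ n" .
  moreover have "d ^ m \<le> norm (qpoch a (q\<^sup>2) m)" "d ^ m \<le> norm (qpoch b (q\<^sup>2) m)"
    using assms by (auto intro!: norm_qpoch_ge)
  ultimately show ?thesis
    unfolding norm_divide norm_mult using assms(1) by (intro frac_le mult_mono) auto
qed

lemma norm_KA_term_le:
  assumes "0 < d" "\<And>k. d \<le> norm (1 - w * q\<^sup>2 * (q\<^sup>2) ^ k)" "\<And>k. d \<le> norm (1 - q\<^sup>2 / w * (q\<^sup>2) ^ k)"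
  shows "norm (KA_term q w n) \<le> (2 / d\<^sup>2) ^ n * norm q ^ n\<^sup>2"
proof -
  have "norm (KA_term q w n) = norm (qpoch q (q\<^sup>2) n / (qpoch (w * q\<^sup>2) (q\<^sup>2) n * qpoch (q\<^sup>2 / w) (q\<^sup>2) n)) * norm q ^ n\<^sup>2"
    by (simp add: KA_term_def norm_mult norm_power norm_divide)
  also have "\<dots> \<le> 2 ^ n / (d ^ n * d ^ n) * norm q ^ n\<^sup>2"
    by (intro mult_right_mono norm_K_quotient_le assms) auto
  finally show ?thesis by (simp add: power_divide power2_eq_square power_mult_distrib)
qed

lemma norm_KB_term_le:
  assumes "0 < d" "\<And>k. d \<le> norm (1 - w * q * (q\<^sup>2) ^ k)" "\<And>k. d \<le> norm (1 - q / w * (q\<^sup>2) ^ k)"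
  shows "norm (KB_term q w n) \<le> 1 / d\<^sup>2 * ((2 / d\<^sup>2) ^ n * norm q ^ (Suc n)\<^sup>2)"
proof -
  have "norm (KB_term q w n) = norm (qpoch q (q\<^sup>2) n / (qpoch (w * q) (q\<^sup>2) (Suc n) * qpoch (q / w) (q\<^sup>2) (Suc n))) * norm q ^ (Suc n)\<^sup>2"
    unfolding KB_term_def by (simp only: norm_mult norm_power norm_divide norm_minus_cancel norm_one) simp
  also have "\<dots> \<le> 2 ^ n / (d ^ Suc n * d ^ Suc n) * norm q ^ (Suc n)\<^sup>2"
    by (intro mult_right_mono norm_K_quotient_le assms) auto
  finally show ?thesis by (simp add: power_divide power2_eq_square power_mult_distrib mult_ac)
qed

lemma summable_K_majorant:
  assumes "0 < d"
  shows "summable (\<lambda>n. (2 / d\<^sup>2) ^ n * norm q ^ n\<^sup>2)"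
    and "summable (\<lambda>n. 1 / d\<^sup>2 * ((2 / d\<^sup>2) ^ n * norm q ^ (Suc n)\<^sup>2))"
proof -
  show "summable (\<lambda>n. (2 / d\<^sup>2) ^ n * norm q ^ n\<^sup>2)"
    using q assms by (intro summable_power_superlinear) (auto simp: power2_eq_square)
  show "summable (\<lambda>n. 1 / d\<^sup>2 * ((2 / d\<^sup>2) ^ n * norm q ^ (Suc n)\<^sup>2))"
    using q assms by (intro summable_mult summable_power_superlinear) (auto simp: power2_eq_square)
qed

lemma q2_regular:
  assumes "\<And>k. a * q ^ k \<noteq> 1"
  obtains d where "0 < d" "\<And>k. d \<le> norm (1 - a * (q\<^sup>2) ^ k)"
  using qinf_bounded_factors[OF norm_q2, of a] assms by (metis power_mult)

text \<open>The points off the multiplicative lattice of integral powers of q; the two conditions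
  treat powers of either sign with natural exponents.\<close>

definition regular :: "complex \<Rightarrow> bool" where
  "regular w \<longleftrightarrow> w \<noteq> 0 \<and> (\<forall>k. w * q ^ k \<noteq> 1 \<and> q ^ k / w \<noteq> 1)"

lemma summable_norm_KA_term:
  assumes "w \<noteq> 0" "\<And>k. w * q\<^sup>2 * q ^ k \<noteq> 1" "\<And>k. q\<^sup>2 / w * q ^ k \<noteq> 1"
  shows "summable (\<lambda>n. norm (KA_term q w n))"
proof -
  obtain d where d: "0 < d" "\<And>k. d \<le> norm (1 - w * q\<^sup>2 * (q\<^sup>2) ^ k)"
    using q2_regular[OF assms(2)] by metis
  obtain e where e: "0 < e" "\<And>k. e \<le> norm (1 - q\<^sup>2 / w * (q\<^sup>2) ^ k)"
    using q2_regular[OF assms(3)] by metis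
  have "0 < min d e" using d e by simp
  from summable_K_majorant(1)[OF this] show ?thesis
    by (rule summable_comparison_test'[where N = 0])
       (use d e norm_KA_term_le[of "min d e" w] in \<open>auto simp: min_le_iff_disj\<close>)
qed

lemma summable_norm_KB_term:
  assumes "w \<noteq> 0" "\<And>k. w * q * q ^ k \<noteq> 1" "\<And>k. q / w * q ^ k \<noteq> 1"
  shows "summable (\<lambda>n. norm (KB_term q w n))"
proof -
  obtain d where d: "0 < d" "\<And>k. d \<le> norm (1 - w * q * (q\<^sup>2) ^ k)"
    using q2_regular[OF assms(2)] by metis
  obtain e where e: "0 < e" "\<And>k. e \<le> norm (1 - q / w * (q\<^sup>2) ^ k)"
    using q2_regular[OF assms(3)] by metis
  have "0 < min d e" using d e by simp
  from summable_K_majorant(2)[OF this] show ?thesis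
    by (rule summable_comparison_test'[where N = 0])
       (use d e norm_KB_term_le[of "min d e" w] in \<open>auto simp: min_le_iff_disj\<close>)
qed

lemma regular_shifts:
  assumes "regular w"
  shows "w \<noteq> 0" "w * q ^ Suc j * q ^ k \<noteq> 1" "q ^ Suc j / w * q ^ k \<noteq> 1" "w * q ^ k \<noteq> 1" "q ^ k / w \<noteq> 1"
  using assms unfolding regular_def by (metis power_add mult.assoc times_divide_eq_left)+

lemma regular_mult_q:
  assumes "regular w" shows "regular (w * q)"
proof -
  have "q ^ k / (w * q) \<noteq> 1" for k
  proof (cases k)
    case 0
    show ?thesis using regular_shifts(4)[OF assms, of 1] regular_shifts(1)[OF assms] q
      by (auto simp: 0 divide_simps)
  next
    case (Suc j)
    show ?thesis using regular_shifts(5)[OF assms, of j] q by (simp add: Suc)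
  qed
  then show ?thesis
    using regular_shifts(1)[OF assms] regular_shifts(4)[OF assms, of "Suc _"] q
    by (auto simp: regular_def mult.assoc)
qed

lemma regular_inverse: "regular w \<Longrightarrow> regular (1 / w)"
  by (auto simp: regular_def divide_simps mult_ac)

lemma KA_term_inverse: "KA_term q (1 / w) n = KA_term q w n"
  by (simp add: KA_term_def mult.commute)

lemma KB_term_inverse: "KB_term q (1 / w) n = KB_term q w n"
  by (simp add: KB_term_def mult.commute)

lemma KA_inverse: "KA q (1 / w) = KA q w" and KB_inverse: "KB q (1 / w) = KB q w"
  by (simp_all add: KA_def KB_def KA_term_inverse[abs_def] KB_term_inverse[abs_def])

lemma K_telescope:
  assumes w: "regular w"
  shows "KA q (w * q) / (1 - w * q) + (w - 1) * KB q w = 1"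
proof -
  \<comment> \<open>The telescoping sequence: numerators as in \<open>KA_term\<close>, denominators
    as in \<open>KB_term\<close> but with one factor fewer each. It starts at 1, which is the
    right-hand side.\<close>
  define U where "U n = (-1) ^ n * q ^ n\<^sup>2 * qpoch q (q\<^sup>2) n / (qpoch (w * q) (q\<^sup>2) n * qpoch (q / w) (q\<^sup>2) n)" for n
  have w0: "w \<noteq> 0" by (rule regular_shifts[OF w])
  have nz: "qpoch (w * q) (q\<^sup>2) n \<noteq> 0" "qpoch (q / w) (q\<^sup>2) n \<noteq> 0" for n
    using regular_shifts(2,3)[OF w, of 0 "2 * _"] by (auto simp: qpoch_eq_0_iff power_mult)
  have terms: "KA_term q (w * q) n / (1 - w * q) + (w - 1) * KB_term q w n = U n - U (Suc n)" for n
  proof -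
    \<comment> \<open>With X = q^(2n+1) and the common quotient V removed, the claim reads 1 - X/w -
      (w - 1) X = (1 - w X)(1 - X/w) + X (1 - X), where the X^2 terms cancel.\<close>
    define X where "X = q * (q\<^sup>2) ^ n"
    define V where "V = (-1) ^ n * q ^ n\<^sup>2 * qpoch q (q\<^sup>2) n / (qpoch (w * q) (q\<^sup>2) (Suc n) * qpoch (q / w) (q\<^sup>2) (Suc n))"
    have f: "1 - w * X \<noteq> 0" "1 - X / w \<noteq> 0" "1 - w * q \<noteq> 0"
      using nz[of "Suc n"] nz(1)[of "Suc 0"] by (auto simp: qpoch_Suc X_def mult_ac)
    have s1: "qpoch (w * q) (q\<^sup>2) (Suc n) = qpoch (w * q) (q\<^sup>2) n * (1 - w * X)"
      and s2: "qpoch (q / w) (q\<^sup>2) (Suc n) = qpoch (q / w) (q\<^sup>2) n * (1 - X / w)"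
      and s3: "qpoch q (q\<^sup>2) (Suc n) = qpoch q (q\<^sup>2) n * (1 - X)"
      by (simp_all add: qpoch_Suc X_def)
    have "(Suc n)\<^sup>2 = n\<^sup>2 + 2 * n + 1" by (simp add: power2_eq_square)
    then have qX: "q ^ (Suc n)\<^sup>2 = q ^ n\<^sup>2 * X"
      by (simp add: power_add power_mult X_def)
    have U: "U n = V * ((1 - w * X) * (1 - X / w))"
      unfolding U_def V_def s1 s2 using f nz[of n] w0 by simp
    have US: "U (Suc n) = V * (- X * (1 - X))"
      unfolding U_def V_def qX s3 by simp
    have B: "KB_term q w n = V * (- X)"
      unfolding KB_term_def V_def qX by simp
    have "(1 - w * q) * qpoch (w * q * q\<^sup>2) (q\<^sup>2) n = qpoch (w * q) (q\<^sup>2) (Suc n)"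
      by (simp add: qpoch_rec)
    then have "KA_term q (w * q) n / (1 - w * q) =
        (-1) ^ n * q ^ n\<^sup>2 * qpoch q (q\<^sup>2) n / (qpoch (w * q) (q\<^sup>2) (Suc n) * qpoch (q\<^sup>2 / (w * q)) (q\<^sup>2) n)"
      unfolding KA_term_def by (simp add: mult_ac)
    also have "q\<^sup>2 / (w * q) = q / w" using q by (simp add: power2_eq_square)
    also have "(-1) ^ n * q ^ n\<^sup>2 * qpoch q (q\<^sup>2) n / (qpoch (w * q) (q\<^sup>2) (Suc n) * qpoch (q / w) (q\<^sup>2) n) = V * (1 - X / w)"
      unfolding V_def s2 using f w0 by simp
    finally have A: "KA_term q (w * q) n / (1 - w * q) = V * (1 - X / w)" .
    show ?thesis unfolding U US A B using w0 by (simp add: field_simps)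
  qed
  have "summable (\<lambda>n. norm (U n))"
  proof -
    have "\<And>k. w * q * q ^ k \<noteq> 1" "\<And>k. q / w * q ^ k \<noteq> 1"
      using regular_shifts(2,3)[OF w, of 0] by auto
    note r = this
    obtain d where d: "0 < d" "\<And>k. d \<le> norm (1 - w * q * (q\<^sup>2) ^ k)"
      using q2_regular[OF r(1)] by metis
    obtain e where e: "0 < e" "\<And>k. e \<le> norm (1 - q / w * (q\<^sup>2) ^ k)"
      using q2_regular[OF r(2)] by metis
    have de: "0 < min d e" using d e by simp
    show ?thesis
    proof (rule summable_comparison_test'[OF summable_K_majorant(1)[OF de], where N = 0])
      fix n
      have "norm (U n) = norm (qpoch q (q\<^sup>2) n / (qpoch (w * q) (q\<^sup>2) n * qpoch (q / w) (q\<^sup>2) n)) * norm q ^ n\<^sup>2"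
        by (simp add: U_def norm_mult norm_power norm_divide)
      also have "\<dots> \<le> 2 ^ n / (min d e ^ n * min d e ^ n) * norm q ^ n\<^sup>2"
        using d e by (intro mult_right_mono norm_K_quotient_le de) (auto simp: min_le_iff_disj)
      finally show "norm (norm (U n)) \<le> (2 / (min d e)\<^sup>2) ^ n * norm q ^ n\<^sup>2"
        by (simp add: power_divide power2_eq_square power_mult_distrib)
    qed
  qed
  then have "U \<longlonglongrightarrow> 0" by (rule summable_LIMSEQ_zero[OF summable_norm_cancel])
  then have "(\<lambda>n. U n - U (Suc n)) sums (U 0 - 0)" by (rule telescope_sums')
  moreover have "(\<lambda>n. KA_term q (w * q) n / (1 - w * q) + (w - 1) * KB_term q w n) sums
      (KA q (w * q) / (1 - w * q) + (w - 1) * KB q w)"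
    unfolding KA_def KB_def
  proof (intro sums_add sums_divide sums_mult summable_sums)
    note wq = regular_mult_q[OF w]
    have "summable (\<lambda>n. norm (KA_term q (w * q) n))"
      using regular_shifts(1)[OF wq] regular_shifts(2,3)[OF wq, of 1]
      by (intro summable_norm_KA_term) (auto simp: power2_eq_square)
    then show "summable (KA_term q (w * q))" by (rule summable_norm_cancel)
    have "summable (\<lambda>n. norm (KB_term q w n))"
      using regular_shifts(1)[OF w] regular_shifts(2,3)[OF w, of 0] by (intro summable_norm_KB_term) auto
    then show "summable (KB_term q w)" by (rule summable_norm_cancel)
  qed
  ultimately show ?thesis unfolding terms by (simp add: sums_iff U_def)
qed

text \<open>This is \<open>S\<close> times (w; q) (q/w; q), with the factor 1 - w of (w; q) already
  cancelled against the denominator of \<open>S\<close>; hence the product starts at w q.\<close>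

definition KZ :: "complex \<Rightarrow> complex" where
  "KZ w = (KA q w + (1 - w) * (1 - 1 / w) * KB q w) * (qinf (w * q) q * qinf (q / w) q)"

lemma KZ_inverse: "KZ (1 / w) = KZ w"
  unfolding KZ_def KA_inverse KB_inverse by (simp add: mult_ac)

lemma KZ_mult_q:
  assumes w: "regular w"
  shows "KZ (w * q) = KZ w"
proof -
  have w0: "w \<noteq> 0" and w1: "1 - w \<noteq> 0" "1 - w * q \<noteq> 0" and iw: "1 - 1 / w \<noteq> 0"
    using regular_shifts(1)[OF w] regular_shifts(4)[OF w, of 0] regular_shifts(4)[OF w, of 1]
    by auto
  have 1: "KA q (w * q) / (1 - w * q) = 1 - (w - 1) * KB q w"
    using K_telescope[OF w] by (simp add: algebra_simps)
  \<comment> \<open>The telescoped identity a second time, at 1/(w q): after multiplication by q the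
    argument is 1/w. By the inversion symmetry this expresses \<open>KB\<close> at w q through
    \<open>KA\<close> at w, whereas the first use expressed \<open>KA\<close> at w q through
    \<open>KB\<close> at w.\<close>
  have "KA q (1 / (w * q) * q) / (1 - 1 / (w * q) * q) + (1 / (w * q) - 1) * KB q (1 / (w * q)) = 1"
    by (intro K_telescope regular_inverse regular_mult_q w)
  then have "KA q (1 / w) / (1 - 1 / w) + (1 / (w * q) - 1) * KB q (1 / (w * q)) = 1"
    using q by simp
  then have 2: "(1 - 1 / (w * q)) * KB q (w * q) = KA q w / (1 - 1 / w) - 1"
    unfolding KA_inverse KB_inverse by (simp add: algebra_simps)
  have A: "KA q (w * q) = (1 - w * q) * (1 - (w - 1) * KB q w)"
    using 1 w1 by (simp add: field_simps)
  have "KA q (w * q) + (1 - w * q) * (1 - 1 / (w * q)) * KB q (w * q) =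
      (1 - w * q) * (1 - (w - 1) * KB q w + (KA q w / (1 - 1 / w) - 1))"
    unfolding A mult.assoc 2 by (simp add: algebra_simps)
  also have "\<dots> * (1 - 1 / w) = (1 - w * q) * (KA q w + (1 - w) * (1 - 1 / w) * KB q w)"
    using iw by (simp add: field_simps)
  finally have S: "(KA q (w * q) + (1 - w * q) * (1 - 1 / (w * q)) * KB q (w * q)) * (1 - 1 / w) =
      (1 - w * q) * (KA q w + (1 - w) * (1 - 1 / w) * KB q w)" .
  have q1: "qinf (w * q) q = (1 - w * q) * qinf (w * q * q) q"
    by (rule qinf_rec[OF q(2)])
  have "qinf (1 / w) q = (1 - 1 / w) * qinf (1 / w * q) q"
    by (rule qinf_rec[OF q(2)])
  then have q2: "qinf (q / (w * q)) q = (1 - 1 / w) * qinf (q / w) q"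
    using q by simp
  have "KZ (w * q) = (KA q (w * q) + (1 - w * q) * (1 - 1 / (w * q)) * KB q (w * q)) * (1 - 1 / w)
      * (qinf (w * q * q) q * qinf (q / w) q)"
    unfolding KZ_def q2 by (simp only: mult_ac)
  also have "\<dots> = KZ w" unfolding S KZ_def q1 by (simp only: mult_ac)
  finally show ?thesis .
qed

text \<open>All denominators are products of factors 1 - w q^k and 1 - q^k / w with k \<ge> 1. None
  of them vanishes on this annulus, not even at w = 1, and locally they are bounded away from 0
  uniformly in k.\<close>

lemma holomorphic_KZ: "KZ holomorphic_on {w. norm q < norm w \<and> norm w < 1 / norm q}"
proof -
  define S where "S = {w :: complex. norm q < norm w \<and> norm w < 1 / norm q}"
  have S: "open S"
    unfolding S_def by (intro open_Collect_conj open_Collect_less continuous_intros)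
  have S0: "w \<noteq> 0" if "w \<in> S" for w using that by (auto simp: S_def)
  have fac: "\<exists>d>0. \<exists>r>0. \<forall>w\<in>cball z r \<inter> S. \<forall>k. d \<le> norm (1 - w * q ^ Suc k) \<and> d \<le> norm (1 - q ^ Suc k / w)"
    if z: "z \<in> S" for z
  proof -
    \<comment> \<open>By the triangle inequality \<open>g w\<close> bounds all the factors from
      below at once; its continuity gives a bound valid near z.\<close>
    define g where "g w = min (1 - norm w * norm q) (1 - norm q / norm w)" for w :: complex
    have "0 < norm z" using z S0 by simp
    then have "g z > 0" using z q by (auto simp: g_def S_def field_simps)
    have "continuous_on S g" unfolding g_def using S0 by (intro continuous_intros) auto
    then have "isCont g z" using S z by (simp add: continuous_on_eq_continuous_at)
    then have "\<exists>r>0. \<forall>w. dist w z < r \<longrightarrow> dist (g w) (g z) < g z / 2"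
      using \<open>g z > 0\<close> unfolding continuous_at_eps_delta by (metis half_gt_zero)
    then obtain r where r: "r > 0" "\<And>w. dist w z < r \<Longrightarrow> dist (g w) (g z) < g z / 2" by blast
    have "g z / 2 \<le> norm (1 - w * q ^ Suc k) \<and> g z / 2 \<le> norm (1 - q ^ Suc k / w)"
      if w: "w \<in> cball z (r/2) \<inter> S" for w k
    proof -
      have "dist w z < r" using w r(1) by (auto simp: dist_commute)
      from r(2)[OF this] have g: "g z / 2 \<le> g w" by (simp add: dist_real_def abs_if split: if_splits)
      have le: "norm q ^ Suc k \<le> norm q" using q by (simp add: mult_left_le power_le_one)
      have "norm (w * q ^ Suc k) \<le> norm w * norm q"
        unfolding norm_mult norm_power using le by (intro mult_left_mono) auto
      moreover have "norm (q ^ Suc k / w) \<le> norm q / norm w"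
        unfolding norm_divide norm_power using le by (intro divide_right_mono) auto
      moreover have "norm (1::complex) - norm (w * q ^ Suc k) \<le> norm (1 - w * q ^ Suc k)"
        "norm (1::complex) - norm (q ^ Suc k / w) \<le> norm (1 - q ^ Suc k / w)" by (rule norm_triangle_ineq2)+
      ultimately show ?thesis using g unfolding g_def norm_one by linarith
    qed
    then show ?thesis using \<open>g z > 0\<close> r(1) by (metis half_gt_zero)
  qed
  have nz: "1 - w * q ^ Suc k \<noteq> 0" "1 - q ^ Suc k / w \<noteq> 0" if "w \<in> S" for w k
    using fac[OF that] that
    by (metis IntI centre_in_cball less_imp_le norm_zero not_le)+
  have hA: "KA q holomorphic_on S" unfolding KA_def
  proof (rule holomorphic_suminf[OF S])
    show "(\<lambda>w. KA_term q w n) holomorphic_on S" for n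
    proof -
      have "w * q\<^sup>2 * (q\<^sup>2) ^ k \<noteq> 1" "q\<^sup>2 / w * (q\<^sup>2) ^ k \<noteq> 1" if "w \<in> S" for w k
      proof -
        have "w * q\<^sup>2 * (q\<^sup>2) ^ k = w * q ^ Suc (Suc (2 * k))" "q\<^sup>2 / w * (q\<^sup>2) ^ k = q ^ Suc (Suc (2 * k)) / w"
          by (simp_all add: power_mult power2_eq_square)
        then show "w * q\<^sup>2 * (q\<^sup>2) ^ k \<noteq> 1" "q\<^sup>2 / w * (q\<^sup>2) ^ k \<noteq> 1"
          using nz[OF that, of "Suc (2 * k)"] by (metis right_minus_eq)+
      qed
      then have "w \<in> S \<Longrightarrow> qpoch (w * q\<^sup>2) (q\<^sup>2) n * qpoch (q\<^sup>2 / w) (q\<^sup>2) n \<noteq> 0" for w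
        by (auto simp: qpoch_eq_0_iff)
      then show ?thesis unfolding KA_term_def
        by (intro holomorphic_intros) (use S0 in \<open>auto simp: qpoch_def intro!: holomorphic_intros\<close>)
    qed
    fix z assume "z \<in> S"
    from fac[OF this] obtain d r where d: "d > 0" "r > 0"
      and b: "\<And>w k. w \<in> cball z r \<inter> S \<Longrightarrow> d \<le> norm (1 - w * q ^ Suc k) \<and> d \<le> norm (1 - q ^ Suc k / w)"
      by blast
    have "norm (KA_term q w n) \<le> (2 / d\<^sup>2) ^ n * norm q ^ n\<^sup>2" if w: "w \<in> cball z r \<inter> S" for w n
    proof (rule norm_KA_term_le[OF d(1)])
      fix k
      have "w * q\<^sup>2 * (q\<^sup>2) ^ k = w * q ^ Suc (Suc (2 * k))" "q\<^sup>2 / w * (q\<^sup>2) ^ k = q ^ Suc (Suc (2 * k)) / w"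
        by (simp_all add: power_mult power2_eq_square)
      then show "d \<le> norm (1 - w * q\<^sup>2 * (q\<^sup>2) ^ k)" "d \<le> norm (1 - q\<^sup>2 / w * (q\<^sup>2) ^ k)"
        using b[OF w, of "Suc (2 * k)"] by metis+
    qed
    then show "\<exists>r>0. \<exists>M. summable M \<and> (\<forall>n. \<forall>w\<in>cball z r \<inter> S. norm (KA_term q w n) \<le> M n)"
      using d summable_K_majorant(1)[OF d(1)] by blast
  qed
  have hB: "KB q holomorphic_on S" unfolding KB_def
  proof (rule holomorphic_suminf[OF S])
    show "(\<lambda>w. KB_term q w n) holomorphic_on S" for n
    proof -
      have "w * q * (q\<^sup>2) ^ k \<noteq> 1" "q / w * (q\<^sup>2) ^ k \<noteq> 1" if "w \<in> S" for w k
      proof -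
        have "w * q * (q\<^sup>2) ^ k = w * q ^ Suc (2 * k)" "q / w * (q\<^sup>2) ^ k = q ^ Suc (2 * k) / w"
          by (simp_all add: power_mult)
        then show "w * q * (q\<^sup>2) ^ k \<noteq> 1" "q / w * (q\<^sup>2) ^ k \<noteq> 1"
          using nz[OF that, of "2 * k"] by (metis right_minus_eq)+
      qed
      then have "w \<in> S \<Longrightarrow> qpoch (w * q) (q\<^sup>2) (Suc n) * qpoch (q / w) (q\<^sup>2) (Suc n) \<noteq> 0" for w
        by (auto simp: qpoch_eq_0_iff)
      then show ?thesis unfolding KB_term_def
        by (intro holomorphic_intros) (use S0 in \<open>auto simp: qpoch_def intro!: holomorphic_intros\<close>)
    qed
    fix z assume "z \<in> S"
    from fac[OF this] obtain d r where d: "d > 0" "r > 0"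
      and b: "\<And>w k. w \<in> cball z r \<inter> S \<Longrightarrow> d \<le> norm (1 - w * q ^ Suc k) \<and> d \<le> norm (1 - q ^ Suc k / w)"
      by blast
    have "norm (KB_term q w n) \<le> 1 / d\<^sup>2 * ((2 / d\<^sup>2) ^ n * norm q ^ (Suc n)\<^sup>2)" if w: "w \<in> cball z r \<inter> S" for w n
    proof (rule norm_KB_term_le[OF d(1)])
      fix k
      have "w * q * (q\<^sup>2) ^ k = w * q ^ Suc (2 * k)" "q / w * (q\<^sup>2) ^ k = q ^ Suc (2 * k) / w"
        by (simp_all add: power_mult)
      then show "d \<le> norm (1 - w * q * (q\<^sup>2) ^ k)" "d \<le> norm (1 - q / w * (q\<^sup>2) ^ k)"
        using b[OF w, of "2 * k"] by metis+
    qed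
    then show "\<exists>r>0. \<exists>M. summable M \<and> (\<forall>n. \<forall>w\<in>cball z r \<inter> S. norm (KB_term q w n) \<le> M n)"
      using d summable_K_majorant(2)[OF d(1)] by blast
  qed
  have hq: "(\<lambda>w. qinf (f w) q) holomorphic_on S" if "f holomorphic_on S" for f
    using holomorphic_on_compose_gen[OF that holomorphic_qinf[OF q(2)]] by (simp add: o_def)
  show ?thesis unfolding KZ_def S_def[symmetric]
    by (intro holomorphic_intros hA hB hq) (use S0 in auto)
qed

text \<open>At w = 1 both denominator symbols are (q^2; q^2)_n. One plays (p; p)_n and the other (c;
  p)_n in the limiting q-Gauss sum, with p = c = q^2 and a = q.\<close>

lemma KA_1: "KA q 1 = qinf q (q\<^sup>2) / qinf (q\<^sup>2) (q\<^sup>2)"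
proof -
  have "KA_term q 1 n = qgauss_term q (q\<^sup>2) (q\<^sup>2) n" for n
  proof -
    have "n\<^sup>2 = 2 * (n * (n - 1) div 2) + n" by (cases n) (simp_all add: power2_eq_square)
    then have "q ^ n\<^sup>2 = (q\<^sup>2) ^ (n * (n - 1) div 2) * q ^ n" by (metis power_add power_mult)
    then show ?thesis using q by (simp add: KA_term_def qgauss_term_def power2_eq_square)
  qed
  moreover have "qgauss_term q (q\<^sup>2) (q\<^sup>2) sums (qinf (q\<^sup>2 / q) (q\<^sup>2) / qinf (q\<^sup>2) (q\<^sup>2))"
    using qpow_neq_1[OF norm_q2] q by (intro qgauss_limit norm_q2) auto
  ultimately show ?thesis using q by (simp add: KA_def sums_iff power2_eq_square cong: suminf_cong)
qed

text \<open>Powers of q carry any regular w with norm at least 1 into the annulus without changing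
  \<open>KZ\<close>, and the inversion symmetry covers the others. There the constant is read off at
  w = 1, which is not regular itself but is a point of holomorphy.\<close>

theorem KZ_value:
  assumes w: "regular w"
  shows "KZ w = qinf q (q\<^sup>2) / qinf (q\<^sup>2) (q\<^sup>2) * (qinf q q)\<^sup>2"
proof -
  define S where "S = {w :: complex. norm q < norm w \<and> norm w < 1 / norm q}"
  have "KZ constant_on S" unfolding S_def
  proof (rule q_periodic_on_annulus_constant[OF q holomorphic_KZ])
    \<comment> \<open>Between the circles of radii 1 and 1 / norm q every point is regular, so the
      functional equation applies without exceptions.\<close>
    fix w :: complex assume w1: "1 < norm w" and w2: "norm w < 1 / norm q"
    have "w * q ^ k \<noteq> 1" for k
    proof (cases k)
      case 0 with w1 show ?thesis by auto
    next
      case (Suc j)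
      have "norm q ^ k \<le> norm q" using q by (simp add: Suc mult_left_le power_le_one)
      then have "norm w * norm q ^ k \<le> norm w * norm q" by (rule mult_left_mono) simp
      also have "\<dots> < 1" using w2 q by (simp add: field_simps)
      finally have "norm (w * q ^ k) < 1" by (simp add: norm_mult norm_power)
      then show ?thesis by auto
    qed
    moreover have "q ^ k / w \<noteq> 1" for k
    proof -
      have "norm q ^ k \<le> 1" using q by (simp add: power_le_one)
      then have "norm (q ^ k / w) < 1" using w1 by (simp add: norm_divide norm_power divide_less_eq)
      then show ?thesis by auto
    qed
    ultimately show "KZ (w * q) = KZ w" using w1 by (intro KZ_mult_q) (auto simp: regular_def)
  qed
  then have const: "KZ x = KZ 1" if "x \<in> S" for x
    using that q unfolding constant_on_def S_def by (metis (no_types, lifting) mem_Collect_eq norm_one less_divide_eq_1_pos zero_less_norm_iff)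
  have big: "KZ w = KZ 1" if w: "regular w" and w1: "1 \<le> norm w" for w
  proof -
    have "\<exists>n. norm w * norm q ^ n \<le> 1"
    proof -
      have "(\<lambda>n. norm w * norm q ^ n) \<longlonglongrightarrow> norm w * 0"
        using q by (intro tendsto_intros LIMSEQ_power_zero) auto
      then have "\<forall>\<^sub>F n in sequentially. norm w * norm q ^ n < 1"
        by (rule order_tendstoD) simp
      then show ?thesis by (meson eventually_sequentially less_imp_le order_refl)
    qed
    \<comment> \<open>The first power that brings the norm down to at most 1; by minimality the norm
      is still greater than that of q.\<close>
    define n where "n = (LEAST n. norm w * norm q ^ n \<le> 1)"
    have n: "norm w * norm q ^ n \<le> 1"
      unfolding n_def by (rule LeastI_ex) fact
    have "norm q < norm w * norm q ^ n"
    proof (cases n)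
      case 0 with w1 q show ?thesis by simp
    next
      case (Suc m)
      have "\<not> norm w * norm q ^ m \<le> 1" using not_less_Least[of m "\<lambda>n. norm w * norm q ^ n \<le> 1"] Suc
        by (simp add: n_def)
      then have "1 * norm q < norm w * norm q ^ m * norm q" using q by (intro mult_strict_right_mono) auto
      then show ?thesis by (simp add: Suc mult_ac)
    qed
    moreover have "1 < 1 / norm q" using q by simp
    ultimately have "w * q ^ n \<in> S" using n by (auto simp: S_def norm_mult norm_power)
    moreover have "regular (w * q ^ k) \<and> KZ (w * q ^ k) = KZ w" for k
    proof (induction k)
      case (Suc k)
      have "w * q ^ Suc k = w * q ^ k * q" by simp
      then show ?case using Suc regular_mult_q KZ_mult_q by metis
    qed (use w in simp)
    ultimately show ?thesis using const by metis
  qed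
  have "KZ w = KZ 1"
  proof (cases "1 \<le> norm w")
    case False
    then have "1 \<le> norm (1 / w)" using regular_shifts(1)[OF w] by (simp add: norm_divide)
    then show ?thesis using big[OF regular_inverse[OF w]] KZ_inverse by simp
  qed (use big w in blast)
  then show ?thesis by (simp add: KZ_def KA_1 power2_eq_square)
qed

end

section \<open>Theta and eta\<close>

lemma qpow_0 [simp]: "qpow \<tau> 0 = 1"
  by (simp add: qpow_def)

lemma qpow_nonzero [simp]: "qpow \<tau> l \<noteq> 0"
  by (simp add: qpow_def)

lemma qpow_add: "qpow \<tau> (a + b) = qpow \<tau> a * qpow \<tau> b"
  by (simp add: qpow_def algebra_simps flip: exp_add)

lemma qpow_minus: "qpow \<tau> (- a) = 1 / qpow \<tau> a"
  by (simp add: qpow_def exp_minus field_simps)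

lemma qpow_power: "qpow \<tau> a ^ n = qpow \<tau> (of_nat n * a)"
  by (simp add: qpow_def mult_ac flip: exp_of_nat_mult)

lemma qpow_double: "qpow (2 * \<tau>) a = qpow \<tau> (2 * a)"
  by (simp add: qpow_def mult_ac)

lemma norm_qpow: "norm (qpow \<tau> a) = exp (- (2 * pi * a * Im \<tau>))"
  by (simp add: qpow_def)

lemma norm_qpow_less_1: "0 < Im \<tau> \<Longrightarrow> 0 < a \<Longrightarrow> norm (qpow \<tau> a) < 1"
  by (simp add: norm_qpow)

text \<open>The pairing n \<mapsto> -n-1 fixes n(n+1) and negates 2n+1, so for \<open>theta\<close>
  it joins exactly the terms that the triple product combines.\<close>

lemma has_sum_int_split:
  fixes f :: "int \<Rightarrow> 'a::banach"
  assumes "summable (\<lambda>n. norm (f (int n)))" "summable (\<lambda>n. norm (f (- int n - 1)))"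
  shows "(\<lambda>n. f (int n) + f (- int n - 1)) sums infsum f UNIV" "f summable_on UNIV"
proof -
  have 1: "(f has_sum (\<Sum>n. f (int n))) (range int)"
    using norm_summable_imp_has_sum[OF assms(1) summable_sums[OF summable_norm_cancel[OF assms(1)]]]
    by (subst has_sum_reindex) (auto simp: o_def inj_on_def)
  have 2: "(f has_sum (\<Sum>n. f (- int n - 1))) (range (\<lambda>n. - int n - 1))"
    using norm_summable_imp_has_sum[OF assms(2) summable_sums[OF summable_norm_cancel[OF assms(2)]]]
    by (subst has_sum_reindex) (auto simp: o_def inj_on_def)
  have "n \<in> range int \<union> range (\<lambda>n. - int n - 1)" for n
  proof (cases "n \<ge> 0")
    case True then show ?thesis by (intro UnI1 image_eqI[of _ _ "nat n"]) auto
  next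
    case False then show ?thesis by (intro UnI2 image_eqI[of _ _ "nat (- n - 1)"]) auto
  qed
  then have U: "range int \<union> range (\<lambda>n. - int n - 1) = UNIV" by auto
  have "(f has_sum ((\<Sum>n. f (int n)) + (\<Sum>n. f (- int n - 1)))) (range int \<union> range (\<lambda>n. - int n - 1))"
    by (intro has_sum_Un_disjoint 1 2) auto
  then have 3: "(f has_sum ((\<Sum>n. f (int n)) + (\<Sum>n. f (- int n - 1)))) UNIV"
    unfolding U .
  then show "f summable_on UNIV" by (rule has_sum_imp_summable)
  show "(\<lambda>n. f (int n) + f (- int n - 1)) sums infsum f UNIV"
    unfolding infsumI[OF 3]
    by (intro sums_add summable_sums summable_norm_cancel[OF assms(1)] summable_norm_cancel[OF assms(2)])
qed

lemma minus_one_powi_neg: "(-1) powi (- int n - 1) = - ((-1) ^ n :: 'a::field)"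
proof -
  have "(-1 :: 'a) powi (- int n - 1) = (-1) powi (- int n) / (-1) powi 1"
    by (rule power_int_diff) simp
  also have "(-1 :: 'a) powi (- int n) = (-1) ^ n"
    by (simp add: power_int_minus power_one_over flip: power_inverse)
  finally show ?thesis by simp
qed

lemma theta_term:
  fixes z \<tau> :: complex
  defines "h \<equiv> exp (pii * z)" and "q \<equiv> qpow \<tau> 1"
    and "t \<equiv> \<lambda>n::int. (-1) powi n * exp (pii * of_int (2*n+1) * z) * qpow \<tau> (of_int (n*(n+1)) / 2 + 1/8)"
  shows "t (int n) = qpow \<tau> (1/8) * ((-1) ^ n * h ^ (2*n+1) * q ^ (n * (n + 1) div 2))"
    and "t (- int n - 1) = - (qpow \<tau> (1/8) * ((-1) ^ n * (1 / h) ^ (2*n+1) * q ^ (n * (n + 1) div 2)))"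
proof -
  have "2 * (n * (n + 1) div 2) = n * (n + 1)" by simp
  then have "2 * real (n * (n + 1) div 2) = real (n * (n + 1))" by (metis of_nat_mult of_nat_numeral)
  then have e: "real_of_int (int n * (int n + 1)) / 2 = real (n * (n + 1) div 2)"
  proof -
    have "real_of_int (int n * (int n + 1)) = real (n * (n + 1))" by (simp add: algebra_simps)
    with \<open>2 * real (n * (n + 1) div 2) = real (n * (n + 1))\<close> show ?thesis by linarith
  qed
  have qe: "qpow \<tau> (real_of_int (int n * (int n + 1)) / 2 + 1/8) = qpow \<tau> (1/8) * q ^ (n * (n + 1) div 2)"
    unfolding e qpow_add q_def qpow_power by simp
  have he: "exp (pii * of_int (2 * int n + 1) * z) = h ^ (2*n+1)"
    unfolding h_def exp_of_nat_mult[symmetric] by (simp add: algebra_simps)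
  show "t (int n) = qpow \<tau> (1/8) * ((-1) ^ n * h ^ (2*n+1) * q ^ (n * (n + 1) div 2))"
    unfolding t_def qe he by simp
  have he': "exp (pii * of_int (2 * (- int n - 1) + 1) * z) = (1 / h) ^ (2*n+1)"
  proof -
    have "(1 / h) ^ (2*n+1) = exp (- (pii * z)) ^ (2*n+1)" by (simp add: h_def exp_minus field_simps)
    then show ?thesis unfolding exp_of_nat_mult[symmetric] by (simp add: algebra_simps)
  qed
  have "(- int n - 1) * (- int n - 1 + 1) = int n * (int n + 1)" by (simp add: algebra_simps)
  then show "t (- int n - 1) = - (qpow \<tau> (1/8) * ((-1) ^ n * (1 / h) ^ (2*n+1) * q ^ (n * (n + 1) div 2)))"
    unfolding t_def he' minus_one_powi_neg by (simp only: qe) simp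
qed

section \<open>Theta: product, zeros, quasi-periods\<close>

context
  fixes \<tau> :: complex
  assumes tau: "0 < Im \<tau>"
begin

lemma norm_q_less_1: "norm (qpow \<tau> 1) < 1"
  using tau by (simp add: norm_qpow)

theorem theta_sums:
  "(\<lambda>n. qpow \<tau> (1/8) * ((-1) ^ n * (exp (pii * z) ^ (2*n+1) - 1 / exp (pii * z) ^ (2*n+1)) *
     qpow \<tau> 1 ^ (n * (n + 1) div 2))) sums theta z \<tau>"
proof -
  define h where "h = exp (pii * z)"
  define q where "q = qpow \<tau> 1"
  define t where "t = (\<lambda>n::int. (-1) powi n * exp (pii * of_int (2*n+1) * z) * qpow \<tau> (of_int (n*(n+1)) / 2 + 1/8))"
  have s: "summable (\<lambda>n. norm (c * ((-1) ^ n * g ^ (2*n+1) * q ^ (n * (n + 1) div 2))))" for g c :: complex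
  proof -
    have "norm (c * ((-1) ^ n * g ^ (2*n+1) * q ^ (n * (n + 1) div 2))) =
        (norm c * norm g) * ((norm g)\<^sup>2 ^ n * norm q ^ (n * (n + 1) div 2))" for n
      by (simp add: norm_mult norm_power power_mult)
    then show ?thesis
      using norm_q_less_1 by (auto intro!: summable_mult summable_power_superlinear simp: q_def)
  qed
  have t1: "t (int n) = qpow \<tau> (1/8) * ((-1) ^ n * h ^ (2*n+1) * q ^ (n * (n + 1) div 2))"
    and t2: "t (- int n - 1) = - (qpow \<tau> (1/8) * ((-1) ^ n * (1 / h) ^ (2*n+1) * q ^ (n * (n + 1) div 2)))" for n
    unfolding t_def h_def q_def by (rule theta_term)+
  have "summable (\<lambda>n. norm (t (int n)))" "summable (\<lambda>n. norm (t (- int n - 1)))"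
    unfolding t1 t2 norm_minus_cancel by (rule s)+
  note * = has_sum_int_split[OF this]
  have "t (int n) + t (- int n - 1) = qpow \<tau> (1/8) * ((-1) ^ n * (h ^ (2*n+1) - 1 / h ^ (2*n+1)) * q ^ (n * (n + 1) div 2))" for n
    unfolding t1 t2 power_one_over by (simp add: algebra_simps)
  then show "(\<lambda>n. qpow \<tau> (1/8) * ((-1) ^ n * (h ^ (2*n+1) - 1 / h ^ (2*n+1)) * q ^ (n * (n + 1) div 2))) sums theta z \<tau>"
    using *(1) by (simp add: theta_def t_def)
qed

lemma theta_product:
  "theta z \<tau> = (exp (pii * z) - 1 / exp (pii * z)) * (qpow \<tau> (1/8) * (qinf (qpow \<tau> 1) (qpow \<tau> 1) *
     qinf (exp (2 * of_real pi * \<i> * z) * qpow \<tau> 1) (qpow \<tau> 1) * qinf (qpow \<tau> 1 / exp (2 * of_real pi * \<i> * z)) (qpow \<tau> 1)))"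
proof -
  define h where "h = exp (pii * z)"
  have h2: "exp (2 * of_real pi * \<i> * z) = h\<^sup>2"
    unfolding h_def by (simp add: mult_ac flip: exp_double)
  have "h \<noteq> 0" by (simp add: h_def)
  from sums_mult[OF triple_product[OF this qpow_nonzero norm_q_less_1], of "qpow \<tau> (1/8)"]
  have "theta z \<tau> = qpow \<tau> (1/8) * ((h - 1/h) * (qinf (qpow \<tau> 1) (qpow \<tau> 1) * qinf (h\<^sup>2 * qpow \<tau> 1) (qpow \<tau> 1) * qinf (qpow \<tau> 1 / h\<^sup>2) (qpow \<tau> 1)))"
    by (rule sums_unique2[OF theta_sums[of z, folded h_def]])
  then show ?thesis unfolding h2 h_def[symmetric] by (simp only: mult_ac)
qed

lemma regular_exp:
  assumes "\<And>m n::int. z \<noteq> of_int m * \<tau> + of_int n"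
  shows "regular (qpow \<tau> 1) (exp (2 * of_real pi * \<i> * z))"
proof -
  have "exp (2 * of_real pi * \<i> * (of_int m * \<tau> + z)) \<noteq> 1" for m :: int
  proof
    assume "exp (2 * of_real pi * \<i> * (of_int m * \<tau> + z)) = 1"
    then obtain n :: int where "2 * of_real pi * \<i> * (of_int m * \<tau> + z) = of_int (2 * n) * of_real pi * \<i>"
      unfolding exp_eq_1 by (auto simp: complex_eq_iff)
    then have "(pii * 2) * (of_int m * \<tau> + z) = (pii * 2) * of_int n"
      by (simp add: algebra_simps)
    then have "of_int m * \<tau> + z = of_int n"
      by (rule mult_left_cancel[THEN iffD1, rotated]) simp
    then have "z = of_int (- m) * \<tau> + of_int n" by (simp add: algebra_simps)
    with assms show False by blast
  qed
  note ne = this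
  have "exp (2 * of_real pi * \<i> * z) * qpow \<tau> 1 ^ k \<noteq> 1" for k
    using ne[of "int k"] unfolding qpow_power by (simp add: qpow_def algebra_simps flip: exp_add)
  moreover have "qpow \<tau> 1 ^ k / exp (2 * of_real pi * \<i> * z) \<noteq> 1" for k
    using ne[of "- int k"] unfolding qpow_power by (simp add: qpow_def algebra_simps exp_add exp_diff)
  ultimately show ?thesis by (simp add: regular_def[OF qpow_nonzero norm_q_less_1])
qed

lemma exp_half_minus_inverse_nonzero:
  assumes "\<And>m n::int. z \<noteq> of_int m * \<tau> + of_int n"
  shows "exp (pii * z) - 1 / exp (pii * z) \<noteq> 0"
proof
  assume "exp (pii * z) - 1 / exp (pii * z) = 0"
  then have "exp (pii * z) * exp (pii * z) = 1" by (simp add: field_simps)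
  then have "exp (2 * of_real pi * \<i> * z) * qpow \<tau> 1 ^ 0 = 1"
    by (simp add: mult_ac flip: exp_add mult_2)
  with regular_shifts(4)[OF qpow_nonzero norm_q_less_1 regular_exp[OF assms], of 0] show False by simp
qed

lemma qinf_regular_nonzero:
  assumes "regular (qpow \<tau> 1) w"
  shows "qinf (w * qpow \<tau> 1) (qpow \<tau> 1) \<noteq> 0" "qinf (qpow \<tau> 1 / w) (qpow \<tau> 1) \<noteq> 0"
  using regular_shifts(2,3)[OF qpow_nonzero norm_q_less_1 assms, of 0]
    qinf_nonzero[OF norm_q_less_1, of "w * qpow \<tau> 1"] qinf_nonzero[OF norm_q_less_1, of "qpow \<tau> 1 / w"]
  by auto

lemma theta_nonzero:
  assumes "\<And>m n::int. z \<noteq> of_int m * \<tau> + of_int n"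
  shows "theta z \<tau> \<noteq> 0"
  unfolding theta_product
  using exp_half_minus_inverse_nonzero[OF assms] qinf_regular_nonzero[OF regular_exp[OF assms]]
    qinf_q_nonzero[OF norm_q_less_1] by simp

lemma theta_0 [simp]: "theta 0 \<tau> = 0"
  by (simp add: theta_product)

lemma theta_minus: "theta (- z) \<tau> = - theta z \<tau>"
proof -
  have "exp (pii * - z) = 1 / exp (pii * z)" "exp (2 * of_real pi * \<i> * - z) = 1 / exp (2 * of_real pi * \<i> * z)"
    by (simp_all add: exp_minus field_simps)
  then show ?thesis unfolding theta_product by (simp add: algebra_simps)
qed

lemma holomorphic_qinf_compose: "f holomorphic_on S \<Longrightarrow> (\<lambda>z. qinf (f z) (qpow \<tau> 1)) holomorphic_on S"
  using holomorphic_on_compose_gen[of f S "\<lambda>a. qinf a (qpow \<tau> 1)" UNIV] holomorphic_qinf[OF norm_q_less_1]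
  by (simp add: o_def)

lemma holomorphic_theta: "(\<lambda>z. theta z \<tau>) holomorphic_on UNIV"
  unfolding theta_product by (intro holomorphic_intros holomorphic_qinf_compose) auto

lemma theta_plus_1: "theta (z + 1) \<tau> = - theta z \<tau>"
proof -
  have "exp (pii * (z + 1)) = - exp (pii * z)" "exp (2 * of_real pi * \<i> * (z + 1)) = exp (2 * of_real pi * \<i> * z)"
    by (simp_all add: distrib_left exp_add)
  then show ?thesis unfolding theta_product by (simp add: algebra_simps)
qed

text \<open>The substitution z \<mapsto> z + \<tau> acts on the series as the index shift n
  \<mapsto> n + 1, up to a factor independent of n.\<close>

lemma theta_plus_tau: "theta (z + \<tau>) \<tau> = - exp (- (pii * (\<tau> + 2 * z))) * theta z \<tau>"
proof -
  define g where "g = (\<lambda>n::int. (-1) powi n * exp (pii * of_int (2*n+1) * z) * qpow \<tau> (of_int (n*(n+1)) / 2 + 1/8))"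
  have "theta (z + \<tau>) \<tau> = (\<Sum>\<^sub>\<infinity>n. (- exp (- (pii * (\<tau> + 2 * z)))) * g (n + 1))"
    unfolding theta_def
  proof (rule infsum_cong)
    fix n :: int
    have "(-1) powi (n + 1) = - ((-1) powi n :: complex)" by (simp add: power_int_add)
    then show "(-1) powi n * exp (pii * of_int (2*n+1) * (z + \<tau>)) * qpow \<tau> (of_int (n*(n+1)) / 2 + 1/8) =
        - exp (- (pii * (\<tau> + 2 * z))) * g (n + 1)"
      unfolding g_def qpow_def by (simp add: field_simps flip: exp_add)
  qed
  also have "\<dots> = - exp (- (pii * (\<tau> + 2 * z))) * (\<Sum>\<^sub>\<infinity>n. g (n + 1))"
    by (rule infsum_cmult_right')
  also have "(\<Sum>\<^sub>\<infinity>n. g (n + 1)) = infsum g UNIV"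
    by (rule infsum_reindex_bij_betw) (auto intro!: bij_betw_byWitness[where f' = "\<lambda>n. n - 1"])
  finally show ?thesis by (simp add: theta_def g_def)
qed

lemma theta_quasi_periodic:
  "theta (z + of_int l * \<tau> + of_int n) \<tau> = (-1) powi (l + n) * exp (- (pii * (of_int (l\<^sup>2) * \<tau> + 2 * of_int l * z))) * theta z \<tau>"
proof -
  have 1: "theta (z + of_int n) \<tau> = (-1) powi n * theta z \<tau>" for z and n :: int
  proof (induction n arbitrary: z rule: int_induct[where k = 0])
    case (step1 i)
    have "theta (z + of_int (i + 1)) \<tau> = - theta (z + of_int i) \<tau>" using theta_plus_1[of "z + of_int i"] by (simp add: add_ac)
    with step1 show ?case by (simp add: power_int_add)
  next
    case (step2 i)
    have "theta (z + of_int i) \<tau> = - theta (z + of_int (i - 1)) \<tau>" using theta_plus_1[of "z + of_int (i - 1)"] by (simp add: algebra_simps)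
    with step2 show ?case by (simp add: power_int_diff)
  qed simp
  have 2: "theta (z + of_int l * \<tau>) \<tau> = (-1) powi l * exp (- (pii * (of_int (l\<^sup>2) * \<tau> + 2 * of_int l * z))) * theta z \<tau>" for z and l :: int
  proof (induction l arbitrary: z rule: int_induct[where k = 0])
    case (step1 i)
    have "theta (z + of_int (i + 1) * \<tau>) \<tau> = theta (z + of_int i * \<tau> + \<tau>) \<tau>" by (simp add: algebra_simps)
    also have "\<dots> = - exp (- (pii * (\<tau> + 2 * (z + of_int i * \<tau>)))) * theta (z + of_int i * \<tau>) \<tau>" by (rule theta_plus_tau)
    also have "\<dots> = (-1) powi (i + 1) * (exp (- (pii * (\<tau> + 2 * (z + of_int i * \<tau>)))) * exp (- (pii * (of_int (i\<^sup>2) * \<tau> + 2 * of_int i * z)))) * theta z \<tau>"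
      unfolding step1(2) by (simp add: power_int_add)
    also have "exp (- (pii * (\<tau> + 2 * (z + of_int i * \<tau>)))) * exp (- (pii * (of_int (i\<^sup>2) * \<tau> + 2 * of_int i * z)))
        = exp (- (pii * (of_int ((i + 1)\<^sup>2) * \<tau> + 2 * of_int (i + 1) * z)))"
      unfolding exp_add[symmetric] by (rule arg_cong[where f = exp]) (simp add: algebra_simps power2_eq_square)
    finally show ?case .
  next
    case (step2 i)
    define y where "y = z + of_int (i - 1) * \<tau>"
    have "theta (y + \<tau>) \<tau> = (-1) powi i * exp (- (pii * (of_int (i\<^sup>2) * \<tau> + 2 * of_int i * z))) * theta z \<tau>"
      using step2(2)[of z] by (simp add: y_def algebra_simps)
    then have "- exp (- (pii * (\<tau> + 2 * y))) * theta y \<tau> = (-1) powi i * exp (- (pii * (of_int (i\<^sup>2) * \<tau> + 2 * of_int i * z))) * theta z \<tau>"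
      unfolding theta_plus_tau .
    note e = this
    have "exp (pii * (\<tau> + 2 * y)) * exp (- (pii * (\<tau> + 2 * y))) = 1"
      by (simp flip: exp_add)
    then have "theta y \<tau> = - (exp (pii * (\<tau> + 2 * y)) * (- exp (- (pii * (\<tau> + 2 * y))) * theta y \<tau>))"
      by (simp add: mult.assoc[symmetric])
    also have "\<dots> = - ((-1) powi i) * (exp (pii * (\<tau> + 2 * y)) * exp (- (pii * (of_int (i\<^sup>2) * \<tau> + 2 * of_int i * z)))) * theta z \<tau>"
      unfolding e by simp
    also have "exp (pii * (\<tau> + 2 * y)) * exp (- (pii * (of_int (i\<^sup>2) * \<tau> + 2 * of_int i * z)))
        = exp (- (pii * (of_int ((i - 1)\<^sup>2) * \<tau> + 2 * of_int (i - 1) * z)))"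
      unfolding exp_add[symmetric] y_def by (rule arg_cong[where f = exp]) (simp add: algebra_simps power2_eq_square)
    also have "- ((-1) powi i) = ((-1) powi (i - 1) :: complex)" by (simp add: power_int_diff)
    finally show ?case by (simp only: y_def)
  qed simp
  have "theta (z + of_int l * \<tau> + of_int n) \<tau> = (-1) powi n * ((-1) powi l * exp (- (pii * (of_int (l\<^sup>2) * \<tau> + 2 * of_int l * z))) * theta z \<tau>)"
    unfolding 1 2 ..
  then show ?thesis by (simp add: power_int_add)
qed

lemma theta_tau_plus_1: "theta z (\<tau> + 1) = exp (pii / 4) * theta z \<tau>"
proof -
  have "qpow (\<tau> + 1) 1 = qpow \<tau> 1"
    unfolding qpow_def by (simp add: distrib_left exp_add)
  moreover have "qpow (\<tau> + 1) (1/8) = exp (pii / 4) * qpow \<tau> (1/8)"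
    unfolding qpow_def exp_add[symmetric] by (rule arg_cong[where f = exp]) (simp add: field_simps)
  moreover have "0 < Im (\<tau> + 1)" using tau by simp
  ultimately show ?thesis
    using theta_product Submission.theta_product[of "\<tau> + 1" z] by (simp add: mult_ac)
qed

text \<open>The cube of eta, which is the derivative of \<open>theta\<close> at 0 divided by 2 pi
  i.\<close>

definition theta_prime0 :: complex where
  "theta_prime0 = qpow \<tau> (1/8) * qinf (qpow \<tau> 1) (qpow \<tau> 1) ^ 3"

lemma theta_prime0_nonzero: "theta_prime0 \<noteq> 0"
  by (simp add: theta_prime0_def qinf_q_nonzero[OF norm_q_less_1])

text \<open>In the product formula h - 1/h vanishes at z = 0, so only the value there of the
  remaining factor enters.\<close>

lemma theta_deriv_0: "((\<lambda>z. theta z \<tau>) has_field_derivative (2 * of_real pi * \<i> * theta_prime0)) (at 0)"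
proof -
  define u where "u z = qpow \<tau> (1/8) * (qinf (qpow \<tau> 1) (qpow \<tau> 1) *
     qinf (exp (2 * of_real pi * \<i> * z) * qpow \<tau> 1) (qpow \<tau> 1) * qinf (qpow \<tau> 1 / exp (2 * of_real pi * \<i> * z)) (qpow \<tau> 1))" for z
  have "u holomorphic_on UNIV" unfolding u_def by (intro holomorphic_intros holomorphic_qinf_compose) auto
  then obtain u' where u': "(u has_field_derivative u') (at 0)"
    by (auto simp: holomorphic_on_def field_differentiable_def)
  have e: "((\<lambda>z. exp (pii * z) - 1 / exp (pii * z)) has_field_derivative (2 * of_real pi * \<i>)) (at 0)"
    by (auto intro!: derivative_eq_intros simp: algebra_simps)
  have "u 0 = theta_prime0" by (simp add: u_def theta_prime0_def power3_eq_cube)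
  with DERIV_mult[OF e u'] show ?thesis
    unfolding theta_product u_def[symmetric] by simp
qed

section \<open>The eta quotient and the closed form of \<open>K_comb\<close>\<close>

lemma eta_qinf: "eta \<tau> = qpow \<tau> (1/24) * qinf (qpow \<tau> 1) (qpow \<tau> 1)"
  by (simp add: eta_def qinf_def)

lemma eta_double_qinf: "eta (2 * \<tau>) = qpow \<tau> (1/12) * qinf (qpow \<tau> 1 ^ 2) (qpow \<tau> 1 ^ 2)"
  by (simp add: eta_def qinf_def qpow_double qpow_power)

text \<open>The fractional powers of q cancel, since 4/24 = 2/12; the rest is the splitting of (q;
  q) by parity of exponents.\<close>

lemma eta_quotient:
  "eta \<tau> ^ 4 / eta (2 * \<tau>) ^ 2 = (qinf (qpow \<tau> 1) (qpow \<tau> 1) * qinf (qpow \<tau> 1) (qpow \<tau> 1 ^ 2)) ^ 2"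
proof -
  define q where "q = qpow \<tau> 1"
  have q: "norm q < 1" "norm (q\<^sup>2) < 1"
    using norm_q_less_1 by (auto simp: q_def norm_power power_less_one_iff)
  have nz: "qinf (q\<^sup>2) (q\<^sup>2) \<noteq> 0" by (rule qinf_q_nonzero[OF q(2)])
  have "qpow \<tau> (1/24) ^ 4 = qpow \<tau> (1/12) ^ 2" by (simp add: qpow_power)
  then have "eta \<tau> ^ 4 / eta (2 * \<tau>) ^ 2 = qinf q q ^ 4 / qinf (q\<^sup>2) (q\<^sup>2) ^ 2"
    unfolding eta_qinf eta_double_qinf q_def[symmetric] by (simp add: power_mult_distrib)
  also have "\<dots> = (qinf q q * qinf q (q\<^sup>2)) ^ 2"
  proof -
    have "qinf q q ^ 4 = (qinf q q * (qinf q (q\<^sup>2) * qinf (q\<^sup>2) (q\<^sup>2))) ^ 2"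
      using qinf_square[OF q(1)] by (simp add: power2_eq_square power4_eq_xxxx)
    then show ?thesis using nz by (simp add: power_mult_distrib)
  qed
  finally show ?thesis by (simp add: q_def)
qed

lemma K1_eq_KA:
  assumes "regular (qpow \<tau> 1) w"
  shows "K1 w \<tau> = KA (qpow \<tau> 1) w"
proof -
  define q where "q = qpow \<tau> 1"
  have q: "q \<noteq> 0" "norm q < 1" using norm_q_less_1 by (auto simp: q_def)
  have "summable (\<lambda>n. norm (KA_term q w n))"
  proof (rule summable_norm_KA_term[OF q])
    note r = assms[folded q_def]
    show "w \<noteq> 0" by (rule regular_shifts(1)[OF q r])
    show "w * q\<^sup>2 * q ^ k \<noteq> 1" "q\<^sup>2 / w * q ^ k \<noteq> 1" for k
      using regular_shifts(2,3)[OF q r, of 1 k] by (simp_all add: power2_eq_square)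
  qed
  note s = this
  have "(KA_term q w has_sum KA q w) UNIV"
    unfolding KA_def by (rule norm_summable_imp_has_sum[OF s summable_sums[OF summable_norm_cancel[OF s]]])
  then have "infsum (KA_term q w) UNIV = KA q w" by (rule infsumI)
  then show ?thesis by (simp add: K1_def KA_term_def[abs_def] q_def)
qed

lemma K2_eq_KB:
  assumes "regular (qpow \<tau> 1) w"
  shows "K2 w \<tau> = KB (qpow \<tau> 1) w"
proof -
  define q where "q = qpow \<tau> 1"
  have q: "q \<noteq> 0" "norm q < 1" using norm_q_less_1 by (auto simp: q_def)
  define f where "f n = (-1)^n * q^(n^2) * qpoch q (q^2) (n - 1) / (qpoch (w * q) (q^2) n * qpoch (q / w) (q^2) n)" for n
  have "summable (\<lambda>n. norm (KB_term q w n))"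
  proof (rule summable_norm_KB_term[OF q])
    note r = assms[folded q_def]
    show "w \<noteq> 0" by (rule regular_shifts(1)[OF q r])
    show "w * q * q ^ k \<noteq> 1" "q / w * q ^ k \<noteq> 1" for k
      using regular_shifts(2,3)[OF q r, of 0 k] by simp_all
  qed
  note s = this
  have "(KB_term q w has_sum KB q w) UNIV"
    unfolding KB_def by (rule norm_summable_imp_has_sum[OF s summable_sums[OF summable_norm_cancel[OF s]]])
  moreover have "KB_term q w = f \<circ> Suc" by (auto simp: KB_term_def f_def o_def)
  ultimately have "(f has_sum KB q w) (range Suc)"
    by (subst has_sum_reindex) auto
  moreover have "range Suc = {1..}" by (auto simp: image_iff) (metis Suc_le_D)
  ultimately have "infsum f {1..} = KB q w" by (simp add: infsumI)
  then show ?thesis by (simp add: K2_def f_def[abs_def] q_def)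
qed

theorem K_comb_eq:
  assumes "\<And>m n::int. z \<noteq> of_int m * \<tau> + of_int n"
  shows "K_comb z \<tau> = - (eta \<tau> ^ 4 / (eta (2 * \<tau>) ^ 2 * theta z \<tau>))"
proof -
  define q where "q = qpow \<tau> 1"
  define h where "h = exp (pii * z)"
  define w where "w = exp (2 * of_real pi * \<i> * z)"
  have q: "q \<noteq> 0" "norm q < 1" using norm_q_less_1 by (auto simp: q_def)
  have reg: "regular q w" using regular_exp[OF assms] by (simp add: q_def w_def)
  have h: "h \<noteq> 0" "h - 1/h \<noteq> 0" using exp_half_minus_inverse_nonzero[OF assms] by (auto simp: h_def)
  have h': "1/h - h \<noteq> 0" using h(2) by (metis right_minus_eq)
  have wh: "w = h * h" by (simp add: w_def h_def mult_ac flip: exp_add mult_2)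
  have n: "qinf (w * q) q \<noteq> 0" "qinf (q / w) q \<noteq> 0" "qinf q q \<noteq> 0" "qinf (q\<^sup>2) (q\<^sup>2) \<noteq> 0"
    using qinf_regular_nonzero[of w] reg qinf_q_nonzero[OF q(2)] qinf_q_nonzero[of "q\<^sup>2"] q norm_q2[OF q]
    by (auto simp: q_def)
  define T where "T = KA q w + (1 - w) * (1 - 1 / w) * KB q w"
  have "T * (qinf (w * q) q * qinf (q / w) q) = qinf q (q\<^sup>2) / qinf (q\<^sup>2) (q\<^sup>2) * (qinf q q)\<^sup>2"
    using KZ_value[OF q reg] by (simp add: KZ_def[OF q] T_def)
  moreover have "qinf q q = qinf q (q\<^sup>2) * qinf (q\<^sup>2) (q\<^sup>2)" by (rule qinf_square[OF q(2)])
  ultimately have T: "T = qinf q q * (qinf q (q\<^sup>2))\<^sup>2 / (qinf (w * q) q * qinf (q / w) q)"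
    using n by (simp add: field_simps power2_eq_square)
  \<comment> \<open>This makes 1/(1/h - h) a common prefactor of both summands of
    \<open>K_comb\<close>, leaving the bracket of \<open>KZ\<close>. The minus sign of the result
    comes from 1/h - h standing where \<open>theta\<close> has h - 1/h.\<close>
  have e: "(1 - w) * (1 - 1 / w) = (h - 1/h) * (1/h - h)" unfolding wh using h(1) by (simp add: field_simps)
  have "K_comb z \<tau> = qpow \<tau> (-1/8) / (1/h - h) * KA q w + qpow \<tau> (-1/8) * (h - 1/h) * KB q w"
    unfolding K_comb_def Let_def w_def[symmetric] h_def[symmetric]
    using K1_eq_KA K2_eq_KB reg by (simp add: q_def)
  also have "\<dots> = qpow \<tau> (-1/8) / (1/h - h) * T"
    unfolding T_def e using h' by (simp add: distrib_left)
  also have "qpow \<tau> (-1/8) = 1 / qpow \<tau> (1/8)" using qpow_minus[of \<tau> "1/8"] by simp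
  also have "1 / qpow \<tau> (1/8) / (1/h - h) * T = - ((qinf q q * qinf q (q\<^sup>2)) ^ 2 / ((h - 1/h) * (qpow \<tau> (1/8) * (qinf q q * qinf (w * q) q * qinf (q / w) q))))"
  proof -
    have "1 / p / (- x) * (A * B\<^sup>2 / (C * D)) = - ((A * B)\<^sup>2 / (x * (p * (A * C * D))))"
      if "A \<noteq> 0" for p x A B C D :: complex
      using that by (simp add: power2_eq_square mult_ac)
    from this[OF n(3), of _ "h - 1/h"] show ?thesis unfolding T by simp
  qed
  also have "\<dots> = - (eta \<tau> ^ 4 / eta (2 * \<tau>) ^ 2 / theta z \<tau>)"
    unfolding eta_quotient theta_product q_def w_def h_def by simp
  finally show ?thesis by simp
qed

end

section \<open>The inversion formula\<close>

lemma Im_neg_inverse: "0 < Im \<tau> \<Longrightarrow> 0 < Im (- 1 / \<tau>)"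
  by (simp add: Im_divide sum_power2_gt_zero_iff zero_less_divide_iff)

section \<open>Period parallelograms and the shape of the inversion formula\<close>

context
  fixes \<tau> :: complex
  assumes tau: "0 < Im \<tau>"
begin

text \<open>The points x \<tau> + y with x and y in the open interval from -1 to 1: open and
  connected, as the maximum principle requires, and small enough that 0 is the only lattice point in
  it.\<close>

definition period_cell :: "complex set" where
  "period_cell = (\<lambda>z. Im z / Im \<tau>) -` {-1<..<1} \<inter> (\<lambda>z. Re z - Im z / Im \<tau> * Re \<tau>) -` {-1<..<1}"

lemma period_cell: "open period_cell" "connected period_cell" "0 \<in> period_cell"
proof -
  show "open period_cell" unfolding period_cell_def
    by (intro open_Int open_vimage) (use tau in \<open>auto intro!: continuous_intros\<close>)
  have "convex period_cell" unfolding period_cell_def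
    by (intro convex_Int convex_linear_vimage linearI) (auto simp: add_divide_distrib algebra_simps)
  then show "connected period_cell" by (rule convex_connected)
qed (simp add: period_cell_def)

lemma period_cell_lattice:
  assumes "of_int m * \<tau> + of_int n \<in> period_cell" shows "m = 0" "n = 0"
proof -
  from assms tau have m: "- 1 < real_of_int m" "real_of_int m < 1"
    and n: "- 1 < real_of_int n" "real_of_int n < 1"
    by (auto simp: period_cell_def)
  then show "m = 0" "n = 0" by linarith+
qed

text \<open>A compact cell inside \<open>period_cell\<close> that meets every class modulo the
  lattice; the maximum of a doubly periodic function is attained here.\<close>

definition fundamental_cell :: "complex set" where
  "fundamental_cell = (\<lambda>(x, y). of_real x * \<tau> + of_real y) ` ({-1/2..1/2} \<times> {-1/2..1/2})"

lemma fundamental_cell: "compact fundamental_cell" "fundamental_cell \<subseteq> period_cell" "fundamental_cell \<noteq> {}"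
proof -
  have "compact ({-1/2..1/2::real} \<times> {-1/2..1/2::real})"
    by (intro compact_Times) auto
  then show "compact fundamental_cell" unfolding fundamental_cell_def
    by (rule compact_continuous_image[rotated]) (auto intro!: continuous_intros simp: case_prod_unfold)
  show "fundamental_cell \<subseteq> period_cell"
    using tau by (auto simp: fundamental_cell_def period_cell_def)
qed (auto simp: fundamental_cell_def)

lemma fundamental_cell_shift:
  obtains m n :: int where "z + of_int m * \<tau> + of_int n \<in> fundamental_cell"
proof -
  define x where "x = Im z / Im \<tau>"
  define y where "y = Re z - x * Re \<tau>"
  have z: "z = of_real x * \<tau> + of_real y" using tau by (simp add: complex_eq_iff x_def y_def)
  have r: "t - of_int (round t) \<in> {-1/2..1/2}" for t :: real
    using of_int_round_abs_le[of t] unfolding atLeastAtMost_iff by linarith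
  have "z + of_int (- round x) * \<tau> + of_int (- round y) = of_real (x - round x) * \<tau> + of_real (y - round y)"
    unfolding z by (simp add: algebra_simps)
  moreover have "\<dots> \<in> fundamental_cell"
    unfolding fundamental_cell_def using r[of x] r[of y]
    by (intro image_eqI[of _ _ "(x - round x, y - round y)"]) auto
  ultimately show ?thesis using that by metis
qed

text \<open>After division by exp(pi i z^2 / \<tau>) the left-hand side has the same quasi-periods
  as theta(z; \<tau>). Their quotient is doubly periodic, and its only possible pole modulo the
  lattice, at 0, is removable because the zero of \<open>theta\<close> there is simple; so it is
  constant.\<close>

lemma theta_inversion_ex: "\<exists>C. \<forall>z. theta (z / \<tau>) (- 1 / \<tau>) = C * exp (pii * z\<^sup>2 / \<tau>) * theta z \<tau>"
proof -
  define \<sigma> where "\<sigma> = - 1 / \<tau>"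
  have t0: "\<tau> \<noteq> 0" using tau by auto
  have sigma: "0 < Im \<sigma>" unfolding \<sigma>_def by (rule Im_neg_inverse[OF tau])
  define N where "N z = theta (z / \<tau>) \<sigma> * exp (- (pii * z\<^sup>2 / \<tau>))" for z
  have holN: "N holomorphic_on UNIV"
  proof -
    have "(\<lambda>z. z / \<tau>) holomorphic_on UNIV" using t0 by (intro holomorphic_intros)
    from holomorphic_on_compose_gen[OF this holomorphic_theta[OF sigma]]
    have "(\<lambda>z. theta (z / \<tau>) \<sigma>) holomorphic_on UNIV" by (simp add: o_def)
    then show ?thesis unfolding N_def using t0 by (intro holomorphic_intros) auto
  qed
  have N0: "N 0 = 0" by (simp add: N_def theta_0[OF sigma])
  have Nq: "N (z + of_int l * \<tau> + of_int n) = (-1) powi (l + n) * exp (- (pii * (of_int (l\<^sup>2) * \<tau> + 2 * of_int l * z))) * N z"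
    for z and l n :: int
  proof -
    have "(z + of_int l * \<tau> + of_int n) / \<tau> = z / \<tau> + of_int (- n) * \<sigma> + of_int l"
      using t0 by (simp add: \<sigma>_def field_simps)
    then have "N (z + of_int l * \<tau> + of_int n) = (-1) powi (- n + l) * (exp (- (pii * (of_int ((- n)\<^sup>2) * \<sigma> + 2 * of_int (- n) * (z / \<tau>)))) *
        exp (- (pii * (z + of_int l * \<tau> + of_int n)\<^sup>2 / \<tau>))) * theta (z / \<tau>) \<sigma>"
      unfolding N_def using theta_quasi_periodic[OF sigma, of "z / \<tau>" "- n" l] by (simp add: mult_ac)
    \<comment> \<open>The terms in n^2 and n z cancel. Beyond the expected exponent there remains
      only -2 pi i l n, from the mixed term of the square.\<close>
    also have "exp (- (pii * (of_int ((- n)\<^sup>2) * \<sigma> + 2 * of_int (- n) * (z / \<tau>)))) *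
        exp (- (pii * (z + of_int l * \<tau> + of_int n)\<^sup>2 / \<tau>)) =
        exp (- (pii * (of_int (l\<^sup>2) * \<tau> + 2 * of_int l * z)) + - (pii * z\<^sup>2 / \<tau>) + 2 * of_real pi * \<i> * of_int (- (l * n)))"
      unfolding exp_add[symmetric] using t0
      by (intro arg_cong[where f = exp]) (simp add: \<sigma>_def field_simps power2_eq_square)
    also have "\<dots> = exp (- (pii * (of_int (l\<^sup>2) * \<tau> + 2 * of_int l * z))) * exp (- (pii * z\<^sup>2 / \<tau>))"
    proof -
      have "exp (2 * of_real pi * \<i> * of_int (- (l * n))) = 1"
        by (rule exp_eq_1[THEN iffD2]) (auto intro!: exI[of _ "- (l * n)"])
      then show ?thesis unfolding exp_add by simp
    qed
    also have "(-1) powi (- n + l) = ((-1) powi (l + n) :: complex)"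
      by (simp add: power_int_minus_left)
    finally show ?thesis by (simp add: N_def mult_ac)
  qed
  \<comment> \<open>Difference quotients at 0 divide the zero out of numerator and denominator, so
    that their quotient \<open>f\<close> is holomorphic at 0 as well.\<close>
  define N1 where "N1 = (\<lambda>z. if z = 0 then deriv N 0 else (N z - N 0) / (z - 0))"
  define T1 where "T1 = (\<lambda>z. if z = 0 then deriv (\<lambda>z. theta z \<tau>) 0 else (theta z \<tau> - theta 0 \<tau>) / (z - 0))"
  have hol1: "N1 holomorphic_on period_cell" "T1 holomorphic_on period_cell"
    unfolding N1_def T1_def
    by (rule pole_lemma_open[OF holomorphic_on_subset[OF holN subset_UNIV] period_cell(1)],
        rule pole_lemma_open[OF holomorphic_on_subset[OF holomorphic_theta[OF tau] subset_UNIV] period_cell(1)])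
  have nz: "theta z \<tau> \<noteq> 0" if "z \<in> period_cell" "z \<noteq> 0" for z
  proof (rule theta_nonzero[OF tau])
    fix m n :: int
    show "z \<noteq> of_int m * \<tau> + of_int n"
      using that period_cell_lattice[of m n] by auto
  qed
  have T1: "T1 z \<noteq> 0" if "z \<in> period_cell" for z
    using nz[OF that] theta_0[OF tau] theta_prime0_nonzero[OF tau] DERIV_imp_deriv[OF theta_deriv_0[OF tau]]
    by (auto simp: T1_def)
  define f where "f z = N1 z / T1 z" for z
  have f: "f z = N z / theta z \<tau>" if "z \<noteq> 0" for z
    using that N0 theta_0[OF tau] by (simp add: f_def N1_def T1_def)
  have holf: "f holomorphic_on period_cell" unfolding f_def using hol1 T1 by (intro holomorphic_intros)
  have "continuous_on fundamental_cell (\<lambda>z. norm (f z))"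
    by (intro continuous_on_norm holomorphic_on_imp_continuous_on holomorphic_on_subset[OF holf] fundamental_cell)
  then obtain x where x: "x \<in> fundamental_cell" "\<And>y. y \<in> fundamental_cell \<Longrightarrow> norm (f y) \<le> norm (f x)"
    using continuous_attains_sup[OF fundamental_cell(1,3), of "\<lambda>z. norm (f z)"] by auto
  have max: "norm (f z) \<le> norm (f x)" if z: "z \<in> period_cell" for z
  proof (cases "z = 0")
    case True
    have "0 \<in> fundamental_cell" unfolding fundamental_cell_def by (rule image_eqI[of _ _ "(0, 0)"]) auto
    then show ?thesis using x True by simp
  next
    case False
    obtain m n :: int where mn: "z + of_int m * \<tau> + of_int n \<in> fundamental_cell" by (rule fundamental_cell_shift)
    \<comment> \<open>A translate of a nonzero point of the cell cannot be 0: \<open>theta\<close>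
      would vanish there, hence at z too.\<close>
    have tnz: "theta (z + of_int m * \<tau> + of_int n) \<tau> \<noteq> 0"
      using nz[OF z False] unfolding theta_quasi_periodic[OF tau] by simp
    then have "z + of_int m * \<tau> + of_int n \<noteq> 0" using theta_0[OF tau] by metis
    then have "f (z + of_int m * \<tau> + of_int n) = N (z + of_int m * \<tau> + of_int n) / theta (z + of_int m * \<tau> + of_int n) \<tau>"
      by (rule f)
    also have "\<dots> = f z" unfolding Nq theta_quasi_periodic[OF tau] f[OF False] by simp
    finally show ?thesis using x(2)[OF mn] by simp
  qed
  have "f constant_on period_cell"
  proof (rule maximum_modulus_principle[OF holf period_cell(1,2,1) order_refl])
    show "x \<in> period_cell" using x fundamental_cell(2) by blast
  qed (rule max)
  then obtain C where C: "\<And>z. z \<in> period_cell \<Longrightarrow> f z = C" by (auto simp: constant_on_def)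
  have NC: "N z = C * theta z \<tau>" if "z \<in> period_cell" for z
    using C[OF that] nz[OF that] N0 theta_0[OF tau] f[of z] by (cases "z = 0") (auto simp: field_simps)
  \<comment> \<open>The identity theorem passes from the cell to the whole plane, lattice points
    included.\<close>
  have N: "N z = C * theta z \<tau>" for z
    by (rule analytic_continuation_open[OF period_cell(1) open_UNIV _ connected_UNIV subset_UNIV holN
          holomorphic_on_mult[OF holomorphic_on_const holomorphic_theta[OF tau]]]) (use period_cell(3) NC in auto)
  have "theta (z / \<tau>) (- 1 / \<tau>) = C * exp (pii * z\<^sup>2 / \<tau>) * theta z \<tau>" for z
  proof -
    have "theta (z / \<tau>) \<sigma> = N z * exp (pii * z\<^sup>2 / \<tau>)"
      by (simp add: N_def mult.assoc flip: exp_add)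
    then show ?thesis by (simp add: N \<sigma>_def)
  qed
  then show ?thesis by blast
qed

end

section \<open>Theta functions with characteristics\<close>

text \<open>Theta with characteristics, that is q^(r^2/2) theta(r \<tau> + s). Completing the square
  makes all exponents nonnegative; this is what the factor q^(-r^2/2) of the theorem is for.\<close>

definition thc :: "real \<Rightarrow> real \<Rightarrow> complex \<Rightarrow> complex" where
  "thc r s \<tau> = (\<Sum>\<^sub>\<infinity>n::int. (-1) powi n * exp (pii * of_int (2*n+1) * of_real s) * qpow \<tau> ((of_int n + 1/2 + r)\<^sup>2 / 2))"

lemma thc_theta: "thc r s \<tau> = qpow \<tau> (r\<^sup>2 / 2) * theta (of_real r * \<tau> + of_real s) \<tau>"
  unfolding thc_def theta_def infsum_cmult_right'[symmetric]
proof (rule infsum_cong)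
  fix n :: int
  have "exp (pii * of_int (2*n+1) * of_real s) * qpow \<tau> ((of_int n + 1/2 + r)\<^sup>2 / 2) =
      qpow \<tau> (r\<^sup>2 / 2) * (exp (pii * of_int (2*n+1) * (of_real r * \<tau> + of_real s)) * qpow \<tau> (of_int (n*(n+1)) / 2 + 1/8))"
    unfolding qpow_def exp_add[symmetric]
    by (rule arg_cong[where f = exp]) (simp add: power2_eq_square field_simps)
  then show "(-1) powi n * exp (pii * of_int (2*n+1) * of_real s) * qpow \<tau> ((of_int n + 1/2 + r)\<^sup>2 / 2) =
      qpow \<tau> (r\<^sup>2 / 2) * ((-1) powi n * exp (pii * of_int (2*n+1) * (of_real r * \<tau> + of_real s)) * qpow \<tau> (of_int (n*(n+1)) / 2 + 1/8))"
    by (simp add: mult_ac)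
qed

text \<open>Every theta constant used below is such a series in a fractional power \<open>Q\<close> of \<open>q\<close>.\<close>

definition quad_series :: "nat \<Rightarrow> int \<Rightarrow> (int \<Rightarrow> complex) \<Rightarrow> complex \<Rightarrow> complex" where
  "quad_series M b c Q = (\<Sum>\<^sub>\<infinity>n::int. c n * Q ^ nat ((2 * int M * n + b)\<^sup>2))"

lemma summable_quadratic_exponents:
  fixes r :: real
  assumes M: "M > 0" and r: "0 \<le> r" "r < 1"
  shows "(\<lambda>n::int. r ^ nat ((2 * int M * n + b)\<^sup>2)) summable_on UNIV"
proof (rule has_sum_int_split(2))
  have e: "n \<le> nat ((2 * int M * k + b)\<^sup>2)" if n: "nat \<bar>b\<bar> \<le> n" and k: "k = int n \<or> k = - int n - 1" for n k
  proof -
    have "int n \<le> \<bar>k\<bar>" using k by auto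
    moreover have "2 * \<bar>k\<bar> \<le> 2 * int M * \<bar>k\<bar>" using M by (intro mult_right_mono) auto
    moreover have "2 * int M * \<bar>k\<bar> = \<bar>2 * int M * k\<bar>" by (simp add: abs_mult)
    ultimately have "int n \<le> \<bar>2 * int M * k + b\<bar>" using n by linarith
    also have "\<dots> \<le> \<bar>2 * int M * k + b\<bar> * \<bar>2 * int M * k + b\<bar>"
    proof (cases "2 * int M * k + b = 0")
      case False
      then have "\<bar>2 * int M * k + b\<bar> * 1 \<le> \<bar>2 * int M * k + b\<bar> * \<bar>2 * int M * k + b\<bar>"
        by (intro mult_left_mono) linarith+
      then show ?thesis by simp
    qed simp
    also have "\<dots> = (2 * int M * k + b)\<^sup>2" by (simp add: power2_eq_square abs_mult[symmetric])
    finally show ?thesis by simp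
  qed
  have s: "summable (\<lambda>n. norm (r ^ nat ((2 * int M * k n + b)\<^sup>2)))" if k: "\<And>n. k n = int n \<or> k n = - int n - 1" for k
  proof (rule summable_comparison_test'[where N = "nat \<bar>b\<bar>" and g = "\<lambda>n. r ^ n"])
    fix n assume "nat \<bar>b\<bar> \<le> n"
    then show "norm (norm (r ^ nat ((2 * int M * k n + b)\<^sup>2))) \<le> r ^ n"
      using r e[OF _ k, of n] by (simp add: power_decreasing)
  qed (use r in \<open>simp add: summable_geometric\<close>)
  show "summable (\<lambda>n. norm (r ^ nat ((2 * int M * int n + b)\<^sup>2)))" by (rule s) simp
  show "summable (\<lambda>n. norm (r ^ nat ((2 * int M * (- int n - 1) + b)\<^sup>2)))" by (rule s) simp
qed

lemma quad_series_summable: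
  fixes Q :: complex
  assumes M: "M > 0" and c: "\<And>n. norm (c n) \<le> 1" and Q: "norm Q < 1"
  shows "(\<lambda>n::int. c n * Q ^ nat ((2 * int M * n + b)\<^sup>2)) summable_on UNIV"
proof (rule abs_summable_summable)
  show "(\<lambda>n::int. norm (c n * Q ^ nat ((2 * int M * n + b)\<^sup>2))) summable_on UNIV"
    by (rule Infinite_Sum.abs_summable_on_comparison_test'[OF summable_quadratic_exponents[OF M norm_ge_zero Q, of b]])
      (use c in \<open>auto simp: norm_mult norm_power mult_left_le_one_le\<close>)
qed

lemma quad_series_holomorphic:
  assumes M: "M > 0" and c: "\<And>n. norm (c n) \<le> 1"
  shows "quad_series M b c holomorphic_on ball 0 1"
proof -
  have "quad_series M b c field_differentiable at Q" if Q: "Q \<in> ball 0 1" for Q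
  proof -
    obtain R where R: "norm Q < R" "R < 1" using Q dense[of "norm Q" 1] by auto
    then have R0: "0 \<le> R" using norm_ge_zero[of Q] by linarith
    have "uniform_limit (cball 0 R) (\<lambda>X Q. \<Sum>n\<in>X. c n * Q ^ nat ((2 * int M * n + b)\<^sup>2)) (quad_series M b c) (finite_subsets_at_top UNIV)"
      unfolding quad_series_def[abs_def]
    proof (rule Weierstrass_m_test_general)
      show "(\<lambda>n::int. R ^ nat ((2 * int M * n + b)\<^sup>2)) summable_on UNIV"
        by (rule summable_quadratic_exponents[OF M R0 R(2)])
      fix n and Q :: complex assume "Q \<in> cball 0 R"
      then have "norm Q ^ nat ((2 * int M * n + b)\<^sup>2) \<le> R ^ nat ((2 * int M * n + b)\<^sup>2)"
        by (intro power_mono) auto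
      then have "norm (c n) * norm Q ^ nat ((2 * int M * n + b)\<^sup>2) \<le> 1 * R ^ nat ((2 * int M * n + b)\<^sup>2)"
        using c by (intro mult_mono) auto
      then show "norm (c n * Q ^ nat ((2 * int M * n + b)\<^sup>2)) \<le> R ^ nat ((2 * int M * n + b)\<^sup>2)"
        by (simp add: norm_mult norm_power)
    qed
    then have "quad_series M b c holomorphic_on ball 0 R"
      by (rule holomorphic_uniform_limit[rotated])
         (auto intro!: always_eventually continuous_intros holomorphic_intros)
    then show ?thesis using R by (auto intro: holomorphic_on_imp_differentiable_at)
  qed
  then show ?thesis by (simp add: holomorphic_on_def field_differentiable_at_within)
qed

text \<open>The denominator 8 M^2 is what clears (n + b/(2M))^2 / 2 to the integer (2 M n +
  b)^2.\<close>

lemma qpow_quad_exponent: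
  assumes "M > 0"
  shows "qpow \<tau> (1 / (8 * (real M)\<^sup>2)) ^ nat ((2 * int M * n + b)\<^sup>2) = qpow \<tau> ((of_int n + of_int b / (2 * real M))\<^sup>2 / 2)"
proof -
  have "real (nat ((2 * int M * n + b)\<^sup>2)) = (2 * real M * of_int n + of_int b)\<^sup>2" by simp
  also have "\<dots> = (of_int n + of_int b / (2 * real M))\<^sup>2 * (4 * (real M)\<^sup>2)"
    using assms by (simp add: power2_eq_square field_simps)
  finally show ?thesis unfolding qpow_power using assms by (simp add: field_simps)
qed

lemma thc_quad_series:
  assumes "M > 0"
  shows "thc (of_int u / real M) s \<tau> =
    quad_series M (int M + 2 * u) (\<lambda>n. (-1) powi n * exp (pii * of_int (2*n+1) * of_real s)) (qpow \<tau> (1 / (8 * (real M)\<^sup>2)))"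
  unfolding thc_def quad_series_def qpow_quad_exponent[OF assms]
proof (rule infsum_cong)
  fix n
  have "real_of_int n + 1/2 + of_int u / real M = of_int n + of_int (int M + 2 * u) / (2 * real M)"
    using assms by (simp add: field_simps)
  then show "(-1) powi n * exp (pii * of_int (2*n+1) * of_real s) * qpow \<tau> ((of_int n + 1/2 + of_int u / real M)\<^sup>2 / 2) =
     (-1) powi n * exp (pii * of_int (2*n+1) * of_real s) * qpow \<tau> ((of_int n + of_int (int M + 2 * u) / (2 * real M))\<^sup>2 / 2)"
    by (simp only:)
qed

lemma norm_thc_coeff: "norm ((-1) powi n * exp (pii * of_int (2*n+1) * of_real s) :: complex) = 1"
  by (simp add: norm_mult norm_power_int)

section \<open>Theta constants\<close>

text \<open>Jacobi's theta constants, as values of \<open>theta\<close> at the three half-periods;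
  the prefactors produce the classical series. In this form their behaviour under inversion and
  translation is inherited from \<open>theta\<close>.\<close>

definition th2 :: "complex \<Rightarrow> complex" where "th2 \<tau> = - \<i> * theta (1/2) \<tau>"
definition th3 :: "complex \<Rightarrow> complex" where "th3 \<tau> = - \<i> * exp (pii * \<tau> / 4) * theta ((\<tau> + 1) / 2) \<tau>"
definition th4 :: "complex \<Rightarrow> complex" where "th4 \<tau> = - exp (pii * \<tau> / 4) * theta (\<tau> / 2) \<tau>"

lemma exp_odd_quarter: "exp (pii * of_int (2*n+1) * of_real (1/2)) = \<i> * (-1) powi n"
proof -
  have "exp (pii * of_int (2*n+1) * of_real (1/2)) = exp (of_int n * (pii)) * exp (pii / 2)"
    unfolding exp_add[symmetric] by (rule arg_cong[where f = exp]) (simp add: field_simps)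
  also have "exp (of_int n * (pii)) = exp (pii) powi n"
    by (rule exp_power_int[symmetric])
  also have "exp (pii) = -1" by simp
  also have "exp (pii / 2) = cis (pi / 2)" by (simp add: cis_conv_exp mult_ac)
  finally show ?thesis by (simp add: mult.commute)
qed

lemma powi_minus_one_square: "((-1) powi n * (-1) powi n :: complex) = 1"
  by (simp flip: power_int_mult_distrib)

lemma powi_i_square: "- \<i> * ((-1) powi n * (\<i> * (-1) powi n) * x) = x"
proof -
  have "- \<i> * ((-1) powi n * (\<i> * (-1) powi n) * x) = (- \<i> * \<i>) * ((-1) powi n * (-1) powi n) * x"
    by (simp only: mult_ac)
  then show ?thesis unfolding powi_minus_one_square by simp
qed

lemma half_half: "real_of_int n + 1/2 + 1/2 = real_of_int (n + 1)"
  by simp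

lemma infsum_int_shift: "(\<Sum>\<^sub>\<infinity>n::int. f (n + k)) = (\<Sum>\<^sub>\<infinity>n::int. f n)"
  by (rule infsum_reindex_bij_betw) (auto intro!: bij_betw_byWitness[where f' = "\<lambda>n. n - k"])

lemma th2_series: "th2 \<tau> = (\<Sum>\<^sub>\<infinity>n::int. qpow \<tau> ((of_int n + 1/2)\<^sup>2 / 2))"
proof -
  have "th2 \<tau> = - \<i> * thc 0 (1/2) \<tau>" by (simp add: th2_def thc_theta)
  also have "\<dots> = (\<Sum>\<^sub>\<infinity>n::int. - \<i> * ((-1) powi n * exp (pii * of_int (2*n+1) * of_real (1/2)) * qpow \<tau> ((of_int n + 1/2 + 0)\<^sup>2 / 2)))"
    unfolding thc_def by (rule infsum_cmult_right'[symmetric])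
  also have "\<dots> = (\<Sum>\<^sub>\<infinity>n::int. qpow \<tau> ((of_int n + 1/2)\<^sup>2 / 2))"
    unfolding exp_odd_quarter powi_i_square half_half by simp
  finally show ?thesis .
qed

lemma th3_series: "th3 \<tau> = (\<Sum>\<^sub>\<infinity>n::int. qpow \<tau> ((of_int n)\<^sup>2 / 2))"
proof -
  have "qpow \<tau> ((1/2)\<^sup>2 / 2) = exp (pii * \<tau> / 4)"
    unfolding qpow_def by (rule arg_cong[where f = exp]) (simp add: power2_eq_square)
  moreover have "of_real (1/2) * \<tau> + of_real (1/2) = (\<tau> + 1) / 2" by (simp add: field_simps)
  ultimately have "th3 \<tau> = - \<i> * thc (1/2) (1/2) \<tau>"
    unfolding th3_def thc_theta by (simp only: mult.assoc)
  also have "\<dots> = (\<Sum>\<^sub>\<infinity>n::int. - \<i> * ((-1) powi n * exp (pii * of_int (2*n+1) * of_real (1/2)) * qpow \<tau> ((of_int n + 1/2 + 1/2)\<^sup>2 / 2)))"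
    unfolding thc_def by (rule infsum_cmult_right'[symmetric])
  also have "\<dots> = (\<Sum>\<^sub>\<infinity>n::int. qpow \<tau> ((of_int (n + 1))\<^sup>2 / 2))"
    unfolding exp_odd_quarter powi_i_square half_half by simp
  also have "\<dots> = (\<Sum>\<^sub>\<infinity>n::int. qpow \<tau> ((of_int n)\<^sup>2 / 2))"
    by (rule infsum_int_shift)
  finally show ?thesis .
qed

lemma th4_series: "th4 \<tau> = (\<Sum>\<^sub>\<infinity>n::int. (-1) powi n * qpow \<tau> ((of_int n)\<^sup>2 / 2))"
proof -
  have "qpow \<tau> ((1/2)\<^sup>2 / 2) = exp (pii * \<tau> / 4)"
    unfolding qpow_def by (rule arg_cong[where f = exp]) (simp add: power2_eq_square)
  moreover have "of_real (1/2) * \<tau> + of_real 0 = \<tau> / 2" by (simp add: field_simps)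
  ultimately have "th4 \<tau> = - 1 * thc (1/2) 0 \<tau>"
    unfolding th4_def thc_theta by (simp only: mult.assoc) simp
  also have "\<dots> = (\<Sum>\<^sub>\<infinity>n::int. - 1 * ((-1) powi n * exp (pii * of_int (2*n+1) * of_real 0) * qpow \<tau> ((of_int n + 1/2 + 1/2)\<^sup>2 / 2)))"
    unfolding thc_def by (rule infsum_cmult_right'[symmetric])
  also have "\<dots> = (\<Sum>\<^sub>\<infinity>n::int. (-1) powi (n + 1) * qpow \<tau> ((of_int (n + 1))\<^sup>2 / 2))"
    unfolding half_half by (simp add: power_int_add)
  also have "\<dots> = (\<Sum>\<^sub>\<infinity>n::int. (-1) powi n * qpow \<tau> ((of_int n)\<^sup>2 / 2))"
    by (rule infsum_int_shift)
  finally show ?thesis .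
qed

lemma theta0_th3: "theta0 \<tau> = th3 (2 * \<tau>)"
  unfolding theta0_def th3_series qpow_double by simp

lemma th_quad_series:
  "th2 \<tau> = quad_series 1 1 (\<lambda>_. 1) (qpow \<tau> (1/8))"
  "th3 \<tau> = quad_series 1 0 (\<lambda>_. 1) (qpow \<tau> (1/8))"
  "th4 \<tau> = quad_series 1 0 (\<lambda>n. (-1) powi n) (qpow \<tau> (1/8))"
proof -
  have qe: "qpow \<tau> (1/8) ^ nat ((2 * int 1 * n + b)\<^sup>2) = qpow \<tau> ((of_int n + of_int b / 2)\<^sup>2 / 2)" for n b
    using qpow_quad_exponent[of 1 \<tau> n b] by simp
  show "th2 \<tau> = quad_series 1 1 (\<lambda>_. 1) (qpow \<tau> (1/8))" "th3 \<tau> = quad_series 1 0 (\<lambda>_. 1) (qpow \<tau> (1/8))"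
    "th4 \<tau> = quad_series 1 0 (\<lambda>n. (-1) powi n) (qpow \<tau> (1/8))"
    unfolding quad_series_def th2_series th3_series th4_series qe by simp_all
qed

text \<open>Even and odd indices of the series at \<tau>/2 give th3(2\<tau>) and th2(2\<tau>). It is
  needed because \<open>theta0\<close> is \<open>th3\<close> at 2\<tau>, which the inversion sends
  to \<open>th3\<close> at \<tau>/2.\<close>

lemma th_halving:
  assumes "0 < Im \<tau>"
  shows "th3 (\<tau> / 2) = th3 (2 * \<tau>) + th2 (2 * \<tau>)" "th4 (\<tau> / 2) = th3 (2 * \<tau>) - th2 (2 * \<tau>)"
proof -
  have U: "(UNIV :: int set) = range (\<lambda>m. 2 * m) \<union> range (\<lambda>m. 2 * m + 1)"
    by (auto simp: image_iff) presburger
  have D: "range (\<lambda>m::int. 2 * m) \<inter> range (\<lambda>m. 2 * m + 1) = {}"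
    by (auto simp: image_iff) presburger
  have split: "infsum f UNIV = (\<Sum>\<^sub>\<infinity>m. f (2 * m)) + (\<Sum>\<^sub>\<infinity>m. f (2 * m + 1))" if "f summable_on UNIV" for f :: "int \<Rightarrow> complex"
  proof -
    have "infsum f (range (\<lambda>m. 2 * m) \<union> range (\<lambda>m. 2 * m + 1)) = infsum f (range (\<lambda>m. 2 * m)) + infsum f (range (\<lambda>m. 2 * m + 1))"
      by (intro infsum_Un_disjoint summable_on_subset_banach[OF that] D) auto
    also have "infsum f (range (\<lambda>m. 2 * m)) = (\<Sum>\<^sub>\<infinity>m. f (2 * m))"
      by (subst infsum_reindex) (auto simp: inj_on_def o_def)
    also have "infsum f (range (\<lambda>m. 2 * m + 1)) = (\<Sum>\<^sub>\<infinity>m. f (2 * m + 1))"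
      by (subst infsum_reindex) (auto simp: inj_on_def o_def)
    finally show ?thesis unfolding U[symmetric] .
  qed
  have Q: "norm (qpow (\<tau> / 2) (1/8)) < 1" using assms by (intro norm_qpow_less_1) auto
  have s: "(\<lambda>n. c n * qpow (\<tau> / 2) ((of_int n)\<^sup>2 / 2)) summable_on UNIV" if "\<And>n. norm (c n) \<le> 1" for c
    using quad_series_summable[of 1 c, OF _ that Q, of 0] qpow_quad_exponent[of 1 "\<tau> / 2" _ 0] by simp
  have h: "qpow (\<tau> / 2) l = qpow (2 * \<tau>) (l / 4)" for l
    unfolding qpow_def by (simp add: mult_ac)
  have e1: "qpow (\<tau> / 2) ((of_int (2 * m))\<^sup>2 / 2) = qpow (2 * \<tau>) ((of_int m)\<^sup>2 / 2)" for m
    unfolding h by (rule arg_cong[where f = "qpow _"]) (simp add: power2_eq_square)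
  have e2: "qpow (\<tau> / 2) ((of_int (2 * m + 1))\<^sup>2 / 2) = qpow (2 * \<tau>) ((of_int m + 1/2)\<^sup>2 / 2)" for m
    unfolding h by (rule arg_cong[where f = "qpow _"]) (simp add: power2_eq_square field_simps)
  have p: "(-1) powi (2 * m) = (1 :: complex)" "(-1) powi (2 * m + 1) = (-1 :: complex)" for m :: int
    by (simp_all add: power_int_minus_left)
  have "(\<lambda>n. qpow (\<tau> / 2) ((of_int n)\<^sup>2 / 2)) summable_on UNIV" using s[of "\<lambda>_. 1"] by simp
  from split[OF this] show "th3 (\<tau> / 2) = th3 (2 * \<tau>) + th2 (2 * \<tau>)"
    unfolding th3_series th2_series e1 e2 .
  have "(\<lambda>n. (-1) powi n * qpow (\<tau> / 2) ((of_int n)\<^sup>2 / 2)) summable_on UNIV"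
    using s[of "\<lambda>n. (-1) powi n"] by (simp add: norm_power_int)
  from split[OF this] show "th4 (\<tau> / 2) = th3 (2 * \<tau>) - th2 (2 * \<tau>)"
    unfolding th4_series th3_series th2_series p e1 e2 by (simp add: infsum_uminus)
qed

lemma qinf_nonzero_norm:
  assumes "norm q < 1" "norm a < 1" shows "qinf a q \<noteq> 0"
proof (rule qinf_nonzero[OF assms(1)])
  fix k
  have "norm a * norm q ^ k \<le> norm a * 1" using assms by (intro mult_left_mono power_le_one) auto
  then have "norm (a * q ^ k) < 1" using assms by (simp add: norm_mult norm_power)
  then show "a * q ^ k \<noteq> 1" by auto
qed

lemma exp_eighth_square: "exp (pii / 4) * exp (pii / 4) = \<i>"
proof -
  have "pii / 4 + pii / 4 = \<i> * of_real (pi / 2)" by simp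
  then have "exp (pii / 4) * exp (pii / 4) = cis (pi / 2)"
    unfolding cis_conv_exp exp_add[symmetric] by (simp only:)
  then show ?thesis by simp
qed

section \<open>Product formulas and Jacobi's derivative formula\<close>

context
  fixes \<tau> :: complex
  assumes tau: "0 < Im \<tau>"
begin

lemma th_products:
  defines "q \<equiv> qpow \<tau> 1" and "p \<equiv> qpow \<tau> (1/2)"
  shows "th2 \<tau> = 2 * qpow \<tau> (1/8) * (qinf q q * (qinf (-q) q)\<^sup>2)"
    and "th3 \<tau> = qinf q q * (qinf (-p) q)\<^sup>2"
    and "th4 \<tau> = qinf q q * (qinf p q)\<^sup>2"
proof -
  define g where "g = qpow \<tau> (1/8)"
  define r where "r = qpow \<tau> (1/4)"
  have gg: "g * g = r" and rr: "r * r = p" and pp: "p * p = q"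
    unfolding g_def r_def p_def q_def qpow_add[symmetric] by simp_all
  have nz: "r \<noteq> 0" "p \<noteq> 0" by (simp_all add: r_def p_def)
  have q1: "norm q < 1" unfolding q_def by (rule norm_q_less_1[OF tau])
  have e: "exp (pii * \<tau> / 4) = g" "exp (pii * (\<tau> / 2)) = r" "exp (2 * of_real pi * \<i> * (\<tau> / 2)) = p"
    unfolding g_def r_def p_def qpow_def by (rule arg_cong[where f = exp]; simp)+
  have half: "exp (pii * (1/2)) = \<i>" "exp (2 * of_real pi * \<i> * (1/2)) = -1"
    using exp_odd_quarter[of 0] by simp_all
  have "theta (1/2) \<tau> = (\<i> - 1 / \<i>) * (g * (qinf q q * qinf (-1 * q) q * qinf (q / -1) q))"
    unfolding theta_product[OF tau] half by (simp only: g_def q_def)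
  then show "th2 \<tau> = 2 * qpow \<tau> (1/8) * (qinf q q * (qinf (-q) q)\<^sup>2)"
    by (simp add: th2_def g_def power2_eq_square algebra_simps)
  have e3: "exp (pii * ((\<tau> + 1) / 2)) = \<i> * r" "exp (2 * of_real pi * \<i> * ((\<tau> + 1) / 2)) = - p"
  proof -
    have "pii * ((\<tau> + 1) / 2) = pii * (1/2) + pii * (\<tau> / 2)"
      "2 * of_real pi * \<i> * ((\<tau> + 1) / 2) = 2 * of_real pi * \<i> * (1/2) + 2 * of_real pi * \<i> * (\<tau> / 2)"
      by (simp_all add: field_simps)
    then show "exp (pii * ((\<tau> + 1) / 2)) = \<i> * r" "exp (2 * of_real pi * \<i> * ((\<tau> + 1) / 2)) = - p"
      by (simp_all only: exp_add e half) simp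
  qed
  have qp: "q / p = p" "q / - p = - p" using pp nz by (auto simp: field_simps)
  have "th3 \<tau> = - \<i> * g * ((\<i> * r - 1 / (\<i> * r)) * (g * (qinf q q * qinf (- p * q) q * qinf (- p) q)))"
    unfolding th3_def theta_product[OF tau] e e3 q_def[symmetric] qp by (simp only: g_def)
  also have "\<dots> = (g * g * (r + 1 / r)) * (qinf q q * qinf (- p * q) q * qinf (- p) q)"
    using nz by (simp add: field_simps)
  \<comment> \<open>The boundary factor becomes 1 + q^(1/2), precisely the first factor missing from
    one of the two infinite products.\<close>
  also have "g * g * (r + 1 / r) = 1 - - p" unfolding gg distrib_left rr using nz by simp
  also have "(1 - - p) * (qinf q q * qinf (- p * q) q * qinf (- p) q) = qinf q q * (qinf (- p) q)\<^sup>2"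
  proof -
    have "(1 - - p) * (qinf q q * qinf (- p * q) q * qinf (- p) q) = qinf q q * ((1 - - p) * qinf (- p * q) q) * qinf (- p) q"
      by (simp only: mult_ac)
    then show ?thesis unfolding qinf_rec[OF q1, of "- p", symmetric] by (simp only: power2_eq_square mult_ac)
  qed
  finally show "th3 \<tau> = qinf q q * (qinf (-p) q)\<^sup>2" .
  have "th4 \<tau> = - g * ((r - 1 / r) * (g * (qinf q q * qinf (p * q) q * qinf p q)))"
    unfolding th4_def theta_product[OF tau] e q_def[symmetric] qp by (simp only: g_def)
  also have "\<dots> = - (g * g * (r - 1 / r)) * (qinf q q * qinf (p * q) q * qinf p q)"
    by (simp only: mult_ac minus_mult_left)
  also have "- (g * g * (r - 1 / r)) = 1 - p" unfolding gg right_diff_distrib rr using nz by simp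
  also have "(1 - p) * (qinf q q * qinf (p * q) q * qinf p q) = qinf q q * (qinf p q)\<^sup>2"
  proof -
    have "(1 - p) * (qinf q q * qinf (p * q) q * qinf p q) = qinf q q * ((1 - p) * qinf (p * q) q) * qinf p q"
      by (simp only: mult_ac)
    then show ?thesis unfolding qinf_rec[OF q1, of p, symmetric] by (simp only: power2_eq_square mult_ac)
  qed
  finally show "th4 \<tau> = qinf q q * (qinf p q)\<^sup>2" .
qed

lemma th_nonzero: "th2 \<tau> \<noteq> 0" "th3 \<tau> \<noteq> 0" "th4 \<tau> \<noteq> 0"
  unfolding th_products using norm_q_less_1[OF tau] norm_qpow_less_1[OF tau, of "1/2"]
  by (simp_all add: qinf_nonzero_norm)

lemma qpow_half_square: "(qpow \<tau> (1/2))\<^sup>2 = qpow \<tau> 1"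
  by (simp add: qpow_power)

text \<open>With p = q^(1/2) the factors of \<open>th3\<close> and \<open>th4\<close> combine as (p;
  q) (-p; q) = (q; q^2).\<close>

lemma eta_quotient_th: "eta \<tau> ^ 4 / eta (2 * \<tau>) ^ 2 = th3 \<tau> * th4 \<tau>"
proof -
  define q where "q = qpow \<tau> 1"
  define p where "p = qpow \<tau> (1/2)"
  have "qinf p q * qinf (- p) q = qinf q (q\<^sup>2)"
    using qinf_mult_minus[OF norm_q_less_1[OF tau], of p] by (simp add: q_def p_def qpow_half_square)
  then have "(qinf q q * qinf q (q\<^sup>2))\<^sup>2 = qinf q q * (qinf (- p) q)\<^sup>2 * (qinf q q * (qinf p q)\<^sup>2)"
    by (simp only: power2_eq_square[of "_ * _"] power2_eq_square[of "qinf _ _"] mult_ac flip: \<open>qinf p q * qinf (- p) q = qinf q (q\<^sup>2)\<close>)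
  then show ?thesis
    unfolding eta_quotient[OF tau] th_products q_def[symmetric] p_def[symmetric] .
qed

text \<open>All infinite products besides (q; q)^3 cancel, by Euler's identity (q; q^2) (-q; q) =
  1.\<close>

lemma jacobi_derivative_formula: "th2 \<tau> * th3 \<tau> * th4 \<tau> = 2 * theta_prime0 \<tau>"
proof -
  define q where "q = qpow \<tau> 1"
  define p where "p = qpow \<tau> (1/2)"
  have q: "norm q < 1" unfolding q_def by (rule norm_q_less_1[OF tau])
  have q2: "norm (q\<^sup>2) < 1" using q by (simp add: norm_power power_less_one_iff)
  have "qinf p q * qinf (- p) q = qinf q (q\<^sup>2)"
    using qinf_mult_minus[OF q, of p] by (simp add: q_def p_def qpow_half_square)
  moreover have "qinf q (q\<^sup>2) * qinf (- q) q = 1"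
    using qinf_square[OF q] qinf_mult_minus[OF q, of q] qinf_q_nonzero[OF q2] by (simp add: mult_ac)
  ultimately have "(qinf (- q) q * (qinf p q * qinf (- p) q))\<^sup>2 = 1" by (simp add: mult_ac)
  then have "2 * qpow \<tau> (1/8) * qinf q q ^ 3 * (qinf (- q) q * (qinf p q * qinf (- p) q))\<^sup>2 = 2 * theta_prime0 \<tau>"
    by (simp add: theta_prime0_def[OF tau] q_def)
  then show ?thesis
    unfolding th_products q_def[symmetric] p_def[symmetric]
    by (simp add: power2_eq_square power3_eq_cube mult_ac)
qed

text \<open>The derivative of \<open>theta\<close> at 0 is computed twice: differentiating the
  inversion formula gives a factor \<tau> C, the product of the three theta constants gives s^3,
  where C = -i s. Hence s^2 = -i \<tau>, which determines s up to sign.\<close>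

lemma theta_inversion_square:
  obtains s where "s\<^sup>2 = - \<i> * \<tau>"
    "\<And>z. theta (z / \<tau>) (- 1 / \<tau>) = - \<i> * s * exp (pii * z\<^sup>2 / \<tau>) * theta z \<tau>"
    "th2 (- 1 / \<tau>) = s * th4 \<tau>" "th3 (- 1 / \<tau>) = s * th3 \<tau>" "th4 (- 1 / \<tau>) = s * th2 \<tau>"
proof -
  define \<sigma> where "\<sigma> = - 1 / \<tau>"
  have t0: "\<tau> \<noteq> 0" using tau by auto
  have sigma: "0 < Im \<sigma>" unfolding \<sigma>_def by (rule Im_neg_inverse[OF tau])
  obtain C where C: "\<And>z. theta (z / \<tau>) \<sigma> = C * exp (pii * z\<^sup>2 / \<tau>) * theta z \<tau>"
    using theta_inversion_ex[OF tau] unfolding \<sigma>_def by blast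
  define s where "s = \<i> * C"
  have Cs: "C = - \<i> * s" by (simp add: s_def)
  have 2: "th2 \<sigma> = s * th4 \<tau>"
  proof -
    have "th2 \<sigma> = - \<i> * theta ((\<tau> / 2) / \<tau>) \<sigma>" using t0 by (simp add: th2_def)
    also have "\<dots> = - \<i> * C * exp (pii * (\<tau> / 2)\<^sup>2 / \<tau>) * theta (\<tau> / 2) \<tau>" unfolding C by simp
    also have "pii * (\<tau> / 2)\<^sup>2 / \<tau> = pii * \<tau> / 4" using t0 by (simp add: power2_eq_square)
    finally show ?thesis by (simp add: th4_def s_def)
  qed
  have 4: "th4 \<sigma> = s * th2 \<tau>"
  proof -
    have "\<sigma> / 2 = (- (1/2)) / \<tau>" by (simp add: \<sigma>_def)
    then have "th4 \<sigma> = - exp (pii * \<sigma> / 4) * (C * exp (pii * (- (1/2))\<^sup>2 / \<tau>) * theta (- (1/2)) \<tau>)"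
      unfolding th4_def by (simp only: C)
    also have "\<dots> = C * (exp (pii * \<sigma> / 4) * exp (pii * (- (1/2))\<^sup>2 / \<tau>)) * theta (1/2) \<tau>"
      unfolding theta_minus[OF tau] by simp
    also have "exp (pii * \<sigma> / 4) * exp (pii * (- (1/2))\<^sup>2 / \<tau>) = 1"
      unfolding exp_add[symmetric] by (simp add: \<sigma>_def power2_eq_square)
    finally show ?thesis by (simp add: th2_def s_def mult_ac)
  qed
  have 3: "th3 \<sigma> = s * th3 \<tau>"
  proof -
    \<comment> \<open>The half-period (\<sigma> + 1)/2 pulls back to (\<tau> - 1)/2, not to (\<tau>
      + 1)/2; a translation by 1 repairs this and contributes a sign.\<close>
    have "(\<sigma> + 1) / 2 = ((\<tau> - 1) / 2) / \<tau>" using t0 by (simp add: \<sigma>_def field_simps)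
    then have "th3 \<sigma> = - \<i> * exp (pii * \<sigma> / 4) * (C * exp (pii * ((\<tau> - 1) / 2)\<^sup>2 / \<tau>) * theta ((\<tau> - 1) / 2) \<tau>)"
      unfolding th3_def by (simp only: C)
    also have "theta ((\<tau> - 1) / 2) \<tau> = - theta ((\<tau> + 1) / 2) \<tau>"
    proof -
      have e: "(\<tau> - 1) / 2 + 1 = (\<tau> + 1) / 2" by (simp add: field_simps)
      show ?thesis using theta_plus_1[OF tau, of "(\<tau> - 1) / 2", unfolded e] by (simp only: minus_minus)
    qed
    also have "- \<i> * exp (pii * \<sigma> / 4) * (C * exp (pii * ((\<tau> - 1) / 2)\<^sup>2 / \<tau>) * - theta ((\<tau> + 1) / 2) \<tau>)
      = \<i> * C * (exp (pii * \<sigma> / 4) * exp (pii * ((\<tau> - 1) / 2)\<^sup>2 / \<tau>)) * theta ((\<tau> + 1) / 2) \<tau>"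
      by (simp add: mult_ac)
    also have "exp (pii * \<sigma> / 4) * exp (pii * ((\<tau> - 1) / 2)\<^sup>2 / \<tau>) = exp (pii * \<tau> / 4) * exp (- (pii * (1/2)))"
      unfolding exp_add[symmetric] using t0
      by (intro arg_cong[where f = exp]) (simp add: \<sigma>_def field_simps power2_eq_square)
    also have "exp (- (pii * (1/2))) = - \<i>"
      using exp_odd_quarter[of 0] by (simp add: exp_minus)
    finally show ?thesis by (simp add: th3_def s_def mult_ac)
  qed
  have D: "theta_prime0 \<sigma> = \<tau> * C * theta_prime0 \<tau>"
  proof -
    have "((\<lambda>z. theta z \<sigma>) has_field_derivative 2 * of_real pi * \<i> * theta_prime0 \<sigma>) (at (0 / \<tau>))"
      using theta_deriv_0[OF sigma] by simp
    moreover have "((\<lambda>z. z / \<tau>) has_field_derivative 1 / \<tau>) (at 0)"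
      using t0 by (auto intro!: derivative_eq_intros)
    ultimately have "((\<lambda>z. theta (z / \<tau>) \<sigma>) has_field_derivative 2 * of_real pi * \<i> * theta_prime0 \<sigma> * (1 / \<tau>)) (at 0)"
      by (rule DERIV_chain2)
    moreover have "((\<lambda>z. C * exp (pii * z\<^sup>2 / \<tau>) * theta z \<tau>) has_field_derivative C * (2 * of_real pi * \<i> * theta_prime0 \<tau>)) (at 0)"
      using theta_0[OF tau] t0 by (auto intro!: derivative_eq_intros theta_deriv_0[OF tau])
    ultimately have "2 * of_real pi * \<i> * theta_prime0 \<sigma> * (1 / \<tau>) = C * (2 * of_real pi * \<i> * theta_prime0 \<tau>)"
      unfolding C by (rule DERIV_unique)
    then have "(2 * of_real pi * \<i>) * theta_prime0 \<sigma> = (2 * of_real pi * \<i>) * (\<tau> * C * theta_prime0 \<tau>)"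
      using t0 by (simp add: field_simps)
    then show ?thesis by (rule mult_left_cancel[THEN iffD1, rotated]) simp
  qed
  have "2 * theta_prime0 \<sigma> = th2 \<sigma> * th3 \<sigma> * th4 \<sigma>"
    using Submission.jacobi_derivative_formula[OF sigma] by simp
  also have "\<dots> = s ^ 3 * (th2 \<tau> * th3 \<tau> * th4 \<tau>)"
    unfolding 2 3 4 by (simp add: power3_eq_cube mult_ac)
  also have "\<dots> = 2 * (s ^ 3 * theta_prime0 \<tau>)"
    unfolding jacobi_derivative_formula by simp
  finally have "theta_prime0 \<sigma> = s ^ 3 * theta_prime0 \<tau>" by (rule mult_left_cancel[THEN iffD1, rotated]) simp
  then have "s ^ 3 * theta_prime0 \<tau> = \<tau> * C * theta_prime0 \<tau>" unfolding D by (rule sym)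
  then have "s ^ 3 = \<tau> * C" by (rule mult_right_cancel[OF theta_prime0_nonzero[OF tau], THEN iffD1])
  then have "s * s\<^sup>2 = s * (- \<i> * \<tau>)"
    by (simp add: Cs power2_eq_square power3_eq_cube mult_ac)
  moreover have "s \<noteq> 0" using 2 Submission.th_nonzero(1)[OF sigma] by auto
  ultimately have "s\<^sup>2 = - \<i> * \<tau>" by (metis mult_left_cancel)
  moreover have "theta (z / \<tau>) \<sigma> = - \<i> * s * exp (pii * z\<^sup>2 / \<tau>) * theta z \<tau>" for z
    unfolding C Cs ..
  ultimately show ?thesis using that[of s] 2 3 4 unfolding \<sigma>_def by blast
qed

end

section \<open>The branch of the square root\<close>

abbreviation "\<H> \<equiv> upper_half_plane"

lemma in_H [simp]: "\<tau> \<in> \<H> \<longleftrightarrow> 0 < Im \<tau>"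
  by (simp add: upper_half_plane_def)

lemma open_H: "open \<H>" and connected_H: "connected \<H>"
  unfolding upper_half_plane_def by (auto simp: open_halfspace_Im_gt)

lemma quad_series_qpow_holomorphic:
  assumes "M > 0" "\<And>n. norm (c n) \<le> 1" "0 < l"
  shows "(\<lambda>\<tau>. quad_series M b c (qpow \<tau> l)) holomorphic_on \<H>"
proof -
  have "(\<lambda>\<tau>. qpow \<tau> l) holomorphic_on \<H>" unfolding qpow_def by (intro holomorphic_intros)
  moreover have "(\<lambda>\<tau>. qpow \<tau> l) ` \<H> \<subseteq> ball 0 1" using norm_qpow_less_1 assms(3) by auto
  ultimately show ?thesis
    using holomorphic_on_compose_gen[OF _ quad_series_holomorphic[of M c b]] assms by (simp add: o_def)
qed

lemma th_holomorphic: "th2 holomorphic_on \<H>" "th3 holomorphic_on \<H>" "th4 holomorphic_on \<H>"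
  unfolding th_quad_series[abs_def] by (auto intro!: quad_series_qpow_holomorphic simp: norm_power_int)

lemma csqrt_H: "0 < Im \<tau> \<Longrightarrow> - \<i> * \<tau> \<notin> \<real>\<^sub>\<le>\<^sub>0"
  by (auto simp: complex_nonpos_Reals_iff)

lemma continuous_csqrt_H: "continuous_on \<H> (\<lambda>\<tau>. csqrt (- \<i> * \<tau>))"
  by (rule continuous_on_compose2[OF continuous_on_csqrt]) (use csqrt_H in \<open>auto intro!: continuous_intros\<close>)

text \<open>The quotient of the two sides is continuous on a connected set and has values 1 and -1
  only, so a single point decides the sign.\<close>

lemma theta_inversion_csqrt:
  assumes "0 < Im \<tau>" shows "th3 (- 1 / \<tau>) = csqrt (- \<i> * \<tau>) * th3 \<tau>"
proof -
  define g where "g = (\<lambda>\<tau>. th3 (- 1 / \<tau>) / (csqrt (- \<i> * \<tau>) * th3 \<tau>))"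
  have nz: "csqrt (- \<i> * \<tau>) \<noteq> 0" "th3 \<tau> \<noteq> 0" if "\<tau> \<in> \<H>" for \<tau>
    using th_nonzero(2)[of \<tau>] that by auto
  have "continuous_on \<H> (\<lambda>\<tau>. th3 (- 1 / \<tau>))"
    by (rule continuous_on_compose2[OF holomorphic_on_imp_continuous_on[OF th_holomorphic(2)]])
       (use Im_neg_inverse in \<open>auto intro!: continuous_intros\<close>)
  then have "continuous_on \<H> g"
    unfolding g_def using nz
    by (intro continuous_intros continuous_csqrt_H holomorphic_on_imp_continuous_on[OF th_holomorphic(2)]) auto
  moreover have vals: "g \<tau> \<in> {1, -1}" if "\<tau> \<in> \<H>" for \<tau>
  proof -
    have H: "0 < Im \<tau>" using that by simp
    obtain s where s: "s\<^sup>2 = - \<i> * \<tau>" "th3 (- 1 / \<tau>) = s * th3 \<tau>"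
      using theta_inversion_square[OF H] by metis
    have "(g \<tau>)\<^sup>2 = 1"
      using s nz[OF that] power2_csqrt[of "- \<i> * \<tau>"] that
      by (auto simp: g_def power_divide power_mult_distrib)
    then show ?thesis by (simp add: power2_eq_1_iff)
  qed
  ultimately have "g constant_on \<H>"
    by (intro continuous_finite_range_constant connected_H finite_subset[of "g ` \<H>" "{1, -1}"]) (assumption, blast, simp)
  then have "g \<tau> = g \<i>" using assms by (auto simp: constant_on_def)
  \<comment> \<open>The point i is fixed by \<tau> \<mapsto> -1/\<tau>, and the square root there is
    that of 1.\<close>
  also have "g \<i> = 1" using nz(2)[of \<i>] by (simp add: g_def)
  finally show ?thesis using nz[of \<tau>] assms by (simp add: g_def)
qed

theorem theta_inversion:
  assumes "0 < Im \<tau>"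
  shows "theta (z / \<tau>) (- 1 / \<tau>) = - \<i> * csqrt (- \<i> * \<tau>) * exp (pii * z\<^sup>2 / \<tau>) * theta z \<tau>"
    "th2 (- 1 / \<tau>) = csqrt (- \<i> * \<tau>) * th4 \<tau>"
    "th3 (- 1 / \<tau>) = csqrt (- \<i> * \<tau>) * th3 \<tau>"
    "th4 (- 1 / \<tau>) = csqrt (- \<i> * \<tau>) * th2 \<tau>"
proof -
  obtain s where s: "\<And>z. theta (z / \<tau>) (- 1 / \<tau>) = - \<i> * s * exp (pii * z\<^sup>2 / \<tau>) * theta z \<tau>"
    "th2 (- 1 / \<tau>) = s * th4 \<tau>" "th3 (- 1 / \<tau>) = s * th3 \<tau>" "th4 (- 1 / \<tau>) = s * th2 \<tau>"
    using theta_inversion_square[OF assms] by metis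
  have "s = csqrt (- \<i> * \<tau>)"
    using theta_inversion_csqrt[OF assms] s(3) th_nonzero(2)[OF assms] by simp
  with s show "theta (z / \<tau>) (- 1 / \<tau>) = - \<i> * csqrt (- \<i> * \<tau>) * exp (pii * z\<^sup>2 / \<tau>) * theta z \<tau>"
    "th2 (- 1 / \<tau>) = csqrt (- \<i> * \<tau>) * th4 \<tau>"
    "th3 (- 1 / \<tau>) = csqrt (- \<i> * \<tau>) * th3 \<tau>"
    "th4 (- 1 / \<tau>) = csqrt (- \<i> * \<tau>) * th2 \<tau>" by metis+
qed

lemma th_translation:
  assumes "0 < Im \<tau>"
  shows "th2 (\<tau> + 1) = exp (pii / 4) * th2 \<tau>" "th3 (\<tau> + 1) = th4 \<tau>" "th4 (\<tau> + 1) = th3 \<tau>"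
proof -
  have e: "exp (pii * (\<tau> + 1) / 4) = exp (pii / 4) * exp (pii * \<tau> / 4)"
    unfolding exp_add[symmetric] by (rule arg_cong[where f = exp]) (simp add: field_simps)
  note ee = exp_eighth_square
  show "th2 (\<tau> + 1) = exp (pii / 4) * th2 \<tau>"
    by (simp add: th2_def theta_tau_plus_1[OF assms])
  have "th4 (\<tau> + 1) = - (exp (pii / 4) * exp (pii / 4)) * exp (pii * \<tau> / 4) * theta ((\<tau> + 1) / 2) \<tau>"
    unfolding th4_def theta_tau_plus_1[OF assms] e by (simp add: mult_ac)
  then show "th4 (\<tau> + 1) = th3 \<tau>" unfolding ee by (simp add: th3_def)
  have "(\<tau> + 1 + 1) / 2 = \<tau> / 2 + 1" by (simp add: field_simps)
  then have "th3 (\<tau> + 1) = - \<i> * (exp (pii / 4) * exp (pii / 4)) * exp (pii * \<tau> / 4) * - theta (\<tau> / 2) \<tau>"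
    unfolding th3_def theta_tau_plus_1[OF assms] e \<open>(\<tau> + 1 + 1) / 2 = \<tau> / 2 + 1\<close> theta_plus_1[OF assms]
    by (simp only: mult_ac)
  then show "th3 (\<tau> + 1) = th4 \<tau>" unfolding ee by (simp add: th4_def)
qed

lemma csqrt_half:
  assumes "0 < Im \<tau>"
  shows "csqrt (- \<i> * (\<tau> / 2)) = csqrt (- \<i> * \<tau>) / of_real (sqrt 2)"
proof (rule csqrt_unique)
  show "(csqrt (- \<i> * \<tau>) / of_real (sqrt 2))\<^sup>2 = - \<i> * (\<tau> / 2)"
    by (simp add: power_divide del: csqrt.simps flip: of_real_power)
  have "Re (csqrt (- \<i> * \<tau>)) > 0"
  proof -
    have "Re (csqrt z) > 0" if "Re z > 0" for z using that by (simp add: add_nonneg_pos)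
    from this[of "- \<i> * \<tau>"] show ?thesis using assms by (simp del: csqrt.simps)
  qed
  then show "0 < Re (csqrt (- \<i> * \<tau>) / of_real (sqrt 2)) \<or> Re (csqrt (- \<i> * \<tau>) / of_real (sqrt 2)) = 0 \<and> 0 \<le> Im (csqrt (- \<i> * \<tau>) / of_real (sqrt 2))"
    by (simp del: csqrt.simps)
qed

text \<open>The functions \<open>theta0\<close> and th2(2\<tau>) span a space stable under the
  generators: inversion acts, up to the square root, by the matrix with rows (1, 1) and (1, -1)
  divided by sqrt 2, and translation acts by the diagonal matrix (1, i).\<close>

lemma theta0_transformations:
  assumes "0 < Im \<tau>"
  shows "theta0 (- 1 / \<tau>) = csqrt (- \<i> * \<tau>) * ((theta0 \<tau> + th2 (2 * \<tau>)) / of_real (sqrt 2))"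
    "th2 (2 * (- 1 / \<tau>)) = csqrt (- \<i> * \<tau>) * ((theta0 \<tau> - th2 (2 * \<tau>)) / of_real (sqrt 2))"
    "theta0 (\<tau> + 1) = theta0 \<tau>" "th2 (2 * (\<tau> + 1)) = \<i> * th2 (2 * \<tau>)"
proof -
  have h: "0 < Im (\<tau> / 2)" "0 < Im (2 * \<tau>)" "0 < Im (2 * \<tau> + 1)" using assms by auto
  have e: "2 * (- 1 / \<tau>) = - 1 / (\<tau> / 2)" by simp
  have d: "2 * (\<tau> + 1) = (2 * \<tau> + 1) + 1" by simp
  show "theta0 (- 1 / \<tau>) = csqrt (- \<i> * \<tau>) * ((theta0 \<tau> + th2 (2 * \<tau>)) / of_real (sqrt 2))"
    unfolding theta0_th3 e theta_inversion[OF h(1)] csqrt_half[OF assms] th_halving[OF assms] by simp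
  show "th2 (2 * (- 1 / \<tau>)) = csqrt (- \<i> * \<tau>) * ((theta0 \<tau> - th2 (2 * \<tau>)) / of_real (sqrt 2))"
    unfolding theta0_th3 e theta_inversion[OF h(1)] csqrt_half[OF assms] th_halving[OF assms] by simp
  show "theta0 (\<tau> + 1) = theta0 \<tau>"
    unfolding theta0_th3 d th_translation[OF h(3)] th_translation[OF h(2)] ..
  show "th2 (2 * (\<tau> + 1)) = \<i> * th2 (2 * \<tau>)"
    unfolding d th_translation[OF h(3)] th_translation[OF h(2)] mult.assoc[symmetric] exp_eighth_square ..
qed

lemma theta0_nonzero: "0 < Im \<tau> \<Longrightarrow> theta0 \<tau> \<noteq> 0"
  using th_nonzero(2)[of "2 * \<tau>"] by (simp add: theta0_th3)

section \<open>The modular group\<close>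

definition mat2 :: "int \<Rightarrow> int \<Rightarrow> int \<Rightarrow> int \<Rightarrow> int^2^2" where
  "mat2 a b c d = vector [vector [a, b], vector [c, d]]"

lemma mat2_nth [simp]: "mat2 a b c d $ 1 $ 1 = a" "mat2 a b c d $ 1 $ 2 = b" "mat2 a b c d $ 2 $ 1 = c" "mat2 a b c d $ 2 $ 2 = d"
  unfolding mat2_def vector_2 by (rule refl)+

lemma mat2_eq_iff:
  fixes A B :: "int^2^2"
  shows "A = B \<longleftrightarrow> A $ 1 $ 1 = B $ 1 $ 1 \<and> A $ 1 $ 2 = B $ 1 $ 2 \<and> A $ 2 $ 1 = B $ 2 $ 1 \<and> A $ 2 $ 2 = B $ 2 $ 2"
  unfolding vec_eq_iff[of A B] vec_eq_iff[of "A $ _"] forall_2 by blast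

lemma mat2_mult_nth:
  fixes A B :: "int^2^2"
  shows "(A ** B) $ i $ j = A $ i $ 1 * B $ 1 $ j + A $ i $ 2 * B $ 2 $ j"
  by (simp add: matrix_matrix_mult_def sum_2)

lemma mat2_one_nth [simp]: "(mat 1 :: int^2^2) $ 1 $ 1 = 1" "(mat 1 :: int^2^2) $ 1 $ 2 = 0" "(mat 1 :: int^2^2) $ 2 $ 1 = 0" "(mat 1 :: int^2^2) $ 2 $ 2 = 1"
  by (simp_all add: mat_def)

abbreviation "SL2 \<equiv> carrier SL2Z"

lemma SL2_iff:
  fixes A :: "int^2^2"
  shows "A \<in> SL2 \<longleftrightarrow> A $ 1 $ 1 * A $ 2 $ 2 - A $ 1 $ 2 * A $ 2 $ 1 = 1"
  by (simp add: SL2Z_def det_2)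

lemma SL2_det_of_int:
  "A \<in> SL2 \<Longrightarrow> of_int (A $ 1 $ 1) * of_int (A $ 2 $ 2) - of_int (A $ 1 $ 2) * of_int (A $ 2 $ 1) = (1 :: 'a::comm_ring_1)"
  unfolding SL2_iff by (drule arg_cong[where f = "of_int :: int \<Rightarrow> 'a"]) simp

lemma SL2_simps [simp]: "A \<otimes>\<^bsub>SL2Z\<^esub> B = A ** B" "\<one>\<^bsub>SL2Z\<^esub> = mat 1"
  by (simp_all add: SL2Z_def)

lemma SL2_mult: "A \<in> SL2 \<Longrightarrow> B \<in> SL2 \<Longrightarrow> A ** B \<in> SL2"
  by (simp add: SL2Z_def det_mul)

definition adj2 :: "int^2^2 \<Rightarrow> int^2^2" where
  "adj2 A = mat2 (A $ 2 $ 2) (- A $ 1 $ 2) (- A $ 2 $ 1) (A $ 1 $ 1)"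

lemma adj2: "A \<in> SL2 \<Longrightarrow> adj2 A \<in> SL2" "A \<in> SL2 \<Longrightarrow> adj2 A ** A = mat 1" "A \<in> SL2 \<Longrightarrow> A ** adj2 A = mat 1"
  by (auto simp: SL2_iff adj2_def mat2_eq_iff mat2_mult_nth algebra_simps)

lemma SL2_one: "mat 1 \<in> SL2"
  by (simp add: SL2_iff)

lemma group_SL2Z: "group SL2Z"
proof (rule groupI)
  fix A assume "A \<in> SL2"
  then show "\<exists>B\<in>SL2. B \<otimes>\<^bsub>SL2Z\<^esub> A = \<one>\<^bsub>SL2Z\<^esub>" using adj2 by auto
qed (auto simp: SL2_mult matrix_mul_assoc SL2_one)

lemma inv_SL2: "A \<in> SL2 \<Longrightarrow> inv\<^bsub>SL2Z\<^esub> A = adj2 A"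
  using group.inv_equality[OF group_SL2Z, of "adj2 A" A] adj2 by simp

definition "S_mat = mat2 0 (-1) 1 0"
definition "T_mat = mat2 1 1 0 1"

lemma ST_in_SL2: "S_mat \<in> SL2" "T_mat \<in> SL2"
  by (simp_all add: SL2_iff S_mat_def T_mat_def)

text \<open>The Euclidean algorithm on the bottom row. Generators are appended on the right, hence
  act on \<tau> first, which is the form in which the function families below are shown to be
  stable.\<close>

lemma SL2_induct:
  assumes A: "A \<in> SL2" and one: "P (mat 1)"
    and S: "\<And>A. A \<in> SL2 \<Longrightarrow> P A \<Longrightarrow> P (A ** S_mat)"
    and T: "\<And>A. A \<in> SL2 \<Longrightarrow> P A \<Longrightarrow> P (A ** T_mat)"
  shows "P A"
proof -
  \<comment> \<open>Matrices whose right multiplication preserves P. They are closed under products;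
    inverses are not immediate, and the inverse of \<open>T_mat\<close> is therefore written as a
    word in the generators.\<close>
  define Q where "Q A \<longleftrightarrow> A \<in> SL2 \<and> (\<forall>B\<in>SL2. P B \<longrightarrow> P (B ** A))" for A
  have QS: "Q S_mat" and QT: "Q T_mat" using S T ST_in_SL2 by (auto simp: Q_def)
  have Qm: "Q (A ** B)" if "Q A" "Q B" for A B
    using that by (auto simp: Q_def SL2_mult matrix_mul_assoc)
  have QT': "Q (mat2 1 (-1) 0 1)"
  proof -
    have "mat2 1 (-1) 0 1 = S_mat ** T_mat ** S_mat ** T_mat ** S_mat ** S_mat ** S_mat"
      by (simp add: mat2_eq_iff mat2_mult_nth S_mat_def T_mat_def)
    then show ?thesis using QS QT by (simp only: Qm)
  qed
  have Qn: "Q (mat2 1 n 0 1)" for n :: int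
  proof (induction n rule: int_induct[where k = 0])
    case base
    have "mat2 1 0 0 1 = mat 1" by (simp add: mat2_eq_iff)
    then show ?case by (simp add: Q_def SL2_one matrix_mul_rid)
  next
    case (step1 i)
    have "mat2 1 (i + 1) 0 1 = mat2 1 i 0 1 ** T_mat" by (simp add: mat2_eq_iff mat2_mult_nth T_mat_def)
    then show ?case using step1 QT Qm by simp
  next
    case (step2 i)
    have "mat2 1 (i - 1) 0 1 = mat2 1 i 0 1 ** mat2 1 (-1) 0 1" by (simp add: mat2_eq_iff mat2_mult_nth)
    then show ?case using step2 QT' Qm by simp
  qed
  have "A \<in> SL2 \<Longrightarrow> Q A" for A
  proof (induction "nat \<bar>A $ 2 $ 1\<bar>" arbitrary: A rule: less_induct)
    case less
    define a b c d where abcd: "a = A $ 1 $ 1" "b = A $ 1 $ 2" "c = A $ 2 $ 1" "d = A $ 2 $ 2"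
    have det: "a * d - b * c = 1" using less.prems by (simp add: SL2_iff abcd)
    show ?case
    proof (cases "c = 0")
      case True
      then have "a * d = 1" using det by simp
      then have "(a = 1 \<and> d = 1) \<or> (a = -1 \<and> d = -1)" by (rule zmult_eq_1_iff[THEN iffD1])
      then show ?thesis
      proof
        assume "a = 1 \<and> d = 1"
        then have "A = mat2 1 b 0 1" using True by (simp add: mat2_eq_iff abcd)
        then show ?thesis using Qn by simp
      next
        assume "a = -1 \<and> d = -1"
        then have "A = S_mat ** S_mat ** mat2 1 (-b) 0 1" using True by (simp add: mat2_eq_iff mat2_mult_nth S_mat_def abcd)
        then show ?thesis using Qn QS Qm by simp
      qed
    next
      case False
      define k where "k = d div c"
      \<comment> \<open>One division step: A times T^(-k) S^(-1), whose lower left entry is, up to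
        sign, the remainder of d by c.\<close>
      define A' where "A' = mat2 (k * a - b) a (- (d mod c)) c"
      have d: "d = k * c + d mod c" by (simp add: k_def)
      have "(k * a - b) * c + a * (d mod c) = a * (k * c + d mod c) - b * c" by (simp add: algebra_simps)
      then have "A' \<in> SL2" using det d by (simp add: SL2_iff A'_def)
      moreover have "nat \<bar>A' $ 2 $ 1\<bar> < nat \<bar>A $ 2 $ 1\<bar>"
        using False abs_mod_less[of c d] by (simp add: A'_def abcd)
      ultimately have "Q A'" using less.hyps by blast
      moreover have "A = A' ** S_mat ** mat2 1 k 0 1"
        using d by (simp add: mat2_eq_iff mat2_mult_nth S_mat_def A'_def abcd[symmetric] algebra_simps)
      ultimately show ?thesis using QS Qn Qm by simp
    qed
  qed
  then have "Q A" using A by blast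
  then have "P (mat 1 ** A)" using one SL2_one unfolding Q_def by blast
  then show ?thesis by (simp add: matrix_mul_lid)
qed

section \<open>The action on the upper half-plane and its cocycles\<close>

lemma cocyc_nonzero:
  assumes "A \<in> SL2" "0 < Im \<tau>" shows "cocyc A \<tau> \<noteq> 0"
proof
  assume 0: "cocyc A \<tau> = 0"
  then have "Im (cocyc A \<tau>) = 0" by simp
  then have "A $ 2 $ 1 = 0" using assms(2) by (simp add: cocyc_def)
  moreover then have "A $ 2 $ 2 = 0" using 0 by (simp add: cocyc_def)
  ultimately show False using assms(1) by (simp add: SL2_iff)
qed

lemma moebius_in_H:
  assumes A: "A \<in> SL2" and t: "0 < Im \<tau>" shows "0 < Im (moebius A \<tau>)"
proof -
  let ?c = "cocyc A \<tau>"
  have det: "real_of_int (A $ 1 $ 1) * real_of_int (A $ 2 $ 2) - real_of_int (A $ 1 $ 2) * real_of_int (A $ 2 $ 1) = 1"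
    by (rule SL2_det_of_int[OF A])
  have "Im ((of_int (A$1$1) * \<tau> + of_int (A$1$2)) * cnj ?c) =
     (real_of_int (A $ 1 $ 1) * real_of_int (A $ 2 $ 2) - real_of_int (A $ 1 $ 2) * real_of_int (A $ 2 $ 1)) * Im \<tau>"
    by (simp add: cocyc_def algebra_simps)
  then show ?thesis
    unfolding moebius_def cocyc_def[symmetric] Im_complex_div_gt_0 det using t by simp
qed

lemma cocyc_mult:
  assumes B: "B \<in> SL2" and t: "0 < Im \<tau>"
  shows "cocyc (A ** B) \<tau> = cocyc A (moebius B \<tau>) * cocyc B \<tau>"
  using cocyc_nonzero[OF B t]
  by (simp add: cocyc_def moebius_def mat2_mult_nth field_simps)

lemma moebius_mult:
  assumes B: "B \<in> SL2" and t: "0 < Im \<tau>"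
  shows "moebius (A ** B) \<tau> = moebius A (moebius B \<tau>)"
proof -
  have c: "cocyc B \<tau> \<noteq> 0" by (rule cocyc_nonzero[OF B t])
  have "moebius A (moebius B \<tau>) = ((of_int (A$1$1) * moebius B \<tau> + of_int (A$1$2)) * cocyc B \<tau>) / (cocyc A (moebius B \<tau>) * cocyc B \<tau>)"
    using c by (simp add: moebius_def[of A] cocyc_def[of A])
  also have "(of_int (A$1$1) * moebius B \<tau> + of_int (A$1$2)) * cocyc B \<tau> = of_int ((A ** B)$1$1) * \<tau> + of_int ((A ** B)$1$2)"
    using c by (simp add: moebius_def cocyc_def mat2_mult_nth field_simps)
  finally show ?thesis unfolding cocyc_mult[OF B t, symmetric] by (simp add: moebius_def cocyc_def)
qed

lemma moebius_one [simp]: "moebius (mat 1) \<tau> = \<tau>" and cocyc_one [simp]: "cocyc (mat 1) \<tau> = 1"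
  by (simp_all add: moebius_def cocyc_def)

lemma moebius_ST: "moebius S_mat \<tau> = - 1 / \<tau>" "cocyc S_mat \<tau> = \<tau>" "moebius T_mat \<tau> = \<tau> + 1" "cocyc T_mat \<tau> = 1"
  by (simp_all add: moebius_def cocyc_def S_mat_def T_mat_def)

text \<open>\<open>index_factor A\<close> is the coefficient of \<open>z\<^sup>2\<close> in the exponent of the Jacobi transformation law.\<close>

definition index_factor :: "int^2^2 \<Rightarrow> complex \<Rightarrow> complex" where
  "index_factor A \<tau> = of_int (A $ 2 $ 1) / cocyc A \<tau>"

text \<open>c / (c \<tau> + d) is the logarithmic derivative of the cocycle, and the derivative of
  \<open>moebius B\<close> is 1 / (c \<tau> + d)^2; so this is the chain rule applied to
  \<open>cocyc_mult\<close>.\<close>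

lemma index_factor_mult:
  assumes A: "A \<in> SL2" and B: "B \<in> SL2" and t: "0 < Im \<tau>"
  shows "index_factor (A ** B) \<tau> = index_factor A (moebius B \<tau>) / (cocyc B \<tau>)\<^sup>2 + index_factor B \<tau>"
proof -
  define u where "u = cocyc A (moebius B \<tau>)"
  define v where "v = cocyc B \<tau>"
  have u: "u \<noteq> 0" unfolding u_def by (rule cocyc_nonzero[OF A moebius_in_H[OF B t]])
  have v: "v \<noteq> 0" unfolding v_def by (rule cocyc_nonzero[OF B t])
  have det: "of_int (B $ 1 $ 1) * of_int (B $ 2 $ 2) - of_int (B $ 1 $ 2) * of_int (B $ 2 $ 1) = (1 :: complex)"
    by (rule SL2_det_of_int[OF B])
  have uv: "u * v = of_int (A $ 2 $ 1) * (of_int (B$1$1) * \<tau> + of_int (B$1$2)) + of_int (A $ 2 $ 2) * v"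
    using v by (simp add: u_def v_def cocyc_def moebius_def field_simps)
  have "of_int ((A ** B) $ 2 $ 1) * v = of_int (A $ 2 $ 1) * (of_int (B $ 1 $ 1) * of_int (B $ 2 $ 2) - of_int (B $ 1 $ 2) * of_int (B $ 2 $ 1)) + of_int (B $ 2 $ 1) * (u * v)"
    unfolding uv by (simp add: mat2_mult_nth v_def cocyc_def algebra_simps)
  then have e: "of_int ((A ** B) $ 2 $ 1) * v = of_int (A $ 2 $ 1) + of_int (B $ 2 $ 1) * (u * v)"
    unfolding det by simp
  have "index_factor (A ** B) \<tau> = (of_int ((A ** B) $ 2 $ 1) * v) / (u * v * v)"
    unfolding index_factor_def cocyc_mult[OF B t] u_def[symmetric] v_def[symmetric] using v by simp
  also have "\<dots> = of_int (A $ 2 $ 1) / u / v\<^sup>2 + of_int (B $ 2 $ 1) / v"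
    unfolding e using u v by (simp add: add_divide_distrib power2_eq_square)
  finally show ?thesis by (simp add: index_factor_def u_def v_def)
qed

lemma index_factor_one [simp]: "index_factor (mat 1) \<tau> = 0"
  by (simp add: index_factor_def)

section \<open>Finite index\<close>

text \<open>The map D separates right cosets, so there are at most as many cosets as values of
  D.\<close>

lemma finite_indexI:
  assumes G: "subgroup \<Gamma> SL2Z" and D: "finite (D ` SL2)"
    and eq: "\<And>A B. A \<in> SL2 \<Longrightarrow> B \<in> SL2 \<Longrightarrow> D A = D B \<Longrightarrow> A ** adj2 B \<in> \<Gamma>"
  shows "finite_index_subgroup \<Gamma>"
proof -
  have "\<Gamma> #>\<^bsub>SL2Z\<^esub> A = \<Gamma> #>\<^bsub>SL2Z\<^esub> B" if AB: "A \<in> SL2" "B \<in> SL2" "D A = D B" for A B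
  proof -
    have "A = A ** adj2 B ** B" using adj2(2)[OF AB(2)] by (simp add: matrix_mul_assoc[symmetric] matrix_mul_rid)
    then have "A \<in> \<Gamma> #>\<^bsub>SL2Z\<^esub> B" using eq[OF AB] by (auto simp: r_coset_def)
    then show ?thesis using group.repr_independence[OF group_SL2Z _ AB(2) G] by metis
  qed
  then have "rcosets\<^bsub>SL2Z\<^esub> \<Gamma> \<subseteq> (\<lambda>d. \<Gamma> #>\<^bsub>SL2Z\<^esub> (SOME A. A \<in> SL2 \<and> D A = d)) ` D ` SL2"
  proof -
    assume *: "\<And>A B. A \<in> SL2 \<Longrightarrow> B \<in> SL2 \<Longrightarrow> D A = D B \<Longrightarrow> \<Gamma> #>\<^bsub>SL2Z\<^esub> A = \<Gamma> #>\<^bsub>SL2Z\<^esub> B"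
    have "\<Gamma> #>\<^bsub>SL2Z\<^esub> A = \<Gamma> #>\<^bsub>SL2Z\<^esub> (SOME B. B \<in> SL2 \<and> D B = D A)" if "A \<in> SL2" for A
    proof -
      define B where "B = (SOME B. B \<in> SL2 \<and> D B = D A)"
      have "B \<in> SL2 \<and> D B = D A"
        unfolding B_def by (rule someI[of _ A]) (use that in simp)
      then show ?thesis unfolding B_def[symmetric] by (intro *[OF that]) auto
    qed
    then show ?thesis by (auto simp: RCOSETS_def)
  qed
  then have "finite (rcosets\<^bsub>SL2Z\<^esub> \<Gamma>)" using D by (meson finite_imageI finite_subset)
  then show ?thesis using G by (simp add: finite_index_subgroup_def)
qed

text \<open>Serves two situations: pairs (z, \<tau>) with an exponential factor m, and \<tau> alone
  with m = 1. The weight is absent because \<open>G\<close> will be a quotient by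
  \<open>theta0\<close>. The value 0 outside X makes translates that agree on X equal as
  functions.\<close>

locale slash_action =
  fixes X :: "'a set" and mv :: "int^2^2 \<Rightarrow> 'a \<Rightarrow> 'a" and m :: "int^2^2 \<Rightarrow> 'a \<Rightarrow> complex" and G :: "'a \<Rightarrow> complex"
  assumes mv_in: "A \<in> SL2 \<Longrightarrow> x \<in> X \<Longrightarrow> mv A x \<in> X"
    and mv_mult: "A \<in> SL2 \<Longrightarrow> B \<in> SL2 \<Longrightarrow> x \<in> X \<Longrightarrow> mv (A ** B) x = mv A (mv B x)"
    and mv_one: "x \<in> X \<Longrightarrow> mv (mat 1) x = x"
    and m_mult: "A \<in> SL2 \<Longrightarrow> B \<in> SL2 \<Longrightarrow> x \<in> X \<Longrightarrow> m (A ** B) x = m A (mv B x) * m B x"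
    and m_one: "x \<in> X \<Longrightarrow> m (mat 1) x = 1"
    and finite_orbit: "finite ((\<lambda>A x. if x \<in> X then m A x * G (mv A x) else 0) ` SL2)"
begin

definition stabilizer :: "(int^2^2) set" where
  "stabilizer = {A \<in> Gamma0_4. \<forall>x\<in>X. m A x * G (mv A x) = G x}"

lemma mv_m_inverse:
  assumes "A \<in> SL2" "x \<in> X"
  shows "mv A (mv (adj2 A) x) = x" "m A (mv (adj2 A) x) * m (adj2 A) x = 1"
  using assms adj2[of A] mv_mult[of A "adj2 A" x] m_mult[of A "adj2 A" x] mv_one m_one by auto

text \<open>Orbit and stabiliser: two matrices with the same translate of \<open>G\<close> differ by
  an element fixing \<open>G\<close>, and there are finitely many translates.\<close>

theorem stabilizer_finite_index: "finite_index_subgroup stabilizer"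
proof (rule finite_indexI)
  have inv: "m (adj2 A) x * G (mv (adj2 A) x) = G x"
    if A: "A \<in> SL2" "x \<in> X" and f: "\<forall>x\<in>X. m A x * G (mv A x) = G x" for A x
  proof -
    have "m A (mv (adj2 A) x) * G (mv A (mv (adj2 A) x)) = G (mv (adj2 A) x)"
      using f mv_in[OF adj2(1)[OF A(1)] A(2)] by blast
    then have e: "G (mv (adj2 A) x) = m A (mv (adj2 A) x) * G x"
      unfolding mv_m_inverse(1)[OF A] by (rule sym)
    have "m (adj2 A) x * G (mv (adj2 A) x) = (m A (mv (adj2 A) x) * m (adj2 A) x) * G x"
      unfolding e by (simp only: mult_ac)
    then show ?thesis unfolding mv_m_inverse(2)[OF A] by simp
  qed
  show "subgroup stabilizer SL2Z"
  proof
    show "stabilizer \<subseteq> SL2" by (auto simp: stabilizer_def Gamma0_4_def)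
    show "\<one>\<^bsub>SL2Z\<^esub> \<in> stabilizer" by (auto simp: stabilizer_def Gamma0_4_def SL2_one mv_one m_one)
    fix A assume A: "A \<in> stabilizer"
    then show "inv\<^bsub>SL2Z\<^esub> A \<in> stabilizer"
      using inv[of A] by (auto simp: stabilizer_def Gamma0_4_def inv_SL2 adj2(1)) (simp add: adj2_def)
    fix B assume B: "B \<in> stabilizer"
    have SL: "A \<in> SL2" "B \<in> SL2" using A B by (auto simp: stabilizer_def Gamma0_4_def)
    have "m (A ** B) x * G (mv (A ** B) x) = G x" if x: "x \<in> X" for x
    proof -
      have "m (A ** B) x * G (mv (A ** B) x) = m B x * (m A (mv B x) * G (mv A (mv B x)))"
        using mv_mult[OF SL x] m_mult[OF SL x] by simp
      also have "m A (mv B x) * G (mv A (mv B x)) = G (mv B x)"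
        using A mv_in[OF SL(2) x] by (auto simp: stabilizer_def)
      finally show ?thesis using B x by (auto simp: stabilizer_def)
    qed
    moreover have "4 dvd (A ** B) $ 2 $ 1"
      using A B by (auto simp: stabilizer_def Gamma0_4_def mat2_mult_nth)
    ultimately show "A \<otimes>\<^bsub>SL2Z\<^esub> B \<in> stabilizer" using SL by (simp add: stabilizer_def Gamma0_4_def SL2_mult)
  qed
  \<comment> \<open>Besides the translate, D records the bottom row modulo 4; equal rows modulo 4
    put A times the inverse of B into \<open>Gamma0_4\<close>.\<close>
  define D where "D A = ((\<lambda>x. if x \<in> X then m A x * G (mv A x) else 0), A $ 2 $ 1 mod 4, A $ 2 $ 2 mod 4)" for A
  show "finite (D ` SL2)"
  proof (rule finite_subset)
    show "D ` SL2 \<subseteq> ((\<lambda>A x. if x \<in> X then m A x * G (mv A x) else 0) ` SL2) \<times> ({0..<4} \<times> {0..<4})"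
      by (auto simp: D_def)
    show "finite (((\<lambda>A x. if x \<in> X then m A x * G (mv A x) else 0) ` SL2) \<times> ({0..<4::int} \<times> {0..<4::int}))"
      using finite_orbit by blast
  qed
  fix A B assume SL: "A \<in> SL2" "B \<in> SL2" and D: "D A = D B"
  have B': "adj2 B \<in> SL2" by (rule adj2(1)[OF SL(2)])
  have "m (A ** adj2 B) x * G (mv (A ** adj2 B) x) = G x" if x: "x \<in> X" for x
  proof -
    let ?y = "mv (adj2 B) x"
    have y: "?y \<in> X" by (rule mv_in[OF B' x])
    have "m A ?y * G (mv A ?y) = m B ?y * G (mv B ?y)"
      using D y unfolding D_def by (auto dest: fun_cong[where x = ?y])
    then have "m (A ** adj2 B) x * G (mv (A ** adj2 B) x) = (m B ?y * m (adj2 B) x) * G (mv B ?y)"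
      unfolding mv_mult[OF SL(1) B' x] m_mult[OF SL(1) B' x] by (simp add: mult_ac)
    then show ?thesis using mv_m_inverse[OF SL(2) x] by simp
  qed
  moreover have "4 dvd (A ** adj2 B) $ 2 $ 1"
  proof -
    have e: "A $ 2 $ 1 mod 4 = B $ 2 $ 1 mod 4" "A $ 2 $ 2 mod 4 = B $ 2 $ 2 mod 4" using D by (auto simp: D_def)
    have "(A $ 2 $ 1 * B $ 2 $ 2 - A $ 2 $ 2 * B $ 2 $ 1) mod 4 = (B $ 2 $ 1 * B $ 2 $ 2 - B $ 2 $ 2 * B $ 2 $ 1) mod 4"
      by (intro mod_diff_cong mod_mult_cong e refl)
    then have "(A $ 2 $ 1 * B $ 2 $ 2 - A $ 2 $ 2 * B $ 2 $ 1) mod 4 = 0" by (simp add: mult.commute)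
    then show ?thesis by (simp add: mat2_mult_nth adj2_def mod_eq_0_iff_dvd)
  qed
  ultimately show "A ** adj2 B \<in> stabilizer"
    by (simp add: stabilizer_def Gamma0_4_def SL2_mult[OF SL(1) B'])
qed

lemma stabilizer_subset: "stabilizer \<subseteq> Gamma0_4"
  by (auto simp: stabilizer_def)

end

section \<open>The full modular transformation of theta\<close>

definition roots8 :: "complex set" where "roots8 = {\<zeta>. \<zeta> ^ 8 = 1}"

lemma roots8: "finite roots8" "1 \<in> roots8" "- 1 \<in> roots8" "\<i> \<in> roots8" "exp (pii / 4) \<in> roots8"
  "x \<in> roots8 \<Longrightarrow> y \<in> roots8 \<Longrightarrow> x * y \<in> roots8" "x \<in> roots8 \<Longrightarrow> y \<in> roots8 \<Longrightarrow> x / y \<in> roots8"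
  "x \<in> roots8 \<Longrightarrow> - x \<in> roots8"
proof -
  show "finite roots8" unfolding roots8_def by (rule finite_roots_unity) simp
  have i8: "\<i> ^ 8 = 1" by (simp add: numeral_eq_Suc)
  then show "\<i> \<in> roots8" by (simp add: roots8_def)
  have "exp (pii / 4) ^ 8 = (exp (pii / 4) * exp (pii / 4)) ^ 4"
    by (simp add: numeral_eq_Suc)
  also have "\<dots> = 1" unfolding exp_eighth_square by simp
  finally show "exp (pii / 4) \<in> roots8" by (simp add: roots8_def)
qed (simp_all add: roots8_def power_mult_distrib power_divide)

text \<open>Eighth roots of unity suffice: the generators produce only powers of exp(pi i / 4)
  besides the automorphy factor.\<close>

definition root_multiples :: "(complex \<Rightarrow> complex) set \<Rightarrow> (complex \<Rightarrow> complex) set" where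
  "root_multiples B = (\<lambda>(\<zeta>, f) \<tau>. \<zeta> * f \<tau>) ` (roots8 \<times> B)"

lemma root_multiples_finite: "finite B \<Longrightarrow> finite (root_multiples B)"
  by (simp add: root_multiples_def roots8)

lemma root_multiples_base: "f \<in> B \<Longrightarrow> f \<in> root_multiples B"
  unfolding root_multiples_def using roots8(2) by (intro image_eqI[of _ _ "(1, f)"]) auto

lemma root_multiples_closed:
  assumes "\<And>f. f \<in> B \<Longrightarrow> \<exists>\<zeta>\<in>roots8. \<exists>f'\<in>B. \<forall>\<tau>\<in>\<H>. f (g \<tau>) = j \<tau> * (\<zeta> * f' \<tau>)" and "f \<in> root_multiples B"
  shows "\<exists>f'\<in>root_multiples B. \<forall>\<tau>\<in>\<H>. f (g \<tau>) = j \<tau> * f' \<tau>"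
proof -
  obtain \<zeta> f0 where f: "\<zeta> \<in> roots8" "f0 \<in> B" "f = (\<lambda>\<tau>. \<zeta> * f0 \<tau>)"
    using assms(2) by (auto simp: root_multiples_def)
  obtain \<xi> f' where f': "\<xi> \<in> roots8" "f' \<in> B" "\<forall>\<tau>\<in>\<H>. f0 (g \<tau>) = j \<tau> * (\<xi> * f' \<tau>)"
    using assms(1)[OF f(2)] by blast
  show ?thesis
  proof (rule bexI[of _ "\<lambda>\<tau>. (\<zeta> * \<xi>) * f' \<tau>"])
    show "(\<lambda>\<tau>. \<zeta> * \<xi> * f' \<tau>) \<in> root_multiples B"
      unfolding root_multiples_def using roots8(6)[OF f(1) f'(1)] f'(2) by (intro image_eqI[of _ _ "(\<zeta> * \<xi>, f')"]) auto
    show "\<forall>\<tau>\<in>\<H>. f (g \<tau>) = j \<tau> * (\<zeta> * \<xi> * f' \<tau>)" using f(3) f'(3) by (simp add: mult_ac)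
  qed
qed

text \<open>The generators permute \<open>th2\<close>, \<open>th3\<close>, \<open>th4\<close> up to
  factors, hence also their three pairwise products; \<open>thP 0\<close> is the eta
  quotient.\<close>

definition thP :: "nat \<Rightarrow> complex \<Rightarrow> complex" where
  "thP k \<tau> = (if k = 0 then th3 \<tau> * th4 \<tau> else if k = 1 then th2 \<tau> * th3 \<tau> else th2 \<tau> * th4 \<tau>)"

text \<open>The orbit of \<open>theta0\<close>, up to eighth roots of unity, in the span of
  \<open>theta0\<close> and th2(2\<tau>): the two basis vectors and the four normalised sums with
  coefficient 1, i, -1, -i. Division by sqrt 2 keeps the scalars between them roots of
  unity.\<close>

definition thL :: "nat \<Rightarrow> complex \<Rightarrow> complex" where
  "thL k \<tau> = (if k = 0 then theta0 \<tau> else if k = 1 then th2 (2 * \<tau>)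
     else if k = 2 then (theta0 \<tau> + th2 (2 * \<tau>)) / of_real (sqrt 2)
     else if k = 3 then (theta0 \<tau> + \<i> * th2 (2 * \<tau>)) / of_real (sqrt 2)
     else if k = 4 then (theta0 \<tau> - th2 (2 * \<tau>)) / of_real (sqrt 2)
     else (theta0 \<tau> - \<i> * th2 (2 * \<tau>)) / of_real (sqrt 2))"

lemma thL_simps:
  "thL 0 \<tau> = theta0 \<tau>" "thL 1 \<tau> = th2 (2 * \<tau>)"
  "thL 2 \<tau> = (theta0 \<tau> + th2 (2 * \<tau>)) / of_real (sqrt 2)"
  "thL 3 \<tau> = (theta0 \<tau> + \<i> * th2 (2 * \<tau>)) / of_real (sqrt 2)"
  "thL 4 \<tau> = (theta0 \<tau> - th2 (2 * \<tau>)) / of_real (sqrt 2)"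
  "thL 5 \<tau> = (theta0 \<tau> - \<i> * th2 (2 * \<tau>)) / of_real (sqrt 2)"
  by (simp_all add: thL_def)

lemma exp_eighth: "exp (pii / 4) = (1 + \<i>) / of_real (sqrt 2)"
proof -
  have "exp (pii / 4) = cis (pi / 4)" by (simp add: cis_conv_exp mult_ac)
  also have "\<dots> = (1 + \<i>) / of_real (sqrt 2)"
    by (simp add: complex_eq_iff cos_45 sin_45 field_simps)
  finally show ?thesis .
qed

lemma sqrt2_square: "complex_of_real (sqrt 2) * complex_of_real (sqrt 2) = 2"
  by (simp flip: of_real_mult)

lemma thP_S:
  assumes "k < 3"
  shows "\<exists>\<zeta>\<in>roots8. \<exists>k'<3. \<forall>\<tau>\<in>\<H>. thP k (- 1 / \<tau>) = (- \<i> * csqrt (- \<i> * \<tau>))\<^sup>2 * (\<zeta> * thP k' \<tau>)"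
\<comment> \<open>Inversion exchanges \<open>th2\<close> and \<open>th4\<close>, so it swaps
  products 0 and 1 and fixes product 2. The root -1 compensates for the square of -i.\<close>
proof (rule bexI[OF _ roots8(3)], rule exI[of _ "[1, 0, 2] ! k"], intro conjI ballI)
  have k: "k = 0 \<or> k = 1 \<or> k = 2" using assms by auto
  then show "[1, 0, 2] ! k < (3::nat)" by auto
  fix \<tau> assume "\<tau> \<in> \<H>"
  then have t: "0 < Im \<tau>" by simp
  have sq: "(- \<i> * s)\<^sup>2 = - (s\<^sup>2)" for s :: complex by (simp add: power_mult_distrib)
  show "thP k (- 1 / \<tau>) = (- \<i> * csqrt (- \<i> * \<tau>))\<^sup>2 * (- 1 * thP ([1, 0, 2] ! k) \<tau>)"
    unfolding sq using k
    by (elim disjE; simp only: thP_def theta_inversion(2-4)[OF t]; simp del: csqrt.simps power2_csqrt add: power2_eq_square)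
qed

lemma thP_T:
  assumes "k < 3"
  shows "\<exists>\<zeta>\<in>roots8. \<exists>k'<3. \<forall>\<tau>\<in>\<H>. thP k (\<tau> + 1) = (exp (pii / 4))\<^sup>2 * (\<zeta> * thP k' \<tau>)"
\<comment> \<open>Translation exchanges \<open>th3\<close> and \<open>th4\<close> and multiplies
  \<open>th2\<close> by exp(pi i / 4); the factor -i undoes the prescribed square of exp(pi i / 4),
  which is i.\<close>
proof (rule bexI[of _ "if k = 0 then - \<i> else - \<i> * exp (pii / 4)"], rule exI[of _ "[0, 2, 1] ! k"], intro conjI ballI)
  have k: "k = 0 \<or> k = 1 \<or> k = 2" using assms by auto
  then show "[0, 2, 1] ! k < (3::nat)" by auto
  have e2: "(exp (pii / 4))\<^sup>2 = \<i>" unfolding power2_eq_square by (rule exp_eighth_square)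
  show "(if k = 0 then - \<i> else - \<i> * exp (pii / 4)) \<in> roots8"
    using roots8(4,5,6,8) by auto
  fix \<tau> assume "\<tau> \<in> \<H>"
  then have t: "0 < Im \<tau>" by simp
  show "thP k (\<tau> + 1) = (exp (pii / 4))\<^sup>2 * ((if k = 0 then - \<i> else - \<i> * exp (pii / 4)) * thP ([0, 2, 1] ! k) \<tau>)"
    unfolding e2 using k by (auto simp: thP_def th_translation[OF t] mult.assoc)
qed

lemma thL_S:
  assumes "k < 6"
  shows "\<exists>\<zeta>\<in>roots8. \<exists>k'<6. \<forall>\<tau>\<in>\<H>. thL k (- 1 / \<tau>) = (- \<i> * csqrt (- \<i> * \<tau>)) * (\<zeta> * thL k' \<tau>)"
proof -
  define e where "e = exp (pii / 4)"
  have k: "k = 0 \<or> k = 1 \<or> k = 2 \<or> k = 3 \<or> k = 4 \<or> k = 5" using assms by auto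
  have e: "e = (1 + \<i>) / of_real (sqrt 2)" "1 / e = (1 - \<i>) / of_real (sqrt 2)"
  proof -
    show e1: "e = (1 + \<i>) / of_real (sqrt 2)" unfolding e_def by (rule exp_eighth)
    have "e * ((1 - \<i>) / of_real (sqrt 2)) = 1" unfolding e1 using sqrt2_square by (simp add: field_simps)
    moreover have "e \<noteq> 0" by (simp add: e_def)
    ultimately show "1 / e = (1 - \<i>) / of_real (sqrt 2)" by (simp add: field_simps)
  qed
  \<comment> \<open>Inversion swaps 0 with 2, 1 with 4 and 3 with 5. Only the last pair brings in
    primitive eighth roots, from 1 + i and 1 - i divided by sqrt 2; the factor i offsets the -i of
    the automorphy factor.\<close>
  have vals: "thL 0 (- 1 / \<tau>) = (- \<i> * csqrt (- \<i> * \<tau>)) * (\<i> * thL 2 \<tau>)"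
    "thL 1 (- 1 / \<tau>) = (- \<i> * csqrt (- \<i> * \<tau>)) * (\<i> * thL 4 \<tau>)"
    "thL 2 (- 1 / \<tau>) = (- \<i> * csqrt (- \<i> * \<tau>)) * (\<i> * thL 0 \<tau>)"
    "thL 3 (- 1 / \<tau>) = (- \<i> * csqrt (- \<i> * \<tau>)) * (\<i> * e * thL 5 \<tau>)"
    "thL 4 (- 1 / \<tau>) = (- \<i> * csqrt (- \<i> * \<tau>)) * (\<i> * thL 1 \<tau>)"
    "thL 5 (- 1 / \<tau>) = (- \<i> * csqrt (- \<i> * \<tau>)) * (\<i> * (1 / e) * thL 3 \<tau>)" if t: "0 < Im \<tau>" for \<tau>
  proof -
    define a b s r where abs: "a = theta0 \<tau>" "b = th2 (2 * \<tau>)" "s = csqrt (- \<i> * \<tau>)" "r = complex_of_real (sqrt 2)"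
    have r: "r * r = 2" "r \<noteq> 0" using sqrt2_square by (auto simp: abs)
    have ta: "theta0 (- 1 / \<tau>) = s * ((a + b) / r)" "th2 (2 * (- 1 / \<tau>)) = s * ((a - b) / r)"
      unfolding abs by (rule theta0_transformations[OF t])+
    have i: "(- \<i> * s) * (\<i> * x) = s * x" for x
    proof -
      have "(- \<i> * s) * (\<i> * x) = (- \<i> * \<i>) * (s * x)" by (simp only: mult_ac)
      then show ?thesis by simp
    qed
    have d: "x / r / r = x / 2" for x using r by (metis divide_divide_eq_left)
    have d2: "s * (x / r) / r = s * (x / 2)" for x by (metis d times_divide_eq_right)
    have m: "x / r * (y / r) = x * y / 2" for x y using r by (simp add: times_divide_times_eq)
    have sum: "(s * ((a + b) / r) + s * ((a - b) / r)) / r = s * a" "(s * ((a + b) / r) - s * ((a - b) / r)) / r = s * b"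
      unfolding add_divide_distrib[of "s * _"] diff_divide_distrib[of "s * _"] d2 by (simp_all add: field_simps)
    have sum': "(s * ((a + b) / r) + \<i> * (s * ((a - b) / r))) / r = s * (((1 + \<i>) / r) * ((a - \<i> * b) / r))"
      "(s * ((a + b) / r) - \<i> * (s * ((a - b) / r))) / r = s * (((1 - \<i>) / r) * ((a + \<i> * b) / r))"
      unfolding m add_divide_distrib[of "s * _"] diff_divide_distrib[of "s * _"] times_divide_eq_right[of \<i>, symmetric] d2
      by (simp_all add: field_simps)
    show "thL 0 (- 1 / \<tau>) = (- \<i> * csqrt (- \<i> * \<tau>)) * (\<i> * thL 2 \<tau>)"
      "thL 1 (- 1 / \<tau>) = (- \<i> * csqrt (- \<i> * \<tau>)) * (\<i> * thL 4 \<tau>)"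
      "thL 2 (- 1 / \<tau>) = (- \<i> * csqrt (- \<i> * \<tau>)) * (\<i> * thL 0 \<tau>)"
      "thL 3 (- 1 / \<tau>) = (- \<i> * csqrt (- \<i> * \<tau>)) * (\<i> * e * thL 5 \<tau>)"
      "thL 4 (- 1 / \<tau>) = (- \<i> * csqrt (- \<i> * \<tau>)) * (\<i> * thL 1 \<tau>)"
      unfolding thL_simps ta e(1) abs(3,4)[symmetric] abs(1,2)[symmetric] mult.assoc[of \<i>] i sum sum' by (rule refl)+
    show "thL 5 (- 1 / \<tau>) = (- \<i> * csqrt (- \<i> * \<tau>)) * (\<i> * (1 / e) * thL 3 \<tau>)"
      unfolding thL_simps ta e(2) abs(3,4)[symmetric] abs(1,2)[symmetric] mult.assoc[of \<i>] i sum sum' by (rule refl)+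
  qed
  have wit: ?thesis if "\<zeta> \<in> roots8" "k' < 6" "\<And>\<tau>. 0 < Im \<tau> \<Longrightarrow> thL k (- 1 / \<tau>) = (- \<i> * csqrt (- \<i> * \<tau>)) * (\<zeta> * thL k' \<tau>)" for \<zeta> k'
    by (rule bexI[OF _ that(1)], rule exI[of _ k'], intro conjI ballI that(2,3)) simp
  have z: "\<i> \<in> roots8" "\<i> * e \<in> roots8" "\<i> * (1 / e) \<in> roots8"
    using roots8 unfolding e_def by blast+
  from k show ?thesis
  proof (elim disjE)
    assume "k = 0" then show ?thesis using wit[OF z(1), of 2] vals(1) by simp
  next
    assume "k = 1" then show ?thesis using wit[OF z(1), of 4] vals(2) by simp
  next
    assume "k = 2" then show ?thesis using wit[OF z(1), of 0] vals(3) by simp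
  next
    assume "k = 3" then show ?thesis using wit[OF z(2), of 5] vals(4) by simp
  next
    assume "k = 4" then show ?thesis using wit[OF z(1), of 1] vals(5) by simp
  next
    assume "k = 5" then show ?thesis using wit[OF z(3), of 3] vals(6) by simp
  qed
qed

lemma thL_T:
  assumes "k < 6"
  shows "\<exists>\<zeta>\<in>roots8. \<exists>k'<6. \<forall>\<tau>\<in>\<H>. thL k (\<tau> + 1) = exp (pii / 4) * (\<zeta> * thL k' \<tau>)"
proof -
  define e where "e = exp (pii / 4)"
  define \<zeta> where "\<zeta> = (if k = 1 then \<i> / e else 1 / e)"
  \<comment> \<open>Translation fixes \<open>theta0\<close> and multiplies th2(2\<tau>) by i, so the
    four sums are permuted cyclically.\<close>
  define k' where "k' = [0, 1, 3, 4, 5, 2 :: nat] ! k"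
  have k: "k = 0 \<or> k = 1 \<or> k = 2 \<or> k = 3 \<or> k = 4 \<or> k = 5" using assms by auto
  have z: "\<zeta> \<in> roots8" using roots8 by (auto simp: \<zeta>_def e_def)
  have k': "k' < 6" using k by (auto simp: k'_def)
  have "e \<noteq> 0" by (simp add: e_def)
  have "thL k (\<tau> + 1) = e * (\<zeta> * thL k' \<tau>)" if "\<tau> \<in> \<H>" for \<tau>
  proof -
    have t: "0 < Im \<tau>" using that by simp
    have "th2 (2 * \<tau> + 2) = \<i> * th2 (2 * \<tau>)" using theta0_transformations(4)[OF t] by simp
    then show ?thesis
      using k \<open>e \<noteq> 0\<close> by (elim disjE) (simp_all add: thL_def \<zeta>_def k'_def theta0_transformations(3)[OF t])
  qed
  then show ?thesis using z k' unfolding e_def by blast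
qed

abbreviation "P_family \<equiv> root_multiples (thP ` {..<3})"
abbreviation "L_family \<equiv> root_multiples (thL ` {..<6})"

text \<open>One \<open>J\<close> governs all three laws, so it cancels in th3 th4 / (theta0 theta).
  Continuity and the equation for its eighth power fix it up to an eighth root of unity without
  choosing a branch of the square root of the cocycle.\<close>

definition theta_multiplier :: "int^2^2 \<Rightarrow> (complex \<Rightarrow> complex) \<Rightarrow> (complex \<Rightarrow> complex) \<Rightarrow> (complex \<Rightarrow> complex) \<Rightarrow> bool" where
  "theta_multiplier A J P L \<longleftrightarrow> continuous_on \<H> J \<and> P \<in> P_family \<and> L \<in> L_family \<and>
     (\<forall>\<tau>\<in>\<H>. J \<tau> ^ 8 = cocyc A \<tau> ^ 4 \<and> th3 (moebius A \<tau>) * th4 (moebius A \<tau>) = (J \<tau>)\<^sup>2 * P \<tau> \<and> theta0 (moebius A \<tau>) = J \<tau> * L \<tau> \<and>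
       (\<forall>z. theta (z / cocyc A \<tau>) (moebius A \<tau>) = J \<tau> * exp (pii * index_factor A \<tau> * z\<^sup>2) * theta z \<tau>))"

text \<open>Multipliers compose as J(B \<tau>) K(\<tau>), the exponential factors add up by
  \<open>index_factor_mult\<close>, and the families are stable under the generator B.\<close>

lemma theta_multiplier_step:
  assumes A: "A \<in> SL2" and B: "B \<in> SL2" and JA: "theta_multiplier A J P L"
    and K: "continuous_on \<H> K" "\<And>\<tau>. \<tau> \<in> \<H> \<Longrightarrow> K \<tau> ^ 8 = cocyc B \<tau> ^ 4"
      "\<And>z \<tau>. \<tau> \<in> \<H> \<Longrightarrow> theta (z / cocyc B \<tau>) (moebius B \<tau>) = K \<tau> * exp (pii * index_factor B \<tau> * z\<^sup>2) * theta z \<tau>"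
    and P: "\<And>k. k < 3 \<Longrightarrow> \<exists>\<zeta>\<in>roots8. \<exists>k'<3. \<forall>\<tau>\<in>\<H>. thP k (moebius B \<tau>) = (K \<tau>)\<^sup>2 * (\<zeta> * thP k' \<tau>)"
    and L: "\<And>k. k < 6 \<Longrightarrow> \<exists>\<zeta>\<in>roots8. \<exists>k'<6. \<forall>\<tau>\<in>\<H>. thL k (moebius B \<tau>) = K \<tau> * (\<zeta> * thL k' \<tau>)"
  shows "\<exists>J P L. theta_multiplier (A ** B) J P L"
proof -
  have Pm: "P \<in> P_family" and Lm: "L \<in> L_family" and J: "continuous_on \<H> J"
    using JA by (auto simp: theta_multiplier_def)
  have "\<exists>f'\<in>P_family. \<forall>\<tau>\<in>\<H>. P (moebius B \<tau>) = (K \<tau>)\<^sup>2 * f' \<tau>"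
    by (rule root_multiples_closed[OF _ Pm]) (use P in fastforce)
  then obtain P' where P': "P' \<in> P_family" "\<And>\<tau>. \<tau> \<in> \<H> \<Longrightarrow> P (moebius B \<tau>) = (K \<tau>)\<^sup>2 * P' \<tau>" by blast
  have "\<exists>f'\<in>L_family. \<forall>\<tau>\<in>\<H>. L (moebius B \<tau>) = K \<tau> * f' \<tau>"
    by (rule root_multiples_closed[OF _ Lm]) (use L in fastforce)
  then obtain L' where L': "L' \<in> L_family" "\<And>\<tau>. \<tau> \<in> \<H> \<Longrightarrow> L (moebius B \<tau>) = K \<tau> * L' \<tau>" by blast
  have BH: "moebius B \<tau> \<in> \<H>" if "\<tau> \<in> \<H>" for \<tau> using moebius_in_H[OF B] that by simp
  have "theta_multiplier (A ** B) (\<lambda>\<tau>. J (moebius B \<tau>) * K \<tau>) P' L'"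
    unfolding theta_multiplier_def
  proof (intro conjI ballI allI)
    have "continuous_on \<H> (moebius B)" unfolding moebius_def
      using cocyc_nonzero[OF B] by (intro continuous_intros) (auto simp: cocyc_def)
    then show "continuous_on \<H> (\<lambda>\<tau>. J (moebius B \<tau>) * K \<tau>)"
      using BH by (intro continuous_on_mult continuous_on_compose2[OF J] K(1)) auto
    fix \<tau> assume H: "\<tau> \<in> \<H>"
    then have t: "0 < Im \<tau>" by simp
    have JZ: "theta (y / cocyc A (moebius B \<tau>)) (moebius A (moebius B \<tau>)) = J (moebius B \<tau>) * exp (pii * index_factor A (moebius B \<tau>) * y\<^sup>2) * theta y (moebius B \<tau>)" for y
      using JA BH[OF H] unfolding theta_multiplier_def by blast
    note JAB = JA[unfolded theta_multiplier_def, THEN conjunct2, THEN conjunct2, THEN conjunct2, rule_format, OF BH[OF H]]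
    show "(J (moebius B \<tau>) * K \<tau>) ^ 8 = cocyc (A ** B) \<tau> ^ 4"
      using JAB K(2)[OF H] by (simp add: power_mult_distrib cocyc_mult[OF B t])
    show "th3 (moebius (A ** B) \<tau>) * th4 (moebius (A ** B) \<tau>) = (J (moebius B \<tau>) * K \<tau>)\<^sup>2 * P' \<tau>"
      using JAB P'(2)[OF H] by (simp add: power_mult_distrib moebius_mult[OF B t])
    show "theta0 (moebius (A ** B) \<tau>) = J (moebius B \<tau>) * K \<tau> * L' \<tau>"
      using JAB L'(2)[OF H] by (simp add: moebius_mult[OF B t])
    fix z
    have "theta (z / cocyc (A ** B) \<tau>) (moebius (A ** B) \<tau>) = theta ((z / cocyc B \<tau>) / cocyc A (moebius B \<tau>)) (moebius A (moebius B \<tau>))"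
      by (simp add: moebius_mult[OF B t] cocyc_mult[OF B t] mult.commute)
    also have "\<dots> = J (moebius B \<tau>) * exp (pii * index_factor A (moebius B \<tau>) * (z / cocyc B \<tau>)\<^sup>2) * (K \<tau> * exp (pii * index_factor B \<tau> * z\<^sup>2) * theta z \<tau>)"
      unfolding JZ K(3)[OF H] ..
    also have "\<dots> = J (moebius B \<tau>) * K \<tau> * exp (pii * index_factor A (moebius B \<tau>) * (z / cocyc B \<tau>)\<^sup>2 + pii * index_factor B \<tau> * z\<^sup>2) * theta z \<tau>"
      by (simp add: exp_add mult_ac)
    also have "pii * index_factor A (moebius B \<tau>) * (z / cocyc B \<tau>)\<^sup>2 + pii * index_factor B \<tau> * z\<^sup>2 = pii * index_factor (A ** B) \<tau> * z\<^sup>2"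
      unfolding index_factor_mult[OF A B t] by (simp add: power_divide algebra_simps)
    finally show "theta (z / cocyc (A ** B) \<tau>) (moebius (A ** B) \<tau>) = J (moebius B \<tau>) * K \<tau> * exp (pii * index_factor (A ** B) \<tau> * z\<^sup>2) * theta z \<tau>" .
  qed (rule P' L')+
  then show ?thesis by blast
qed

theorem theta_multiplier_exists:
  assumes "A \<in> SL2"
  shows "\<exists>J P L. theta_multiplier A J P L"
proof (rule SL2_induct[OF assms])
  have "thP 0 \<in> P_family" "thL 0 \<in> L_family"
    by (auto intro!: root_multiples_base)
  then have "theta_multiplier (mat 1) (\<lambda>_. 1) (thP 0) (thL 0)"
    by (auto simp: theta_multiplier_def thP_def thL_def)
  then show "\<exists>J P L. theta_multiplier (mat 1) J P L" by blast
next
  fix A assume A: "A \<in> SL2" and "\<exists>J P L. theta_multiplier A J P L"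
  then obtain J P L where J: "theta_multiplier A J P L" by blast
  show "\<exists>J P L. theta_multiplier (A ** S_mat) J P L"
  proof (rule theta_multiplier_step[OF A ST_in_SL2(1) J, of "\<lambda>\<tau>. - \<i> * csqrt (- \<i> * \<tau>)"])
    show "continuous_on \<H> (\<lambda>\<tau>. - \<i> * csqrt (- \<i> * \<tau>))"
      by (intro continuous_intros continuous_csqrt_H)
    fix \<tau> assume H: "\<tau> \<in> \<H>"
    have i: "(- \<i>) ^ 8 = 1" "(- \<i>) ^ 4 = 1" by (simp_all add: numeral_eq_Suc)
    have "(- \<i> * csqrt (- \<i> * \<tau>)) ^ 8 = (- \<i>) ^ 8 * ((csqrt (- \<i> * \<tau>))\<^sup>2) ^ 4"
      by (simp only: power_mult_distrib power_mult[symmetric]) simp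
    also have "\<dots> = cocyc S_mat \<tau> ^ 4" unfolding power2_csqrt power_mult_distrib i moebius_ST by simp
    finally show "(- \<i> * csqrt (- \<i> * \<tau>)) ^ 8 = cocyc S_mat \<tau> ^ 4" .
  next
    fix z \<tau> assume H: "\<tau> \<in> \<H>"
    show "theta (z / cocyc S_mat \<tau>) (moebius S_mat \<tau>) = - \<i> * csqrt (- \<i> * \<tau>) * exp (pii * index_factor S_mat \<tau> * z\<^sup>2) * theta z \<tau>"
      unfolding moebius_ST index_factor_def using theta_inversion(1)[of \<tau> z] H by (simp add: S_mat_def)
  next
    fix k :: nat
    show "k < 3 \<Longrightarrow> \<exists>\<zeta>\<in>roots8. \<exists>k'<3. \<forall>\<tau>\<in>\<H>. thP k (moebius S_mat \<tau>) = (- \<i> * csqrt (- \<i> * \<tau>))\<^sup>2 * (\<zeta> * thP k' \<tau>)"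
      "k < 6 \<Longrightarrow> \<exists>\<zeta>\<in>roots8. \<exists>k'<6. \<forall>\<tau>\<in>\<H>. thL k (moebius S_mat \<tau>) = (- \<i> * csqrt (- \<i> * \<tau>)) * (\<zeta> * thL k' \<tau>)"
      unfolding moebius_ST by (rule thP_S thL_S, assumption)+
  qed
  show "\<exists>J P L. theta_multiplier (A ** T_mat) J P L"
  proof (rule theta_multiplier_step[OF A ST_in_SL2(2) J, of "\<lambda>\<tau>. exp (pii / 4)"])
    show "exp (pii / 4) ^ 8 = cocyc T_mat \<tau> ^ 4" for \<tau>
      using roots8(5) by (simp add: moebius_ST roots8_def)
    show "\<tau> \<in> \<H> \<Longrightarrow> theta (z / cocyc T_mat \<tau>) (moebius T_mat \<tau>) = exp (pii / 4) * exp (pii * index_factor T_mat \<tau> * z\<^sup>2) * theta z \<tau>" for z \<tau>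
      unfolding moebius_ST index_factor_def by (simp add: T_mat_def theta_tau_plus_1)
  next
    fix k :: nat
    show "k < 3 \<Longrightarrow> \<exists>\<zeta>\<in>roots8. \<exists>k'<3. \<forall>\<tau>\<in>\<H>. thP k (moebius T_mat \<tau>) = (exp (pii / 4))\<^sup>2 * (\<zeta> * thP k' \<tau>)"
      "k < 6 \<Longrightarrow> \<exists>\<zeta>\<in>roots8. \<exists>k'<6. \<forall>\<tau>\<in>\<H>. thL k (moebius T_mat \<tau>) = exp (pii / 4) * (\<zeta> * thL k' \<tau>)"
      unfolding moebius_ST by (rule thP_T thL_T, assumption)+
  qed simp
qed

section \<open>Holomorphic functions of two variables\<close>

text \<open>One summable majorant for the terms and both partial derivatives gives uniform
  convergence of the derivatives as linear maps; complex linearity in each variable passes to the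
  limit coefficientwise.\<close>

lemma holomorphic2_series:
  fixes f a b :: "nat \<Rightarrow> complex \<times> complex \<Rightarrow> complex"
  assumes S: "convex S" "open S"
    and der: "\<And>n x. x \<in> S \<Longrightarrow> (f n has_derivative (\<lambda>(u, v). a n x * u + b n x * v)) (at x)"
    and M: "summable M" "\<And>n x. x \<in> S \<Longrightarrow> norm (f n x) \<le> M n" "\<And>n x. x \<in> S \<Longrightarrow> norm (a n x) \<le> M n" "\<And>n x. x \<in> S \<Longrightarrow> norm (b n x) \<le> M n"
  shows "holomorphic2 (\<lambda>x. \<Sum>n. f n x) S"
  unfolding holomorphic2_def
proof
  fix x0 assume x0: "x0 \<in> S"
  define A where "A x = (\<Sum>n. a n x)" for x
  define B where "B x = (\<Sum>n. b n x)" for x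
  have uA: "uniform_limit S (\<lambda>n x. \<Sum>i<n. a i x) A sequentially" and uB: "uniform_limit S (\<lambda>n x. \<Sum>i<n. b i x) B sequentially"
    unfolding A_def[abs_def] B_def[abs_def] using M by (auto intro!: Weierstrass_m_test)
  have "\<exists>g. \<forall>x\<in>S. (\<lambda>n. f n x) sums (g x) \<and> (g has_derivative (\<lambda>(u, v). A x * u + B x * v)) (at x within S)"
  proof (rule has_derivative_series[OF S(1) _ _ x0])
    show "(f n has_derivative (\<lambda>(u, v). a n x * u + b n x * v)) (at x within S)" if "x \<in> S" for n x
      using der[OF that] by (rule has_derivative_at_withinI)
    show "(\<lambda>n. f n x0) sums (\<Sum>n. f n x0)"
      by (rule summable_sums, rule summable_comparison_test'[OF M(1)], rule M(2)[OF x0])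
    fix e :: real assume e: "e > 0"
    have "\<forall>\<^sub>F n in sequentially. \<forall>x\<in>S. dist (\<Sum>i<n. a i x) (A x) < e / 2" "\<forall>\<^sub>F n in sequentially. \<forall>x\<in>S. dist (\<Sum>i<n. b i x) (B x) < e / 2"
      using uniform_limitD[OF uA, of "e / 2"] uniform_limitD[OF uB, of "e / 2"] e by simp_all
    then show "\<forall>\<^sub>F n in sequentially. \<forall>x\<in>S. \<forall>h. norm ((\<Sum>i<n. (\<lambda>(u, v). a i x * u + b i x * v) h) - (\<lambda>(u, v). A x * u + B x * v) h) \<le> e * norm h"
    proof eventually_elim
      case (elim n)
      show ?case
      proof (intro ballI allI)
        fix x h :: "complex \<times> complex" assume x: "x \<in> S"
        obtain u v where h: "h = (u, v)" by (cases h)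
        have uv: "norm u \<le> norm h" "norm v \<le> norm h" unfolding h by (rule norm_fst_le norm_snd_le)+
        have "(\<Sum>i<n. (\<lambda>(u, v). a i x * u + b i x * v) h) - (\<lambda>(u, v). A x * u + B x * v) h = ((\<Sum>i<n. a i x) - A x) * u + ((\<Sum>i<n. b i x) - B x) * v"
          by (simp add: h sum.distrib sum_distrib_right[symmetric] left_diff_distrib)
        also have "norm \<dots> \<le> norm ((\<Sum>i<n. a i x) - A x) * norm u + norm ((\<Sum>i<n. b i x) - B x) * norm v"
          by (metis norm_mult norm_triangle_ineq)
        also have "\<dots> \<le> e / 2 * norm h + e / 2 * norm h"
          using elim x uv e by (intro add_mono mult_mono) (auto simp: dist_norm intro: less_imp_le)
        finally show "norm ((\<Sum>i<n. (\<lambda>(u, v). a i x * u + b i x * v) h) - (\<lambda>(u, v). A x * u + B x * v) h) \<le> e * norm h"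
          by simp
      qed
    qed
  qed
  then obtain g where g: "\<And>x. x \<in> S \<Longrightarrow> (\<lambda>n. f n x) sums (g x)" "\<And>x. x \<in> S \<Longrightarrow> (g has_derivative (\<lambda>(u, v). A x * u + B x * v)) (at x within S)"
    by blast
  have "(g has_derivative (\<lambda>(u, v). A x0 * u + B x0 * v)) (at x0)"
    using g(2)[OF x0] at_within_open[OF x0 S(2)] by simp
  then have "((\<lambda>x. \<Sum>n. f n x) has_derivative (\<lambda>(u, v). A x0 * u + B x0 * v)) (at x0)"
    by (rule has_derivative_transform_within_open[OF _ S(2) x0]) (use g(1) in \<open>simp add: sums_iff\<close>)
  then show "\<exists>a b. ((\<lambda>x. \<Sum>n. f n x) has_derivative (\<lambda>(u, v). a * u + b * v)) (at x0)" by blast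
qed

lemma holomorphic2_snd:
  assumes "p holomorphic_on S" "open S"
  shows "holomorphic2 (\<lambda>x. p (snd x)) (UNIV \<times> S)"
  unfolding holomorphic2_def
proof
  fix x :: "complex \<times> complex" assume "x \<in> UNIV \<times> S"
  then have "p field_differentiable (at (snd x))"
    using assms by (auto intro: holomorphic_on_imp_differentiable_at)
  then obtain d where "(p has_field_derivative d) (at (snd x))" by (auto simp: field_differentiable_def)
  then have p: "(p has_derivative (\<lambda>v. d * v)) (at (snd x))" by (simp add: has_field_derivative_def)
  have "(snd has_derivative snd) (at x)" by (rule has_derivative_snd[OF has_derivative_ident])
  from has_derivative_compose[OF this p]
  have "((\<lambda>x. p (snd x)) has_derivative (\<lambda>(u, v). 0 * u + d * v)) (at x)" by (simp add: case_prod_unfold)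
  then show "\<exists>a b. ((\<lambda>x. p (snd x)) has_derivative (\<lambda>(u, v). a * u + b * v)) (at x)" by blast
qed

lemma holomorphic2_compose_snd:
  assumes f: "holomorphic2 f (UNIV \<times> T)" and p: "p holomorphic_on S" "open S" "p ` S \<subseteq> T"
  shows "holomorphic2 (\<lambda>x. f (fst x, p (snd x))) (UNIV \<times> S)"
  unfolding holomorphic2_def
proof
  fix x :: "complex \<times> complex" assume x: "x \<in> UNIV \<times> S"
  then have "p field_differentiable (at (snd x))"
    using p by (auto intro: holomorphic_on_imp_differentiable_at)
  then obtain d where "(p has_field_derivative d) (at (snd x))" by (auto simp: field_differentiable_def)
  then have pd: "(p has_derivative (\<lambda>v. d * v)) (at (snd x))" by (simp add: has_field_derivative_def)
  have "(snd has_derivative snd) (at x)" by (rule has_derivative_snd[OF has_derivative_ident])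
  from has_derivative_compose[OF this pd] have "((\<lambda>x. p (snd x)) has_derivative (\<lambda>h. d * snd h)) (at x)" .
  then have i: "((\<lambda>x. (fst x, p (snd x))) has_derivative (\<lambda>h. (fst h, d * snd h))) (at x)"
    by (intro has_derivative_Pair has_derivative_fst[OF has_derivative_ident])
  have "(fst x, p (snd x)) \<in> UNIV \<times> T" using x p(3) by auto
  then obtain a b where "(f has_derivative (\<lambda>(u, v). a * u + b * v)) (at (fst x, p (snd x)))"
    using f unfolding holomorphic2_def by blast
  from has_derivative_compose[OF i this]
  have "((\<lambda>x. f (fst x, p (snd x))) has_derivative (\<lambda>(u, v). a * u + (b * d) * v)) (at x)"
    by (simp add: case_prod_unfold mult_ac)
  then show "\<exists>a b. ((\<lambda>x. f (fst x, p (snd x))) has_derivative (\<lambda>(u, v). a * u + b * v)) (at x)" by blast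
qed

text \<open>Term of \<open>theta\<close> in the variable Q = q^(1/8), since n(n+1)/2 + 1/8 =
  (2n+1)^2 / 8. In this variable the series makes sense at Q = 0, that is at the cusp.\<close>

definition thetaQ_term :: "nat \<Rightarrow> complex \<times> complex \<Rightarrow> complex" where
  "thetaQ_term n x = (-1) ^ n * (exp (pii * fst x) ^ (2*n+1) - exp (- (pii * fst x)) ^ (2*n+1)) * snd x ^ ((2*n+1)\<^sup>2)"

definition thetaQ :: "complex \<times> complex \<Rightarrow> complex" where
  "thetaQ x = (\<Sum>n. thetaQ_term n x)"

lemma theta_thetaQ:
  assumes "0 < Im \<tau>"
  shows "theta z \<tau> = thetaQ (z, qpow \<tau> (1/8))"
proof -
  have "qpow \<tau> (1/8) * ((-1) ^ n * (exp (pii * z) ^ (2*n+1) - 1 / exp (pii * z) ^ (2*n+1)) * qpow \<tau> 1 ^ (n * (n + 1) div 2)) = thetaQ_term n (z, qpow \<tau> (1/8))" for n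
  proof -
    have "(2*n+1)\<^sup>2 = 1 + 8 * (n * (n + 1) div 2)"
    proof -
      have "2 * (n * (n + 1) div 2) = n * (n + 1)" by simp
      moreover have "(2*n+1)\<^sup>2 = 1 + 4 * (n * (n + 1))" by (simp add: power2_eq_square)
      ultimately show ?thesis by linarith
    qed
    then have "qpow \<tau> (1/8) ^ ((2*n+1)\<^sup>2) = qpow \<tau> (1/8) * (qpow \<tau> (1/8) ^ 8) ^ (n * (n + 1) div 2)"
      by (simp only: power_add power_mult power_one_right)
    also have "qpow \<tau> (1/8) ^ 8 = qpow \<tau> 1" by (simp add: qpow_power)
    finally have e: "qpow \<tau> (1/8) ^ ((2*n+1)\<^sup>2) = qpow \<tau> (1/8) * qpow \<tau> 1 ^ (n * (n + 1) div 2)" .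
    have i: "exp (- (pii * z)) = 1 / exp (pii * z)" by (simp add: exp_minus field_simps)
    show ?thesis unfolding thetaQ_term_def fst_conv snd_conv e i power_one_over by (simp only: mult_ac)
  qed
  then show ?thesis using theta_sums[OF assms, of z] by (simp add: thetaQ_def sums_iff)
qed

lemma holomorphic2_thetaQ: "holomorphic2 thetaQ (UNIV \<times> ball 0 1)"
  unfolding holomorphic2_def
proof
  fix x0 :: "complex \<times> complex" assume "x0 \<in> UNIV \<times> ball 0 1"
  then have x0: "norm (snd x0) < 1" by auto
  then obtain r where r: "norm (snd x0) < r" "r < 1" using dense by blast
  have r0: "0 \<le> r" using r norm_ge_zero[of "snd x0"] by linarith
  define R where "R = norm (fst x0) + 1"
  define S where "S = ball (0::complex) R \<times> ball (0::complex) r"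
  define E where "E z = exp (pii * z)" for z :: complex
  define E' where "E' z = exp (- (pii * z))" for z :: complex
  define B where "B = exp (pi * R)"
  have R: "0 \<le> R" by (simp add: R_def)
  have B: "1 \<le> B" using R by (simp add: B_def)
  define a where "a n x = (-1) ^ n * (of_nat (2*n+1) * (pii) * (E (fst x) ^ (2*n+1) + E' (fst x) ^ (2*n+1))) * snd x ^ ((2*n+1)\<^sup>2)" for n and x :: "complex \<times> complex"
  define b where "b n x = (-1) ^ n * (E (fst x) ^ (2*n+1) - E' (fst x) ^ (2*n+1)) * (of_nat ((2*n+1)\<^sup>2) * snd x ^ ((2*n+1)\<^sup>2 - 1))" for n and x :: "complex \<times> complex"
  have "holomorphic2 (\<lambda>x. \<Sum>n. thetaQ_term n x) S"
  \<comment> \<open>\<open>B\<close> bounds exp(pi i z) and its inverse on the box. The derivative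
    factors pi (2n+1) and (2n+1)^2 are absorbed by pi 9^n, and 4n^2 + 4n = (2n+1)^2 - 1 is the
    exponent left after differentiation in Q.\<close>
  proof (rule holomorphic2_series[where a = a and b = b and M = "\<lambda>n. 2 * pi * B * ((9 * B\<^sup>2) ^ n * r ^ (4 * n * n + 4 * n))"])
    show "convex S" "open S" unfolding S_def by (auto intro: convex_Times open_Times)
    show "summable (\<lambda>n. 2 * pi * B * ((9 * B\<^sup>2) ^ n * r ^ (4 * n * n + 4 * n)))"
      using r r0 by (intro summable_mult summable_power_superlinear) (auto simp: algebra_simps)
    fix n x assume x: "x \<in> S"
    have fx: "norm (fst x) \<le> R" and sx: "norm (snd x) \<le> r" using x by (auto simp: S_def)
    show "(thetaQ_term n has_derivative (\<lambda>(u, v). a n x * u + b n x * v)) (at x)"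
    proof -
      define m where "m = 2*n+1"
      have E: "((\<lambda>x. exp (pii * fst x) ^ m) has_derivative (\<lambda>h. of_nat m * (pii) * E (fst x) ^ m * fst h)) (at x)"
      proof -
        have 1: "exp (pii * z) ^ m = exp (of_nat m * (pii * z))" for z by (rule exp_of_nat_mult[symmetric])
        have "((\<lambda>z. exp (of_nat m * (pii * z))) has_field_derivative exp (of_nat m * (pii * fst x)) * (of_nat m * (pii))) (at (fst x))"
          by (auto intro!: derivative_eq_intros simp: algebra_simps)
        from has_derivative_compose[OF has_derivative_fst[OF has_derivative_ident] this[unfolded has_field_derivative_def]]
        show ?thesis unfolding E_def 1 by (simp add: mult_ac fun_eq_iff)
      qed
      have E': "((\<lambda>x. exp (- (pii * fst x)) ^ m) has_derivative (\<lambda>h. - (of_nat m * (pii) * E' (fst x) ^ m * fst h))) (at x)"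
      proof -
        have 1: "exp (- (pii * z)) ^ m = exp (of_nat m * - (pii * z))" for z by (rule exp_of_nat_mult[symmetric])
        have "((\<lambda>z. exp (of_nat m * - (pii * z))) has_field_derivative exp (of_nat m * - (pii * fst x)) * - (of_nat m * (pii))) (at (fst x))"
          by (auto intro!: derivative_eq_intros simp: algebra_simps)
        from has_derivative_compose[OF has_derivative_fst[OF has_derivative_ident] this[unfolded has_field_derivative_def]]
        show ?thesis unfolding E'_def 1 by (simp add: mult_ac fun_eq_iff)
      qed
      have Q: "((\<lambda>x. snd x ^ m\<^sup>2) has_derivative (\<lambda>h. of_nat (m\<^sup>2) * snd x ^ (m\<^sup>2 - 1) * snd h)) (at x)"
        by (auto intro!: derivative_eq_intros simp: mult_ac)
      have d: "((\<lambda>x. (-1) ^ n * (exp (pii * fst x) ^ m - exp (- (pii * fst x)) ^ m)) has_derivative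
          (\<lambda>h. (-1) ^ n * (of_nat m * (pii) * E (fst x) ^ m * fst h - - (of_nat m * (pii) * E' (fst x) ^ m * fst h)))) (at x)"
        by (intro has_derivative_mult_right has_derivative_diff E E')
      have ab: "a n x = (-1) ^ n * (of_nat m * (pii) * (E (fst x) ^ m + E' (fst x) ^ m)) * snd x ^ m\<^sup>2"
        "b n x = (-1) ^ n * (E (fst x) ^ m - E' (fst x) ^ m) * (of_nat (m\<^sup>2) * snd x ^ (m\<^sup>2 - 1))"
        unfolding a_def b_def m_def by (rule refl)+
      show ?thesis
        unfolding thetaQ_term_def[abs_def] m_def[symmetric]
      proof (rule has_derivative_eq_rhs[OF has_derivative_mult[OF d Q]])
        show "(\<lambda>h. (-1) ^ n * (exp (pii * fst x) ^ m - exp (- (pii * fst x)) ^ m) * (of_nat (m\<^sup>2) * snd x ^ (m\<^sup>2 - 1) * snd h) +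
            (-1) ^ n * (of_nat m * (pii) * E (fst x) ^ m * fst h - - (of_nat m * (pii) * E' (fst x) ^ m * fst h)) * snd x ^ m\<^sup>2) =
          (\<lambda>(u, v). a n x * u + b n x * v)"
          unfolding ab E_def[symmetric] E'_def[symmetric] case_prod_unfold by (rule ext) (simp add: algebra_simps)
      qed
    qed
    have Eb: "norm (E (fst x)) \<le> B" "norm (E' (fst x)) \<le> B"
    proof -
      have "\<bar>Im (fst x)\<bar> \<le> R" using abs_Im_le_cmod[of "fst x"] fx by linarith
      then have "- Im (fst x) \<le> R" "Im (fst x) \<le> R" by linarith+
      moreover have "norm (E (fst x)) = exp (pi * - Im (fst x))" "norm (E' (fst x)) = exp (pi * Im (fst x))"
        by (simp_all add: E_def E'_def)
      ultimately show "norm (E (fst x)) \<le> B" "norm (E' (fst x)) \<le> B"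
        by (simp_all only: B_def exp_le_cancel_iff) (intro mult_left_mono; simp)+
    qed
    have Eb2: "norm (E (fst x) ^ (2*n+1) - E' (fst x) ^ (2*n+1)) \<le> 2 * B * (B\<^sup>2) ^ n" "norm (E (fst x) ^ (2*n+1) + E' (fst x) ^ (2*n+1)) \<le> 2 * B * (B\<^sup>2) ^ n"
    proof -
      have "norm (E (fst x)) ^ (2*n+1) \<le> B ^ (2*n+1)" "norm (E' (fst x)) ^ (2*n+1) \<le> B ^ (2*n+1)"
        using Eb by (auto intro: power_mono simp del: power_Suc)
      moreover have "B ^ (2*n+1) = B * (B\<^sup>2) ^ n" by (simp add: power_mult)
      ultimately show "norm (E (fst x) ^ (2*n+1) - E' (fst x) ^ (2*n+1)) \<le> 2 * B * (B\<^sup>2) ^ n" "norm (E (fst x) ^ (2*n+1) + E' (fst x) ^ (2*n+1)) \<le> 2 * B * (B\<^sup>2) ^ n"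
        using norm_triangle_ineq4[of "E (fst x) ^ (2*n+1)" "E' (fst x) ^ (2*n+1)"] norm_triangle_ineq[of "E (fst x) ^ (2*n+1)" "E' (fst x) ^ (2*n+1)"]
        unfolding norm_power by linarith+
    qed
    have e: "(2*n+1)\<^sup>2 - 1 = 4 * n * n + 4 * n" "(2*n+1)\<^sup>2 = Suc (4 * n * n + 4 * n)" by (simp_all add: power2_eq_square)
    have Qb: "norm (snd x) ^ (4 * n * n + 4 * n) \<le> r ^ (4 * n * n + 4 * n)"
      using sx by (intro power_mono) auto
    have Qb': "norm (snd x) ^ ((2*n+1)\<^sup>2) \<le> r ^ (4 * n * n + 4 * n)"
    proof -
      have "norm (snd x) ^ Suc (4 * n * n + 4 * n) \<le> norm (snd x) ^ (4 * n * n + 4 * n)"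
        using sx r by (intro power_decreasing) auto
      then show ?thesis unfolding e using Qb by linarith
    qed
    have n3: "real (2*n+1) \<le> 3 ^ n"
      by (induction n) auto
    have n9: "real ((2*n+1)\<^sup>2) \<le> 9 ^ n"
    proof -
      have "real ((2*n+1)\<^sup>2) = real (2*n+1) ^ 2" by simp
      also have "\<dots> \<le> (3 ^ n) ^ 2" using n3 by (intro power_mono) auto
      finally show ?thesis by (simp add: power_mult[symmetric] mult.commute[of n]) (simp add: power_mult)
    qed
    have n39: "real (2*n+1) \<le> 9 ^ n"
      using n3 power_mono[of 3 "9::real" n] by simp
    have pi1: "1 \<le> pi" using pi_gt3 by simp
    have main: "c * (2 * B * (B\<^sup>2) ^ n) * r ^ (4 * n * n + 4 * n) \<le> 2 * pi * B * ((9 * B\<^sup>2) ^ n * r ^ (4 * n * n + 4 * n))" if "c \<le> pi * 9 ^ n" for c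
    proof -
      have "c * (2 * B * (B\<^sup>2) ^ n * r ^ (4 * n * n + 4 * n)) \<le> (pi * 9 ^ n) * (2 * B * (B\<^sup>2) ^ n * r ^ (4 * n * n + 4 * n))"
        using that B r0 by (intro mult_right_mono) auto
      then show ?thesis by (simp add: power_mult_distrib mult_ac)
    qed
    have one9: "1 \<le> pi * 9 ^ n" using pi1 mult_mono[of 1 pi 1 "9 ^ n"] by simp
    have "norm (thetaQ_term n x) = norm (E (fst x) ^ (2*n+1) - E' (fst x) ^ (2*n+1)) * norm (snd x) ^ ((2*n+1)\<^sup>2)"
      by (simp add: thetaQ_term_def norm_mult norm_power E_def E'_def)
    also have "\<dots> \<le> (2 * B * (B\<^sup>2) ^ n) * r ^ (4 * n * n + 4 * n)"
      using Eb2 Qb' B by (intro mult_mono) auto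
    also have "\<dots> \<le> 2 * pi * B * ((9 * B\<^sup>2) ^ n * r ^ (4 * n * n + 4 * n))" using main[OF one9] by simp
    finally show "norm (thetaQ_term n x) \<le> 2 * pi * B * ((9 * B\<^sup>2) ^ n * r ^ (4 * n * n + 4 * n))" .
    have "norm (a n x) = (real (2*n+1) * pi) * norm (E (fst x) ^ (2*n+1) + E' (fst x) ^ (2*n+1)) * norm (snd x) ^ ((2*n+1)\<^sup>2)"
      unfolding a_def norm_mult norm_power norm_of_nat norm_of_real norm_ii norm_minus_cancel norm_one by simp
    also have "\<dots> \<le> (real (2*n+1) * pi) * (2 * B * (B\<^sup>2) ^ n) * r ^ (4 * n * n + 4 * n)"
      using Eb2 Qb' B by (intro mult_mono) auto
    also have "\<dots> \<le> 2 * pi * B * ((9 * B\<^sup>2) ^ n * r ^ (4 * n * n + 4 * n))" using n39 by (intro main) (simp add: mult.commute)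
    finally show "norm (a n x) \<le> 2 * pi * B * ((9 * B\<^sup>2) ^ n * r ^ (4 * n * n + 4 * n))" .
    have "norm (b n x) = real ((2*n+1)\<^sup>2) * norm (E (fst x) ^ (2*n+1) - E' (fst x) ^ (2*n+1)) * norm (snd x) ^ (4 * n * n + 4 * n)"
      unfolding b_def norm_mult norm_power norm_of_nat norm_minus_cancel norm_one e(1) by simp
    also have "\<dots> \<le> real ((2*n+1)\<^sup>2) * (2 * B * (B\<^sup>2) ^ n) * r ^ (4 * n * n + 4 * n)"
      using Eb2 Qb B by (intro mult_mono) auto
    also have "\<dots> \<le> 2 * pi * B * ((9 * B\<^sup>2) ^ n * r ^ (4 * n * n + 4 * n))"
    proof (rule main)
      have "1 * 9 ^ n \<le> pi * (9 ^ n :: real)" using pi1 by (intro mult_right_mono) auto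
      then show "real ((2*n+1)\<^sup>2) \<le> pi * 9 ^ n" using n9 by linarith
    qed
    finally show "norm (b n x) \<le> 2 * pi * B * ((9 * B\<^sup>2) ^ n * r ^ (4 * n * n + 4 * n))" .
  qed
  moreover have "x0 \<in> S" using r by (cases x0) (auto simp: S_def R_def)
  ultimately show "\<exists>a b. (thetaQ has_derivative (\<lambda>(u, v). a * u + b * v)) (at x0)"
    unfolding holomorphic2_def thetaQ_def[abs_def] by blast
qed

section \<open>Denominators vanish on no open set\<close>

lemma theta_not_locally_zero:
  assumes "0 < Im \<tau>" "open A" "A \<noteq> {}"
  shows "\<exists>z\<in>A. theta z \<tau> \<noteq> 0"
proof (rule ccontr)
  assume *: "\<not> (\<exists>z\<in>A. theta z \<tau> \<noteq> 0)"
  have "theta (1/2) \<tau> = 0"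
    by (rule analytic_continuation_open[OF assms(2) open_UNIV assms(3) connected_UNIV subset_UNIV holomorphic_theta[OF assms(1)] holomorphic_on_const])
       (use * in blast, simp)
  then show False using th_nonzero(1)[OF assms(1)] by (simp add: th2_def)
qed

lemma open_contains_box:
  assumes "open W" "(x, y) \<in> W"
  obtains A B where "open A" "open B" "x \<in> A" "y \<in> B" "A \<times> B \<subseteq> W"
proof -
  obtain A B where "open A" "open B" "(x, y) \<in> A \<times> B" "A \<times> B \<subseteq> W"
    by (rule open_prod_elim[OF assms])
  then show ?thesis by (intro that[of A B]) auto
qed

lemma qpow_surj:
  assumes "Q \<noteq> 0" "norm Q < 1" "0 < l"
  obtains \<tau> where "0 < Im \<tau>" "qpow \<tau> l = Q"
proof -
  define \<tau> where "\<tau> = Ln Q / (2 * of_real pi * \<i> * of_real l)"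
  have "2 * of_real pi * \<i> * of_real l * \<tau> = Ln Q" using assms(3) by (simp add: \<tau>_def)
  then have q: "qpow \<tau> l = Q" unfolding qpow_def by (simp only: exp_Ln[OF assms(1)])
  have "exp (- (2 * pi * l * Im \<tau>)) < exp 0" using assms(2) norm_qpow[of \<tau> l] q by simp
  then have "0 < (2 * pi * l) * Im \<tau>" by (simp only: exp_less_cancel_iff neg_less_0_iff_less)
  then have "0 < Im \<tau>" by (rule zero_less_mult_pos) (use assms(3) in simp)
  then show ?thesis using that q by blast
qed

text \<open>An open set contains points with Q \<noteq> 0. Such a Q comes from some \<tau>, and for
  this fixed \<tau> the identity theorem in z applies.\<close>

lemma thetaQ_not_locally_zero:
  assumes "open W" "W \<noteq> {}" "W \<subseteq> UNIV \<times> ball 0 1"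
  shows "\<exists>x\<in>W. thetaQ x \<noteq> 0"
proof -
  obtain z y where zy: "(z, y) \<in> W" using assms(2) by (metis ex_in_conv surj_pair)
  obtain A B where AB: "open A" "open B" "z \<in> A" "y \<in> B" "A \<times> B \<subseteq> W"
    using open_contains_box[OF assms(1) zy] by metis
  have "\<not> B \<subseteq> {0}" using AB(2,4) not_open_singleton[of "0::complex"] by (metis empty_iff subset_singletonD)
  then obtain Q where Q: "Q \<in> B" "Q \<noteq> 0" by blast
  have "(z, Q) \<in> W" using AB Q by blast
  then have "norm Q < 1" using assms(3) by auto
  then obtain \<tau> where t: "0 < Im \<tau>" "qpow \<tau> (1/8) = Q" using qpow_surj[OF Q(2), of "1/8"] by auto
  obtain z' where z': "z' \<in> A" "theta z' \<tau> \<noteq> 0" using theta_not_locally_zero[OF t(1) AB(1)] AB(3) by blast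
  then have "thetaQ (z', Q) \<noteq> 0" using theta_thetaQ[OF t(1)] t(2) by simp
  then show ?thesis using AB(5) z'(1) Q(1) by blast
qed

section \<open>The multiplier as a constant\<close>

text \<open>The expression is continuous on the upper half-plane and its eighth power is 1, so
  connectedness leaves one value. This replaces \<open>J\<close> by a constant in the cusp
  expansions.\<close>

lemma multiplier_constant:
  assumes A: "A \<in> SL2" and J: "theta_multiplier A J P L"
  obtains \<kappa> where "\<And>\<tau>. \<tau> \<in> \<H> \<Longrightarrow> cocyc A \<tau> powr (- 1 / 2) * J \<tau> = \<kappa>"
proof -
  define g where "g = (\<lambda>\<tau>. cocyc A \<tau> powr (- 1 / 2) * J \<tau>)"
  have "continuous_on \<H> (\<lambda>\<tau>. cocyc A \<tau> powr (- 1 / 2))"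
  \<comment> \<open>For c \<noteq> 0 the cocycle is never real and the principal power is
    continuous. For c = 0 it is constant, possibly -1 on the branch cut, where constancy gives
    continuity instead.\<close>
  proof (cases "A $ 2 $ 1 = 0")
    case False
    then show ?thesis unfolding cocyc_def
      by (intro continuous_on_powr_complex continuous_intros) (use cocyc_nonzero[OF A] in \<open>auto simp: cocyc_def\<close>)
  qed (simp add: cocyc_def)
  moreover have "continuous_on \<H> J" using J by (simp add: theta_multiplier_def)
  ultimately have "continuous_on \<H> g" unfolding g_def by (rule continuous_on_mult)
  moreover have "g \<tau> ^ 8 = 1" if H: "\<tau> \<in> \<H>" for \<tau>
  proof -
    have c: "cocyc A \<tau> \<noteq> 0" using cocyc_nonzero[OF A] H by simp
    have "cocyc A \<tau> powr (- 1 / 2) * cocyc A \<tau> powr (- 1 / 2) = cocyc A \<tau> powr (- 1)"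
      by (simp flip: powr_add)
    also have "\<dots> = 1 / cocyc A \<tau>" using c by (simp add: powr_minus field_simps)
    finally have "(cocyc A \<tau> powr (- 1 / 2))\<^sup>2 = 1 / cocyc A \<tau>" by (simp add: power2_eq_square)
    then have "((cocyc A \<tau> powr (- 1 / 2))\<^sup>2) ^ 4 = 1 / cocyc A \<tau> ^ 4" by (simp only: power_one_over)
    then have "(cocyc A \<tau> powr (- 1 / 2)) ^ 8 = 1 / cocyc A \<tau> ^ 4" by (simp flip: power_mult)
    moreover have "J \<tau> ^ 8 = cocyc A \<tau> ^ 4" using J H by (auto simp: theta_multiplier_def)
    ultimately show ?thesis using c by (simp add: g_def power_mult_distrib)
  qed
  then have "g ` \<H> \<subseteq> roots8" by (auto simp: roots8_def)
  then have "finite (g ` \<H>)" using roots8(1) finite_subset by blast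
  ultimately have "g constant_on \<H>" by (intro continuous_finite_range_constant connected_H) auto
  then obtain \<kappa> where "\<And>\<tau>. \<tau> \<in> \<H> \<Longrightarrow> g \<tau> = \<kappa>" by (auto simp: constant_on_def)
  then show ?thesis using that unfolding g_def by blast
qed

text \<open>\<open>theta0\<close> has no zeros, and J L is one of its values.\<close>

lemma multiplier_nonzero:
  assumes A: "A \<in> SL2" and J: "theta_multiplier A J P L" and H: "\<tau> \<in> \<H>"
  shows "J \<tau> \<noteq> 0" "L \<tau> \<noteq> 0"
proof -
  have "theta0 (moebius A \<tau>) = J \<tau> * L \<tau>" using J H by (auto simp: theta_multiplier_def)
  moreover have "theta0 (moebius A \<tau>) \<noteq> 0" using moebius_in_H[OF A] H by (intro theta0_nonzero) simp
  ultimately show "J \<tau> \<noteq> 0" "L \<tau> \<noteq> 0" by auto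
qed

lemma finite_multiplier_functions: "finite (P_family)" "finite (L_family)"
  by (auto intro: root_multiples_finite)

lemma thP_expansion:
  assumes "P \<in> P_family"
  obtains P' where "P' holomorphic_on ball 0 1" "\<And>\<tau>. P \<tau> = P' (qpow \<tau> (1/8))"
proof -
  obtain \<zeta> k where P: "P = (\<lambda>\<tau>. \<zeta> * thP k \<tau>)" using assms by (auto simp: root_multiples_def)
  define q2 where "q2 = quad_series 1 1 (\<lambda>_. 1)"
  define q3 where "q3 = quad_series 1 0 (\<lambda>_. 1)"
  define q4 where "q4 = quad_series 1 0 (\<lambda>n. (-1) powi n)"
  have hol: "q2 holomorphic_on ball 0 1" "q3 holomorphic_on ball 0 1" "q4 holomorphic_on ball 0 1"
    unfolding q2_def q3_def q4_def by (auto intro!: quad_series_holomorphic simp: norm_power_int)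
  have th: "th2 \<tau> = q2 (qpow \<tau> (1/8))" "th3 \<tau> = q3 (qpow \<tau> (1/8))" "th4 \<tau> = q4 (qpow \<tau> (1/8))" for \<tau>
    unfolding q2_def q3_def q4_def by (rule th_quad_series)+
  show ?thesis
  proof (rule that)
    show "(\<lambda>Q. \<zeta> * (if k = 0 then q3 Q * q4 Q else if k = 1 then q2 Q * q3 Q else q2 Q * q4 Q)) holomorphic_on ball 0 1"
      by (cases "k = 0"; cases "k = 1") (auto intro!: holomorphic_intros hol)
    show "P \<tau> = \<zeta> * (if k = 0 then q3 (qpow \<tau> (1/8)) * q4 (qpow \<tau> (1/8)) else if k = 1 then q2 (qpow \<tau> (1/8)) * q3 (qpow \<tau> (1/8)) else q2 (qpow \<tau> (1/8)) * q4 (qpow \<tau> (1/8)))" for \<tau>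
      unfolding P thP_def th ..
  qed
qed

section \<open>The Jacobi form\<close>

lemma meromorphic2_quotientI:
  assumes "open U" "holomorphic2 g U" "holomorphic2 h U"
    and "\<And>W. open W \<Longrightarrow> W \<noteq> {} \<Longrightarrow> W \<subseteq> U \<Longrightarrow> \<exists>x\<in>W. h x \<noteq> 0"
    and "\<And>x. x \<in> U \<Longrightarrow> f x = g x / h x"
  shows "meromorphic2 f U"
  unfolding meromorphic2_def
  by (rule ballI, rule exI[of _ U], rule exI[of _ g], rule exI[of _ h]) (simp add: assms)

definition jacobi_quotient :: "complex \<Rightarrow> complex \<Rightarrow> complex" where
  "jacobi_quotient z \<tau> = - (eta \<tau> ^ 4 / (eta (2 * \<tau>) ^ 2 * theta z \<tau>))"

lemma jacobi_quotient_th: "0 < Im \<tau> \<Longrightarrow> jacobi_quotient z \<tau> = - (th3 \<tau> * th4 \<tau> / theta z \<tau>)"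
  by (simp add: jacobi_quotient_def flip: eta_quotient_th)

text \<open>J^2 in the numerator against J in the denominator leaves one J. At zeros of
  \<open>theta\<close> both sides are 0 by the convention for division, so poles need no
  exception.\<close>

lemma jacobi_quotient_transform:
  assumes A: "A \<in> SL2" and J: "theta_multiplier A J P L" and t: "0 < Im \<tau>"
  shows "exp (pii * index_factor A \<tau> * z\<^sup>2) * jacobi_quotient (z / cocyc A \<tau>) (moebius A \<tau>) = - (J \<tau> * P \<tau> / theta z \<tau>)"
proof -
  have H: "\<tau> \<in> \<H>" using t by simp
  have J0: "J \<tau> \<noteq> 0" by (rule multiplier_nonzero[OF A J H])
  have tr: "th3 (moebius A \<tau>) * th4 (moebius A \<tau>) = (J \<tau>)\<^sup>2 * P \<tau>"
    "theta (z / cocyc A \<tau>) (moebius A \<tau>) = J \<tau> * exp (pii * index_factor A \<tau> * z\<^sup>2) * theta z \<tau>"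
    using J H unfolding theta_multiplier_def by blast+
  show ?thesis
    unfolding jacobi_quotient_th[OF moebius_in_H[OF A t]] tr using J0 by (simp add: power2_eq_square)
qed

lemma meromorphic2_jacobi_quotient: "meromorphic2 (\<lambda>(z, \<tau>). jacobi_quotient z \<tau>) (UNIV \<times> \<H>)"
proof -
  define g where "g = (\<lambda>x :: complex \<times> complex. - (th3 (snd x) * th4 (snd x)))"
  define h where "h = (\<lambda>x. thetaQ (fst x, qpow (snd x) (1/8)))"
  have "(\<lambda>\<tau>. - (th3 \<tau> * th4 \<tau>)) holomorphic_on \<H>" by (intro holomorphic_intros th_holomorphic)
  then have g: "holomorphic2 g (UNIV \<times> \<H>)" unfolding g_def by (rule holomorphic2_snd[OF _ open_H])
  have "(\<lambda>\<tau>. qpow \<tau> (1/8)) holomorphic_on \<H>" unfolding qpow_def by (intro holomorphic_intros)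
  moreover have "(\<lambda>\<tau>. qpow \<tau> (1/8)) ` \<H> \<subseteq> ball 0 1" using norm_qpow_less_1[of _ "1/8"] by auto
  ultimately have h: "holomorphic2 h (UNIV \<times> \<H>)"
    unfolding h_def by (intro holomorphic2_compose_snd[OF holomorphic2_thetaQ _ open_H])
  have hth: "h x = theta (fst x) (snd x)" if "x \<in> UNIV \<times> \<H>" for x
    using theta_thetaQ[of "snd x" "fst x"] that by (auto simp: h_def)
  have nz: "\<exists>x\<in>W. h x \<noteq> 0" if W: "open W" "W \<noteq> {}" "W \<subseteq> UNIV \<times> \<H>" for W
  proof -
    obtain z \<tau> where zt: "(z, \<tau>) \<in> W" using W(2) by (metis ex_in_conv surj_pair)
    obtain A B where AB: "open A" "open B" "z \<in> A" "\<tau> \<in> B" "A \<times> B \<subseteq> W"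
      using open_contains_box[OF W(1) zt] by metis
    have t: "0 < Im \<tau>" using W(3) zt by auto
    obtain z' where z': "z' \<in> A" "theta z' \<tau> \<noteq> 0" using theta_not_locally_zero[OF t AB(1)] AB(3) by blast
    have m: "(z', \<tau>) \<in> W" using z' AB by blast
    then have "h (z', \<tau>) = theta z' \<tau>" using hth[of "(z', \<tau>)"] W(3) by auto
    then show ?thesis using m z'(2) by (intro bexI[OF _ m]) simp
  qed
  have eq: "(\<lambda>(z, \<tau>). jacobi_quotient z \<tau>) x = g x / h x" if "x \<in> UNIV \<times> \<H>" for x
    unfolding hth[OF that] g_def using jacobi_quotient_th[of "snd x" "fst x"] that by (auto simp: case_prod_unfold)
  show ?thesis
    by (rule meromorphic2_quotientI[OF open_Times[OF open_UNIV open_H] g h nz eq])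
qed

lemma jacobi_quotient_elliptic:
  assumes "\<tau> \<in> \<H>"
  shows "jacobi_quotient (z + of_int l * \<tau> + of_int n) \<tau> =
    (-1) powi (- 1 * (l + n)) * exp (- of_real pi * \<i> * of_int (- 1) * (of_int (l\<^sup>2) * \<tau> + 2 * of_int l * z)) * jacobi_quotient z \<tau>"
proof -
  define e where "e = pii * (of_int (l\<^sup>2) * \<tau> + 2 * of_int l * z)"
  have s: "(-1 :: complex) powi (- 1 * (l + n)) = 1 / (-1) powi (l + n)" by (simp only: mult_minus1 power_int_minus divide_inverse mult_1)
  have x: "- of_real pi * \<i> * of_int (- 1) * (of_int (l\<^sup>2) * \<tau> + 2 * of_int l * z) = e" by (simp add: e_def)
  show ?thesis
    unfolding jacobi_quotient_th[OF assms[unfolded in_H]] theta_quasi_periodic[OF assms[unfolded in_H]] s x e_def[symmetric]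
    by (simp add: exp_minus field_simps)
qed

theorem jacobi_form: "\<exists>\<Gamma>. meromorphic_jacobi_form \<Gamma> 1 (-1) jacobi_quotient"
proof -
  define X where "X = (UNIV :: complex set) \<times> \<H>"
  define mv where "mv A x = (fst x / cocyc A (snd x), moebius A (snd x))" for A :: "int^2^2" and x :: "complex \<times> complex"
  define m where "m A x = exp (pii * index_factor A (snd x) * (fst x)\<^sup>2)" for A :: "int^2^2" and x :: "complex \<times> complex"
  \<comment> \<open>After division by \<open>theta0\<close> the law of weight 1/2 becomes invariance
    under the exponential factor alone.\<close>
  define G where "G x = jacobi_quotient (fst x) (snd x) / theta0 (snd x)" for x
  interpret slash_action X mv m G
  proof
    fix A B x assume A: "A \<in> SL2" and x: "x \<in> X"
    have t: "0 < Im (snd x)" using x by (auto simp: X_def)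
    show "mv A x \<in> X" using moebius_in_H[OF A t] by (simp add: X_def mv_def)
    assume B: "B \<in> SL2"
    show "mv (A ** B) x = mv A (mv B x)"
      by (simp add: mv_def moebius_mult[OF B t] cocyc_mult[OF B t] mult.commute)
    show "m (A ** B) x = m A (mv B x) * m B x"
      unfolding m_def exp_add[symmetric]
      by (simp add: mv_def index_factor_mult[OF A B t] power_divide algebra_simps)
  next
    fix x assume "x \<in> X"
    show "mv (mat 1) x = x" "m (mat 1) x = 1" by (simp_all add: mv_def m_def)
  next
    \<comment> \<open>Every translate of \<open>G\<close> has this shape: \<open>J\<close> has
      cancelled, and only the finitely many pairs (P, L) remain as parameters.\<close>
    define F where "F = (\<lambda>(P, L) x. if x \<in> X then - (P (snd x) / (L (snd x) * theta (fst x) (snd x))) else (0::complex))"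
    have "(\<lambda>A x. if x \<in> X then m A x * G (mv A x) else 0) ` SL2 \<subseteq> F ` (P_family \<times> L_family)"
    proof (rule image_subsetI)
      fix A assume A: "A \<in> SL2"
      obtain J P L where J: "theta_multiplier A J P L" using theta_multiplier_exists[OF A] by blast
      have "m A x * G (mv A x) = - (P (snd x) / (L (snd x) * theta (fst x) (snd x)))" if x: "x \<in> X" for x
      proof -
        have t: "0 < Im (snd x)" and H: "snd x \<in> \<H>" using x by (auto simp: X_def)
        have L: "theta0 (moebius A (snd x)) = J (snd x) * L (snd x)" using J H unfolding theta_multiplier_def by blast
        have "m A x * G (mv A x) = - (J (snd x) * P (snd x) / theta (fst x) (snd x)) / theta0 (moebius A (snd x))"
          using jacobi_quotient_transform[OF A J t, of "fst x"] by (simp add: m_def G_def mv_def)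
        then show ?thesis unfolding L using multiplier_nonzero(1)[OF A J H] by simp
      qed
      then have "(\<lambda>x. if x \<in> X then m A x * G (mv A x) else 0) = F (P, L)" by (auto simp: F_def fun_eq_iff)
      moreover have "(P, L) \<in> P_family \<times> L_family" using J by (simp add: theta_multiplier_def)
      ultimately show "(\<lambda>x. if x \<in> X then m A x * G (mv A x) else 0) \<in> F ` (P_family \<times> L_family)"
        by blast
    qed
    then show "finite ((\<lambda>A x. if x \<in> X then m A x * G (mv A x) else 0) ` SL2)"
      using finite_multiplier_functions finite_subset by blast
  qed
  have law: "jacobi_quotient (z / cocyc A \<tau>) (moebius A \<tau>) =
      shimura_j A \<tau> powi 1 * exp (pii * of_int (- 1 * A $ 2 $ 1) * z\<^sup>2 / cocyc A \<tau>) * jacobi_quotient z \<tau>"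
    if A: "A \<in> stabilizer" and t: "\<tau> \<in> \<H>" for A z \<tau>
  proof -
    have SL: "A \<in> SL2" using A by (auto simp: stabilizer_def Gamma0_4_def)
    have t': "0 < Im \<tau>" using t by simp
    have nz: "theta0 \<tau> \<noteq> 0" "theta0 (moebius A \<tau>) \<noteq> 0" by (intro theta0_nonzero moebius_in_H[OF SL] t')+
    define e where "e = pii * index_factor A \<tau> * z\<^sup>2"
    have "(z, \<tau>) \<in> X" using t by (simp add: X_def)
    then have "m A (z, \<tau>) * G (mv A (z, \<tau>)) = G (z, \<tau>)" using A unfolding stabilizer_def by blast
    then have "exp e * (jacobi_quotient (z / cocyc A \<tau>) (moebius A \<tau>) / theta0 (moebius A \<tau>)) = jacobi_quotient z \<tau> / theta0 \<tau>"
      by (simp add: m_def G_def mv_def e_def)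
    then have "jacobi_quotient (z / cocyc A \<tau>) (moebius A \<tau>) = theta0 (moebius A \<tau>) / theta0 \<tau> * exp (- e) * jacobi_quotient z \<tau>"
      using nz by (simp add: exp_minus field_simps)
    moreover have "pii * of_int (- 1 * A $ 2 $ 1) * z\<^sup>2 / cocyc A \<tau> = - e"
      by (simp add: e_def index_factor_def)
    ultimately show ?thesis by (simp add: shimura_j_def)
  qed
  have cusp: "\<exists>N>0. \<exists>\<Phi>. meromorphic2 \<Phi> (UNIV \<times> ball 0 1) \<and>
        (\<forall>z. \<forall>\<tau>\<in>\<H>. cocyc A \<tau> powr (- of_int 1 / 2) * exp (- of_real pi * \<i> * of_int (- 1 * A $ 2 $ 1) * z\<^sup>2 / cocyc A \<tau>)
             * jacobi_quotient (z / cocyc A \<tau>) (moebius A \<tau>) = \<Phi> (z, qpow \<tau> (1 / real N)))"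
    if A: "A \<in> SL2" for A
  proof -
    obtain J P L where J: "theta_multiplier A J P L" using theta_multiplier_exists[OF A] by blast
    obtain \<kappa> where \<kappa>: "\<And>\<tau>. \<tau> \<in> \<H> \<Longrightarrow> cocyc A \<tau> powr (- 1 / 2) * J \<tau> = \<kappa>" by (rule multiplier_constant[OF A J]) blast
    have "P \<in> P_family" using J by (simp add: theta_multiplier_def)
    then obtain P' where P': "P' holomorphic_on ball 0 1" "\<And>\<tau>. P \<tau> = P' (qpow \<tau> (1/8))"
      by (rule thP_expansion) blast
    \<comment> \<open>Both \<open>P\<close> and \<open>theta\<close> are functions of Q = q^(1/8),
      so N = 8 works at every cusp, and the extension to Q = 0 is an explicit quotient.\<close>
    define g where "g = (\<lambda>x :: complex \<times> complex. - \<kappa> * P' (snd x))"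
    have "(\<lambda>Q. - \<kappa> * P' Q) holomorphic_on ball 0 1" by (intro holomorphic_intros P')
    then have g: "holomorphic2 g (UNIV \<times> ball 0 1)" unfolding g_def by (rule holomorphic2_snd) simp
    have "meromorphic2 (\<lambda>x. g x / thetaQ x) (UNIV \<times> ball 0 1)"
      by (rule meromorphic2_quotientI[OF open_Times[OF open_UNIV open_ball] g holomorphic2_thetaQ thetaQ_not_locally_zero refl])
    moreover have "cocyc A \<tau> powr (- of_int 1 / 2) * exp (- of_real pi * \<i> * of_int (- 1 * A $ 2 $ 1) * z\<^sup>2 / cocyc A \<tau>)
             * jacobi_quotient (z / cocyc A \<tau>) (moebius A \<tau>) = g (z, qpow \<tau> (1 / real 8)) / thetaQ (z, qpow \<tau> (1 / real 8))"
      if H: "\<tau> \<in> \<H>" for z \<tau>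
    proof -
      have t: "0 < Im \<tau>" using H by simp
      have "- of_real pi * \<i> * of_int (- 1 * A $ 2 $ 1) * z\<^sup>2 / cocyc A \<tau> = pii * index_factor A \<tau> * z\<^sup>2"
        by (simp add: index_factor_def)
      then have "cocyc A \<tau> powr (- of_int 1 / 2) * exp (- of_real pi * \<i> * of_int (- 1 * A $ 2 $ 1) * z\<^sup>2 / cocyc A \<tau>)
             * jacobi_quotient (z / cocyc A \<tau>) (moebius A \<tau>) = cocyc A \<tau> powr (- 1 / 2) * - (J \<tau> * P \<tau> / theta z \<tau>)"
        unfolding mult.assoc using jacobi_quotient_transform[OF A J t, of z] by (simp add: mult.assoc)
      also have "\<dots> = - (cocyc A \<tau> powr (- 1 / 2) * J \<tau>) * P \<tau> / theta z \<tau>" by simp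
      finally show ?thesis unfolding \<kappa>[OF H] P'(2) theta_thetaQ[OF t] g_def by simp
    qed
    ultimately show ?thesis by (intro exI[of _ "8::nat"] conjI exI[of _ "\<lambda>x. g x / thetaQ x"]) auto
  qed
  have "meromorphic_jacobi_form stabilizer 1 (-1) jacobi_quotient"
    unfolding meromorphic_jacobi_form_def
    by (intro conjI ballI allI stabilizer_finite_index stabilizer_subset meromorphic2_jacobi_quotient law
        jacobi_quotient_elliptic cusp)
  then show ?thesis by blast
qed

section \<open>Specialisation to torsion points\<close>

text \<open>With the factor \<open>exp (\<pi> \<i> r s)\<close> the family \<open>thn\<close> transforms under the modular group by
  \<open>(r, s) \<mapsto> (r, s) A\<close> and the multiplier of \<open>theta\<close>, without further constants.\<close>

definition thn :: "real \<Rightarrow> real \<Rightarrow> complex \<Rightarrow> complex" where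
  "thn r s \<tau> = exp (pii * of_real (r * s)) * thc r s \<tau>"

lemma thn_theta: "thn r s \<tau> = exp (pii * of_real r * (of_real r * \<tau> + of_real s)) * theta (of_real r * \<tau> + of_real s) \<tau>"
proof -
  have "exp (pii * of_real (r * s)) * qpow \<tau> (r\<^sup>2 / 2) = exp (pii * of_real r * (of_real r * \<tau> + of_real s))"
    unfolding qpow_def exp_add[symmetric] by (rule arg_cong[where f = exp]) (simp add: field_simps power2_eq_square)
  then show ?thesis unfolding thn_def thc_theta by (simp add: mult.assoc[symmetric])
qed

lemma thn_transform:
  assumes A: "A \<in> SL2" and J: "theta_multiplier A J P L" and t: "0 < Im \<tau>"
    and r': "r' = r * of_int (A $ 1 $ 1) + s * of_int (A $ 2 $ 1)" and s': "s' = r * of_int (A $ 1 $ 2) + s * of_int (A $ 2 $ 2)"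
  shows "thn r s (moebius A \<tau>) = J \<tau> * thn r' s' \<tau>"
proof -
  define v where "v = cocyc A \<tau>"
  define z where "z = of_real r' * \<tau> + of_real s'"
  have v: "v \<noteq> 0" unfolding v_def by (rule cocyc_nonzero[OF A t])
  have zv: "of_real r * moebius A \<tau> + of_real s = z / v"
    using v by (simp add: moebius_def v_def cocyc_def z_def r' s' field_simps)
  have "of_int (A $ 1 $ 1) * of_int (A $ 2 $ 2) - of_int (A $ 1 $ 2) * of_int (A $ 2 $ 1) = (1 :: complex)"
    by (rule SL2_det_of_int[OF A])
  then have "of_real r * (of_int (A $ 1 $ 1) * of_int (A $ 2 $ 2) - of_int (A $ 1 $ 2) * of_int (A $ 2 $ 1)) = (of_real r :: complex)" by simp
  \<comment> \<open>Here determinant 1 enters: r + c z = r' (c \<tau> + d), which makes the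
    prefactors of \<open>thn\<close> match with no constant left over.\<close>
  then have rz: "of_real r + of_int (A $ 2 $ 1) * z = of_real r' * v"
    by (simp add: z_def v_def cocyc_def r' s' algebra_simps)
  have "pii * of_real r * (z / v) + pii * index_factor A \<tau> * z\<^sup>2 = pii * (z / v) * (of_real r + of_int (A $ 2 $ 1) * z)"
    by (simp add: index_factor_def v_def[symmetric] power2_eq_square algebra_simps)
  also have "\<dots> = pii * of_real r' * z" unfolding rz using v by simp
  finally have e: "exp (pii * of_real r * (z / v)) * exp (pii * index_factor A \<tau> * z\<^sup>2) = exp (pii * of_real r' * z)"
    by (simp flip: exp_add)
  have th: "theta (z / v) (moebius A \<tau>) = J \<tau> * exp (pii * index_factor A \<tau> * z\<^sup>2) * theta z \<tau>"
    using J t unfolding theta_multiplier_def v_def by auto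
  show ?thesis unfolding thn_theta zv th z_def[symmetric] e[symmetric] by (simp only: mult_ac)
qed

lemma thc_shift:
  assumes "0 < Im \<tau>"
  shows "thc (r + of_int l) s \<tau> = (-1) powi l * exp (- (2 * of_real pi * \<i> * of_real (of_int l * s))) * thc r s \<tau>"
    and "thc r (s + of_int n) \<tau> = (-1) powi n * thc r s \<tau>"
proof -
  define z where "z = of_real r * \<tau> + of_real s"
  have z1: "of_real (r + of_int l) * \<tau> + of_real s = z + of_int l * \<tau> + of_int 0" by (simp add: z_def algebra_simps)
  have e: "qpow \<tau> ((r + of_int l)\<^sup>2 / 2) * exp (- (pii * (of_int (l\<^sup>2) * \<tau> + 2 * of_int l * z))) =
     exp (- (2 * of_real pi * \<i> * of_real (of_int l * s))) * qpow \<tau> (r\<^sup>2 / 2)"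
    unfolding qpow_def exp_add[symmetric] z_def by (rule arg_cong[where f = exp]) (simp add: field_simps power2_eq_square)
  have "thc (r + of_int l) s \<tau> = (-1) powi l * (qpow \<tau> ((r + of_int l)\<^sup>2 / 2) * exp (- (pii * (of_int (l\<^sup>2) * \<tau> + 2 * of_int l * z)))) * theta z \<tau>"
    unfolding thc_theta z1 theta_quasi_periodic[OF assms] by simp
  then have "thc (r + of_int l) s \<tau> = (-1) powi l * (exp (- (2 * of_real pi * \<i> * of_real (of_int l * s))) * qpow \<tau> (r\<^sup>2 / 2)) * theta z \<tau>"
    unfolding e .
  then show "thc (r + of_int l) s \<tau> = (-1) powi l * exp (- (2 * of_real pi * \<i> * of_real (of_int l * s))) * thc r s \<tau>"
    unfolding thc_theta[of r] z_def by (simp only: mult_ac)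
  have z2: "of_real r * \<tau> + of_real (s + of_int n) = z + of_int 0 * \<tau> + of_int n" by (simp add: z_def)
  show "thc r (s + of_int n) \<tau> = (-1) powi n * thc r s \<tau>"
    unfolding thc_theta z2 theta_quasi_periodic[OF assms] by (simp add: z_def)
qed

lemma exp_2pi_int: "exp (2 * of_real pi * \<i> * of_int n) = 1" "exp (- (2 * of_real pi * \<i> * of_int n)) = 1"
  using exp_eq_1[of "2 * of_real pi * \<i> * of_int n"] by (auto simp: exp_minus)

text \<open>A shift of a numerator by a multiple of 2 N^2 shifts the characteristic by a multiple of
  2N. Being even it kills the sign; times a fraction with denominator N it is an even integer, which
  kills the exponential factors.\<close>

lemma thn_periodic:
  assumes t: "0 < Im \<tau>" and N: "N > 0"
  shows "thn (of_int (u + 2 * (int N)\<^sup>2 * k) / real N) (of_int v / real N) \<tau> = thn (of_int u / real N) (of_int v / real N) \<tau>"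
    and "thn (of_int u / real N) (of_int (v + 2 * (int N)\<^sup>2 * k) / real N) \<tau> = thn (of_int u / real N) (of_int v / real N) \<tau>"
proof -
  have shift: "of_int (w + 2 * (int N)\<^sup>2 * k) / real N = of_int w / real N + of_int (2 * int N * k)" for w
    using N by (simp add: field_simps power2_eq_square)
  have sign: "(-1 :: complex) powi (2 * int N * k) = 1" by (simp add: power_int_minus_left)
  have p: "(of_int u / real N) * of_int (2 * int N * k) = of_int (2 * (u * k))" for u :: int using N by simp
  have e: "exp (pii * of_real (x + of_int (2 * j))) = exp (pii * of_real x)" for x :: real and j :: int
  proof -
    have "exp (pii * of_real (x + of_int (2 * j))) = exp (pii * of_real x) * exp (2 * of_real pi * \<i> * of_int j)"
      unfolding exp_add[symmetric] by (rule arg_cong[where f = exp]) (simp add: algebra_simps)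
    then show ?thesis unfolding exp_2pi_int by simp
  qed
  have e1: "exp (- (2 * of_real pi * \<i> * of_real (of_int (2 * int N * k) * (of_int v / real N)))) = 1"
    using exp_2pi_int(2)[of "2 * (v * k)"] p[of v] by (simp add: mult.commute)
  have m1: "(of_int u / real N + of_int (2 * int N * k)) * (of_int v / real N) = of_int u / real N * (of_int v / real N) + of_int (2 * (v * k))"
    unfolding distrib_right using p[of v] by (simp only: mult.commute[of "of_int (2 * int N * k)"])
  have m2: "of_int u / real N * (of_int v / real N + of_int (2 * int N * k)) = of_int u / real N * (of_int v / real N) + of_int (2 * (u * k))"
    using p[of u] by (simp only: distrib_left)
  show "thn (of_int (u + 2 * (int N)\<^sup>2 * k) / real N) (of_int v / real N) \<tau> = thn (of_int u / real N) (of_int v / real N) \<tau>"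
    unfolding thn_def shift thc_shift(1)[OF t] sign e1 m1 e by simp
  show "thn (of_int u / real N) (of_int (v + 2 * (int N)\<^sup>2 * k) / real N) \<tau> = thn (of_int u / real N) (of_int v / real N) \<tau>"
    unfolding thn_def shift thc_shift(2)[OF t] sign m2 e by simp
qed

lemma thn_mod:
  assumes t: "0 < Im \<tau>" and N: "N > 0"
  shows "thn (of_int u / real N) (of_int v / real N) \<tau> =
    thn (of_int (u mod (2 * (int N)\<^sup>2)) / real N) (of_int (v mod (2 * (int N)\<^sup>2)) / real N) \<tau>"
proof -
  let ?K = "2 * (int N)\<^sup>2"
  have "thn (of_int u / real N) (of_int v / real N) \<tau> = thn (of_int (u mod ?K + ?K * (u div ?K)) / real N) (of_int (v mod ?K + ?K * (v div ?K)) / real N) \<tau>"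
    by simp
  then show ?thesis unfolding thn_periodic[OF t N] .
qed

text \<open>A denominator vanishing at most at the cusp is a power of Q times a zero-free function;
  the exponent will be the order of the pole that the quotient may have there.\<close>

lemma holomorphic_divide_zero:
  assumes f: "f holomorphic_on ball 0 1" and nz: "\<And>Q. Q \<in> ball 0 1 \<Longrightarrow> Q \<noteq> 0 \<Longrightarrow> f Q \<noteq> 0"
  obtains k g where "g holomorphic_on ball 0 1" "\<And>Q. Q \<in> ball 0 1 \<Longrightarrow> f Q = Q ^ k * g Q" "\<And>Q. Q \<in> ball 0 1 \<Longrightarrow> g Q \<noteq> (0::complex)"
proof (cases "f 0 = 0")
  case False
  then have "f Q \<noteq> 0" if "Q \<in> ball 0 1" for Q using nz[OF that] by (cases "Q = 0") auto
  then show ?thesis using that[of f 0] f by simp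
next
  case True
  have nc: "\<not> f constant_on ball 0 1"
  proof
    assume "f constant_on ball 0 1"
    then have "f (1/2) = f 0" by (auto simp: constant_on_def)
    then show False using True nz[of "1/2"] by simp
  qed
  have zero: "0 \<in> ball (0::complex) 1" by simp
  show ?thesis
  proof (rule holomorphic_factor_zero_nonconstant[OF f open_ball connected_ball zero True nc])
  fix g r and k :: nat
  assume g: "0 < k" "0 < r" "ball 0 r \<subseteq> ball (0::complex) 1" "g holomorphic_on ball 0 r"
     "\<And>w. w \<in> ball 0 r \<Longrightarrow> f w = (w - 0) ^ k * g w" "\<And>w. w \<in> ball 0 r \<Longrightarrow> g w \<noteq> 0"
  define h where "h Q = (if Q = 0 then g 0 else f Q / Q ^ k)" for Q
  have hg: "h Q = g Q" if "Q \<in> ball 0 r" for Q using g(5)[OF that] by (simp add: h_def)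
  have fh: "f Q = Q ^ k * h Q" if "Q \<in> ball 0 1" for Q using True g(1) by (simp add: h_def power_0_left)
  have hn: "h Q \<noteq> 0" if "Q \<in> ball 0 1" for Q
    using nz[OF that] g(2,6) by (cases "Q = 0") (auto simp: h_def)
  have "h holomorphic_on ball 0 r" by (rule holomorphic_transform[OF g(4)]) (simp only: hg)
  moreover have "h holomorphic_on ball 0 1 - {0}"
  proof (rule holomorphic_transform)
    show "(\<lambda>Q. f Q / Q ^ k) holomorphic_on ball 0 1 - {0}"
      by (intro holomorphic_intros holomorphic_on_subset[OF f]) auto
  qed (auto simp: h_def)
  ultimately have "h holomorphic_on ball 0 r \<union> (ball 0 1 - {0})"
    by (intro holomorphic_on_Un) (auto intro: open_delete)
  moreover have "ball 0 r \<union> (ball 0 1 - {0}) = ball (0::complex) 1" using g(2,3) by auto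
  ultimately have "h holomorphic_on ball 0 1" by simp
  then show ?thesis using that[of h k] fh hn by blast
  qed
qed

theorem torsion_modular_form:
  assumes rs: "r \<in> \<rat>" "s \<in> \<rat>" "\<not> (r \<in> \<int> \<and> s \<in> \<int>)"
  shows "\<exists>\<Gamma>. weakly_holomorphic_modform \<Gamma> 1 (\<lambda>\<tau>. qpow \<tau> (- (r\<^sup>2) / 2) * K_comb (of_real r * \<tau> + of_real s) \<tau>)"
proof -
  define f where "f \<tau> = qpow \<tau> (- (r\<^sup>2) / 2) * K_comb (of_real r * \<tau> + of_real s) \<tau>" for \<tau>
  define E where "E = exp (pii * of_real (r * s))"
  have E0: "E \<noteq> 0" by (simp add: E_def)
  have nonlattice: "theta (of_real r' * \<tau> + of_real s') \<tau> \<noteq> 0" "K_comb (of_real r' * \<tau> + of_real s') \<tau> = jacobi_quotient (of_real r' * \<tau> + of_real s') \<tau>"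
    if t: "0 < Im \<tau>" and n: "\<not> (r' \<in> \<int> \<and> s' \<in> \<int>)" for r' s' \<tau>
  proof -
    have "of_real r' * \<tau> + of_real s' \<noteq> of_int m * \<tau> + of_int k" for m k :: int
    proof
      assume e: "of_real r' * \<tau> + of_real s' = of_int m * \<tau> + of_int k"
      then have "Im (of_real r' * \<tau> + of_real s') = Im (of_int m * \<tau> + of_int k)" by (rule arg_cong)
      then have "r' = of_int m" using t by simp
      moreover then have "of_real s' = (of_int k :: complex)" using e by simp
      then have "Re (of_real s') = Re (of_int k :: complex)" by (rule arg_cong)
      then have "s' = of_int k" by simp
      ultimately show False using n by auto
    qed
    then show "theta (of_real r' * \<tau> + of_real s') \<tau> \<noteq> 0" "K_comb (of_real r' * \<tau> + of_real s') \<tau> = jacobi_quotient (of_real r' * \<tau> + of_real s') \<tau>"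
      unfolding jacobi_quotient_def by (intro theta_nonzero[OF t] K_comb_eq[OF t]; blast)+
  qed
  have thn_nz: "thn r' s' \<tau> \<noteq> 0" if "0 < Im \<tau>" "\<not> (r' \<in> \<int> \<and> s' \<in> \<int>)" for r' s' \<tau>
    unfolding thn_theta using nonlattice(1)[OF that] by simp
  \<comment> \<open>q^(-r^2/2) turns \<open>theta\<close> in the denominator into
    \<open>thc\<close>, and the constant \<open>E\<close> turns that into
    \<open>thn\<close>.\<close>
  have f_eq: "f \<tau> = - E * (th3 \<tau> * th4 \<tau> / thn r s \<tau>)" if t: "0 < Im \<tau>" for \<tau>
  proof -
    have "f \<tau> = qpow \<tau> (- (r\<^sup>2 / 2)) * - (th3 \<tau> * th4 \<tau> / theta (of_real r * \<tau> + of_real s) \<tau>)"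
      unfolding f_def nonlattice(2)[OF t rs(3)] jacobi_quotient_th[OF t] by simp
    then show ?thesis unfolding thn_def thc_theta E_def[symmetric] qpow_minus using E0 by simp
  qed
  obtain N :: nat and u v :: int where N: "N > 0" and r: "r = of_int u / real N" and s: "s = of_int v / real N"
  proof -
    obtain a b :: int where a: "b > 0" "r = of_int a / of_int b" using rs(1) by (rule Rats_cases') blast
    obtain c d :: int where c: "d > 0" "s = of_int c / of_int d" using rs(2) by (rule Rats_cases') blast
    have "real (nat (b * d)) = of_int b * of_int d" using a(1) c(1) by simp
    then show ?thesis using a c by (intro that[of "nat (b * d)" "a * d" "c * b"]) (auto simp: field_simps)
  qed
  \<comment> \<open>Numerators of the row vector (r, s) A over the common denominator N.\<close>
  define u' where "u' A = u * A $ 1 $ 1 + v * A $ 2 $ 1" for A :: "int^2^2"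
  define v' where "v' A = u * A $ 1 $ 2 + v * A $ 2 $ 2" for A :: "int^2^2"
  have rs': "of_int (u' A) / real N = r * of_int (A $ 1 $ 1) + s * of_int (A $ 2 $ 1)" "of_int (v' A) / real N = r * of_int (A $ 1 $ 2) + s * of_int (A $ 2 $ 2)" for A
    unfolding r s u'_def v'_def using N by (simp_all add: field_simps)
  \<comment> \<open>The inverse of A is integral too, so integral (r, s) A would force r and s to be
    integers.\<close>
  have nonint: "\<not> (of_int (u' A) / real N \<in> \<int> \<and> of_int (v' A) / real N \<in> \<int>)" if A: "A \<in> SL2" for A
  proof
    assume *: "of_int (u' A) / real N \<in> \<int> \<and> of_int (v' A) / real N \<in> \<int>"
    have det: "of_int (A $ 1 $ 1) * of_int (A $ 2 $ 2) - of_int (A $ 1 $ 2) * of_int (A $ 2 $ 1) = (1::real)" by (rule SL2_det_of_int[OF A])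
    have "r * (of_int (A $ 1 $ 1) * of_int (A $ 2 $ 2) - of_int (A $ 1 $ 2) * of_int (A $ 2 $ 1)) =
        of_int (u' A) / real N * of_int (A $ 2 $ 2) - of_int (v' A) / real N * of_int (A $ 2 $ 1)"
      "s * (of_int (A $ 1 $ 1) * of_int (A $ 2 $ 2) - of_int (A $ 1 $ 2) * of_int (A $ 2 $ 1)) =
        of_int (v' A) / real N * of_int (A $ 1 $ 1) - of_int (u' A) / real N * of_int (A $ 1 $ 2)"
      unfolding rs' by (simp_all add: algebra_simps)
    then have "r = of_int (u' A) / real N * of_int (A $ 2 $ 2) - of_int (v' A) / real N * of_int (A $ 2 $ 1)"
      "s = of_int (v' A) / real N * of_int (A $ 1 $ 1) - of_int (u' A) / real N * of_int (A $ 1 $ 2)"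
      unfolding det by simp_all
    then have "r \<in> \<int> \<and> s \<in> \<int>" using * by (metis Ints_diff Ints_mult Ints_of_int)
    with rs(3) show False by blast
  qed
  have f_transform: "f (moebius A \<tau>) = - E * (J \<tau> * P \<tau> / thn (of_int (u' A) / real N) (of_int (v' A) / real N) \<tau>)"
    if A: "A \<in> SL2" and J: "theta_multiplier A J P L" and t: "0 < Im \<tau>" for A J P L \<tau>
  proof -
    have H: "\<tau> \<in> \<H>" using t by simp
    have tr: "th3 (moebius A \<tau>) * th4 (moebius A \<tau>) = (J \<tau>)\<^sup>2 * P \<tau>" using J H unfolding theta_multiplier_def by blast
    show ?thesis
      unfolding f_eq[OF moebius_in_H[OF A t]] tr thn_transform[OF A J t rs'] using multiplier_nonzero(1)[OF A J H] by (simp add: power2_eq_square)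
  qed
  define G where "G \<tau> = f \<tau> / theta0 \<tau>" for \<tau>
  interpret slash_action \<H> moebius "\<lambda>A \<tau>. 1" G
  proof
    fix A B \<tau> assume A: "A \<in> SL2" and t: "\<tau> \<in> \<H>"
    show "moebius A \<tau> \<in> \<H>" using moebius_in_H[OF A] t by simp
    assume B: "B \<in> SL2"
    show "moebius (A ** B) \<tau> = moebius A (moebius B \<tau>)" using moebius_mult[OF B] t by simp
  next
    define K where "K = 2 * (int N)\<^sup>2"
    have K: "K > 0" using N by (simp add: K_def)
    \<comment> \<open>Translates of \<open>G\<close> depend only on (P, L) and on the numerators
      modulo 2 N^2, hence form a finite set.\<close>
    define F where "F = (\<lambda>((P, L), (a, b)) \<tau>. if \<tau> \<in> \<H> then 1 * (- E * (P \<tau> / thn (of_int a / real N) (of_int b / real N) \<tau>) / L \<tau>) else (0::complex))"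
    have "(\<lambda>A \<tau>. if \<tau> \<in> \<H> then 1 * G (moebius A \<tau>) else 0) ` SL2 \<subseteq>
        F ` ((P_family \<times> L_family) \<times> ({0..<K} \<times> {0..<K}))"
    proof (rule image_subsetI)
      fix A assume A: "A \<in> SL2"
      obtain J P L where J: "theta_multiplier A J P L" using theta_multiplier_exists[OF A] by blast
      have "G (moebius A \<tau>) = - E * (P \<tau> / thn (of_int (u' A mod K) / real N) (of_int (v' A mod K) / real N) \<tau>) / L \<tau>" if H: "\<tau> \<in> \<H>" for \<tau>
      proof -
        have t: "0 < Im \<tau>" using H by simp
        have L: "theta0 (moebius A \<tau>) = J \<tau> * L \<tau>" using J H unfolding theta_multiplier_def by blast
        have "G (moebius A \<tau>) = - E * (J \<tau> * P \<tau> / thn (of_int (u' A) / real N) (of_int (v' A) / real N) \<tau>) / (J \<tau> * L \<tau>)"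
          unfolding G_def L f_transform[OF A J t] ..
        also have "\<dots> = - E * (P \<tau> / thn (of_int (u' A) / real N) (of_int (v' A) / real N) \<tau>) / L \<tau>"
          using multiplier_nonzero(1)[OF A J H] by simp
        finally show ?thesis unfolding K_def thn_mod[OF t N, symmetric] .
      qed
      then have "(\<lambda>\<tau>. if \<tau> \<in> \<H> then 1 * G (moebius A \<tau>) else 0) = F ((P, L), (u' A mod K, v' A mod K))"
        by (auto simp: F_def fun_eq_iff)
      moreover have "((P, L), (u' A mod K, v' A mod K)) \<in> (P_family \<times> L_family) \<times> ({0..<K} \<times> {0..<K})"
        using J K by (simp add: theta_multiplier_def)
      ultimately show "(\<lambda>\<tau>. if \<tau> \<in> \<H> then 1 * G (moebius A \<tau>) else 0) \<in> F ` ((P_family \<times> L_family) \<times> ({0..<K} \<times> {0..<K}))"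
        by blast
    qed
    moreover have "finite ((P_family \<times> L_family) \<times> ({0..<K} \<times> {0..<K}))"
      using finite_multiplier_functions by simp
    ultimately show "finite ((\<lambda>A \<tau>. if \<tau> \<in> \<H> then 1 * G (moebius A \<tau>) else 0) ` SL2)"
      by (meson finite_imageI finite_subset)
  qed simp_all
  have hol: "f holomorphic_on \<H>"
  proof (rule holomorphic_transform)
    have "(\<lambda>\<tau>. thc r s \<tau>) holomorphic_on \<H>"
      unfolding r thc_quad_series[OF N] by (rule quad_series_qpow_holomorphic[OF N eq_refl[OF norm_thc_coeff]]) (use N in simp)
    then have "(\<lambda>\<tau>. thn r s \<tau>) holomorphic_on \<H>" unfolding thn_def by (intro holomorphic_intros)
    then show "(\<lambda>\<tau>. - E * (th3 \<tau> * th4 \<tau> / thn r s \<tau>)) holomorphic_on \<H>"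
      using thn_nz rs(3) by (intro holomorphic_intros th_holomorphic) auto
  qed (simp add: f_eq)
  have law: "f (moebius A \<tau>) = shimura_j A \<tau> powi 1 * f \<tau>" if A: "A \<in> stabilizer" and H: "\<tau> \<in> \<H>" for A \<tau>
  proof -
    have SL: "A \<in> SL2" using A by (auto simp: stabilizer_def Gamma0_4_def)
    have t: "0 < Im \<tau>" using H by simp
    have nz: "theta0 \<tau> \<noteq> 0" "theta0 (moebius A \<tau>) \<noteq> 0" by (intro theta0_nonzero moebius_in_H[OF SL] t)+
    have "1 * G (moebius A \<tau>) = G \<tau>" using A H unfolding stabilizer_def by blast
    then show ?thesis using nz by (simp add: G_def shimura_j_def field_simps)
  qed
  have cusp: "\<exists>M>0. \<exists>n0::int. \<exists>c::nat \<Rightarrow> complex. \<forall>\<tau>\<in>\<H>.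
        (\<lambda>n. c n * qpow \<tau> (of_int (n0 + int n) / real M)) sums (cocyc A \<tau> powr (- of_int 1 / 2) * f (moebius A \<tau>))"
    if A: "A \<in> SL2" for A
  proof -
    \<comment> \<open>Local parameter Q = q^l at the cusp: \<open>thn\<close> with denominator N is
      a series in it, and q^(1/8) is its power with exponent N^2.\<close>
    define l where "l = 1 / (8 * (real N)\<^sup>2)"
    define r' where "r' = of_int (u' A) / real N"
    define s' where "s' = of_int (v' A) / real N"
    have l0: "0 < l" using N by (simp add: l_def)
    obtain J P L where J: "theta_multiplier A J P L" using theta_multiplier_exists[OF A] by blast
    obtain \<kappa> where \<kappa>: "\<And>\<tau>. \<tau> \<in> \<H> \<Longrightarrow> cocyc A \<tau> powr (- 1 / 2) * J \<tau> = \<kappa>" by (rule multiplier_constant[OF A J]) blast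
    have "P \<in> P_family" using J by (simp add: theta_multiplier_def)
    then obtain P' where P': "P' holomorphic_on ball 0 1" "\<And>\<tau>. P \<tau> = P' (qpow \<tau> (1/8))"
      by (rule thP_expansion) blast
    define T where "T Q = exp (pii * of_real (r' * s')) *
       quad_series N (int N + 2 * u' A) (\<lambda>n. (-1) powi n * exp (pii * of_int (2*n+1) * of_real s')) Q" for Q
    have T: "thn r' s' \<tau> = T (qpow \<tau> l)" for \<tau>
      unfolding thn_def T_def r'_def thc_quad_series[OF N] l_def ..
    have holT: "T holomorphic_on ball 0 1"
      unfolding T_def by (intro holomorphic_intros quad_series_holomorphic[OF N eq_refl[OF norm_thc_coeff]])
    have nzT: "T Q \<noteq> 0" if Q: "Q \<in> ball 0 1" "Q \<noteq> 0" for Q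
    proof -
      \<comment> \<open>Every nonzero Q in the disc is a value of q^l, so \<open>T\<close> inherits
        nonvanishing from \<open>thn\<close>.\<close>
      obtain \<tau> where t: "0 < Im \<tau>" "qpow \<tau> l = Q" using qpow_surj[OF Q(2) _ l0] Q(1) by auto
      show ?thesis using thn_nz[OF t(1) nonint[OF A]] T[of \<tau>] t(2) unfolding r'_def s'_def by simp
    qed
    obtain k g where g: "g holomorphic_on ball 0 1" "\<And>Q. Q \<in> ball 0 1 \<Longrightarrow> T Q = Q ^ k * g Q" "\<And>Q. Q \<in> ball 0 1 \<Longrightarrow> g Q \<noteq> 0"
      by (rule holomorphic_divide_zero[OF holT nzT]) blast+
    \<comment> \<open>The holomorphic part at the cusp; its Taylor coefficients, shifted by the
      order k of the zero of \<open>T\<close>, give the expansion with n0 = -k.\<close>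
    define F where "F Q = - E * \<kappa> * P' (Q ^ N\<^sup>2) / g Q" for Q
    have holF: "F holomorphic_on ball 0 1"
    proof -
      have p: "(\<lambda>Q. Q ^ N\<^sup>2) holomorphic_on ball (0::complex) 1" by (intro holomorphic_intros)
      have "(\<lambda>Q. Q ^ N\<^sup>2) ` ball 0 1 \<subseteq> ball (0::complex) 1"
        using N by (auto simp: norm_power power_less_one_iff)
      from holomorphic_on_compose_gen[OF p P'(1) this]
      have "(\<lambda>Q. P' (Q ^ N\<^sup>2)) holomorphic_on ball 0 1" by (simp add: o_def)
      then show ?thesis unfolding F_def using g by (intro holomorphic_intros) auto
    qed
    define c where "c n = (deriv ^^ n) F 0 / fact n" for n
    have "(\<lambda>n. c n * qpow \<tau> (of_int (- int k + int n) / real (8 * N\<^sup>2))) sums (cocyc A \<tau> powr (- of_int 1 / 2) * f (moebius A \<tau>))"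
      if H: "\<tau> \<in> \<H>" for \<tau>
    proof -
      have t: "0 < Im \<tau>" using H by simp
      define Q where "Q = qpow \<tau> l"
      have Q: "Q \<in> ball 0 1" "Q \<noteq> 0" using norm_qpow_less_1[OF t l0] by (auto simp: Q_def)
      have "(\<lambda>n. c n * (Q - 0) ^ n) sums F Q" unfolding c_def by (rule holomorphic_power_series[OF holF Q(1)])
      then have "(\<lambda>n. 1 / Q ^ k * (c n * Q ^ n)) sums (1 / Q ^ k * F Q)" by (intro sums_mult) simp
      moreover have "1 / Q ^ k * (c n * Q ^ n) = c n * qpow \<tau> (of_int (- int k + int n) / real (8 * N\<^sup>2))" for n
      proof -
        have "of_int (- int k + int n) / real (8 * N\<^sup>2) = (real n - real k) * l"
          by (simp add: l_def)
        also have "\<dots> = - (real k * l) + real n * l" by (simp add: left_diff_distrib)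
        finally have "qpow \<tau> (of_int (- int k + int n) / real (8 * N\<^sup>2)) = qpow \<tau> (- (real k * l) + real n * l)"
          by simp
        also have "\<dots> = 1 / Q ^ k * Q ^ n" unfolding qpow_add qpow_minus Q_def qpow_power ..
        finally show ?thesis by simp
      qed
      moreover have "1 / Q ^ k * F Q = cocyc A \<tau> powr (- of_int 1 / 2) * f (moebius A \<tau>)"
      proof -
        have "qpow \<tau> (1/8) = Q ^ N\<^sup>2" unfolding Q_def qpow_power l_def using N by simp
        then have PQ: "P \<tau> = P' (Q ^ N\<^sup>2)" using P'(2) by simp
        have "cocyc A \<tau> powr (- of_int 1 / 2) * f (moebius A \<tau>) = - E * ((cocyc A \<tau> powr (- 1 / 2) * J \<tau>) * P \<tau> / thn r' s' \<tau>)"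
          unfolding f_transform[OF A J t] r'_def s'_def by simp
        also have "\<dots> = - E * (\<kappa> * P' (Q ^ N\<^sup>2) / (Q ^ k * g Q))"
          unfolding \<kappa>[OF H] PQ T Q_def[symmetric] g(2)[OF Q(1)] ..
        finally show ?thesis by (simp add: F_def)
      qed
      ultimately show ?thesis by simp
    qed
    moreover have "8 * N\<^sup>2 > 0" using N by simp
    ultimately show ?thesis by blast
  qed
  have "weakly_holomorphic_modform stabilizer 1 f"
    unfolding weakly_holomorphic_modform_def
    using stabilizer_finite_index stabilizer_subset hol law cusp by blast
  then show ?thesis unfolding f_def by blast
qed

theorem theorem1p5:
  shows "(\<forall>\<tau>\<in>upper_half_plane. \<forall>\<alpha>::complex. (\<forall>m n::int. \<alpha> \<noteq> of_int m * \<tau> + of_int n) \<longrightarrow>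
            K_comb \<alpha> \<tau> = - (eta \<tau> ^ 4 / (eta (2 * \<tau>) ^ 2 * theta \<alpha> \<tau>)))
       \<and> (\<exists>\<Gamma>. meromorphic_jacobi_form \<Gamma> 1 (-1)
            (\<lambda>\<alpha> \<tau>. - (eta \<tau> ^ 4 / (eta (2 * \<tau>) ^ 2 * theta \<alpha> \<tau>))))
       \<and> (\<forall>r s::real. r \<in> \<rat> \<and> s \<in> \<rat> \<and> \<not> (r \<in> \<int> \<and> s \<in> \<int>) \<longrightarrow>
            (\<exists>\<Gamma>. weakly_holomorphic_modform \<Gamma> 1
              (\<lambda>\<tau>. qpow \<tau> (- (r^2) / 2) * K_comb (of_real r * \<tau> + of_real s) \<tau>)))"
proof (intro conjI ballI allI impI)
  fix \<tau> \<alpha> :: complex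
  assume "\<tau> \<in> upper_half_plane" "\<forall>m n::int. \<alpha> \<noteq> of_int m * \<tau> + of_int n"
  then show "K_comb \<alpha> \<tau> = - (eta \<tau> ^ 4 / (eta (2 * \<tau>) ^ 2 * theta \<alpha> \<tau>))"
    by (intro K_comb_eq) auto
next
  show "\<exists>\<Gamma>. meromorphic_jacobi_form \<Gamma> 1 (-1) (\<lambda>\<alpha> \<tau>. - (eta \<tau> ^ 4 / (eta (2 * \<tau>) ^ 2 * theta \<alpha> \<tau>)))"
    using jacobi_form unfolding jacobi_quotient_def[abs_def] .
next
  fix r s :: real
  assume "r \<in> \<rat> \<and> s \<in> \<rat> \<and> \<not> (r \<in> \<int> \<and> s \<in> \<int>)"
  then show "\<exists>\<Gamma>. weakly_holomorphic_modform \<Gamma> 1 (\<lambda>\<tau>. qpow \<tau> (- (r^2) / 2) * K_comb (of_real r * \<tau> + of_real s) \<tau>)"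
    by (intro torsion_modular_form) auto
qed

end
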